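(* Let $A, H, H'$ be Hopf algebras over $k$, let $\lambda: H \otimes A \to k$, $\lambda': H' \otimes A \to k$ be two skew pairings of Hopf algebras, and let $D_{\lambda}(A, H)$ and $D_{\lambda'}(A, H')$ be the associated generalized quantum doubles. The following are equivalent: (1) There exists a left $A$-linear Hopf algebra isomorphism $D_{\lambda}(A, H) \cong D_{\lambda'}(A, H')$. (2) There exists a pair of maps $(r, v)$, where $r: H \to A$ is a unitary cocentral map and $v: H \to H'$ is a unitary isomorphism of coalgebras, satisfying for all $a \in A$, $g, h \in H$: \begin{align*} r(hg) &= r(h_{(1)}) \, r(g_{(2)}) \, \lambda' \bigl( v(h_{(2)}), \, r(g_{(3)}) \, S_A ( r(g_{(1)})) \bigr),\\ v(hg) &= v(h_{(2)}) \, v(g_{(2)})\, \lambda' \bigl( S_{H'} (v(h_{(1)}))\, v(h_{(3)}), \, r(g_{(1)})\bigr),\\ v(h_{(2)}) \, \lambda \bigl(S_H (h_{(1)}) h_{(3)}, \, a \bigr) &= v(h_{(2)}) \, \lambda' \bigl(S_{H'} (v(h_{(1)})) \, v(h_{(3)}), \, a \bigr),\\ a_{(2)}\, r(h_{(2)}) \, \lambda \bigl(S_H (h_{(1)}), a_{(1)} \bigr) \, \lambda \bigl(h_{(3)}, a_{(3)} \bigr) &= r(h_{(1)})\, a_{(2)} \, \lambda' \bigl( v(h_{(3)}), a_{(3)} \bigr) \, \lambda' \bigl( S_{H'}(v(h_{(2)})), a_{(1)} \bigr). \end{align*}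
   Context: $k$ is a field; all algebras, coalgebras, Hopf algebras, tensor products and homomorphisms are over $k$. Sweedler notation is used; $S_A, S_H, S_{H'}$ are the antipodes. A map $f$ between Hopf algebras is unitary if $f(1)=1$. A coalgebra map $r: H \to A$ is cocentral if $r(h_{(1)}) \otimes h_{(2)} = r(h_{(2)}) \otimes h_{(1)}$ for all $h \in H$. A skew pairing $\lambda : H \otimes A \to k$ is a $k$-linear map with $\lambda(hg, a) = \lambda(h, a_{(1)}) \lambda(g, a_{(2)})$, $\lambda(h, ab) = \lambda(h_{(1)}, b) \lambda(h_{(2)}, a)$, $\lambda(1, a) = \varepsilon_A(a)$, $\lambda(h, 1) = \varepsilon_H(h)$ for all $h, g \in H$, $a, b \in A$; its convolution inverse is $\lambda^{-1}(h,a) = \lambda(S_H(h), a)$. The generalized quantum double $D_\lambda(A, H)$ is the Hopf algebra with underlying space $A \otimes H$ (elements $a \bowtie h := a \otimes h$), unit $1_A \bowtie 1_H$, tensor product coalgebra structure, and multiplication $(a \bowtie h)(c \bowtie g) = a (h_{(1)} \triangleright c_{(1)}) \bowtie (h_{(2)} \triangleleft c_{(2)}) g$, where $$h \triangleleft a = h_{(2)} \, \lambda^{-1}(h_{(1)}, a_{(1)}) \, \lambda(h_{(3)}, a_{(2)}) = h_{(2)}\, \lambda\bigl(S_H(h_{(1)}) h_{(3)}, a\bigr),$$ $$h \triangleright a = a_{(2)} \, \lambda^{-1}(h_{(1)}, a_{(1)}) \, \lambda(h_{(2)}, a_{(3)}) = a_{(2)}\, \lambda\bigl(S_H(h), a_{(1)}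 S_A(a_{(3)})\bigr).$$ It is a left $A$-module by left multiplication through the inclusion $a \mapsto a \bowtie 1_H$. $D_{\lambda'}(A, H')$ is defined in the same way. *)

theory Defs
  imports "HOL-Algebra.Module" "HOL-Algebra.RingHom" "HOL-Algebra.Free_Abelian_Groups"
begin

section \<open>Linear algebra over a commutative ring\<close>

definition linear_map ::
  "('k, 'r) ring_scheme \<Rightarrow> ('k, 'a, 'm) module_scheme \<Rightarrow> ('k, 'b, 'n) module_scheme
    \<Rightarrow> ('a \<Rightarrow> 'b) \<Rightarrow> bool" where
  "linear_map K M N f \<longleftrightarrow>
     f \<in> carrier M \<rightarrow> carrier N \<and>
     (\<forall>x\<in>carrier M. \<forall>y\<in>carrier M. f (x \<oplus>\<^bsub>M\<^esub> y) = f x \<oplus>\<^bsub>N\<^esub> f y) \<and>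
     (\<forall>c\<in>carrier K. \<forall>x\<in>carrier M. f (c \<odot>\<^bsub>M\<^esub> x) = c \<odot>\<^bsub>N\<^esub> f x)"

definition linear_form ::
  "('k, 'r) ring_scheme \<Rightarrow> ('k, 'a, 'm) module_scheme \<Rightarrow> ('a \<Rightarrow> 'k) \<Rightarrow> bool" where
  "linear_form K M f \<longleftrightarrow>
     f \<in> carrier M \<rightarrow> carrier K \<and>
     (\<forall>x\<in>carrier M. \<forall>y\<in>carrier M. f (x \<oplus>\<^bsub>M\<^esub> y) = f x \<oplus>\<^bsub>K\<^esub> f y) \<and>
     (\<forall>c\<in>carrier K. \<forall>x\<in>carrier M. f (c \<odot>\<^bsub>M\<^esub> x) = c \<otimes>\<^bsub>K\<^esub> f x)"

definition bilinear_form ::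
  "('k, 'r) ring_scheme \<Rightarrow> ('k, 'a, 'm) module_scheme \<Rightarrow> ('k, 'b, 'n) module_scheme
    \<Rightarrow> ('a \<Rightarrow> 'b \<Rightarrow> 'k) \<Rightarrow> bool" where
  "bilinear_form K M N f \<longleftrightarrow>
     (\<forall>x\<in>carrier M. linear_form K N (f x)) \<and>
     (\<forall>y\<in>carrier N. linear_form K M (\<lambda>x. f x y))"


section \<open>Tensor products\<close>

text \<open>The tensor product of \<open>M\<close> and \<open>N\<close> is the free abelian group on
  \<open>carrier M \<times> carrier N\<close> modulo the subgroup generated by the usual relations;
  a tensor is thus a coset of formal \<open>\<int>\<close>-linear combinations of pairs.\<close>

type_synonym ('a, 'b) tensor = "(('a \<times> 'b) \<Rightarrow>\<^sub>0 int) set"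

definition tensor_relations ::
  "('k, 'r) ring_scheme \<Rightarrow> ('k, 'a, 'm) module_scheme \<Rightarrow> ('k, 'b, 'n) module_scheme
    \<Rightarrow> (('a \<times> 'b) \<Rightarrow>\<^sub>0 int) set" where
  "tensor_relations K M N =
     {frag_of (x \<oplus>\<^bsub>M\<^esub> x', y) - frag_of (x, y) - frag_of (x', y) | x x' y.
        x \<in> carrier M \<and> x' \<in> carrier M \<and> y \<in> carrier N} \<union>
     {frag_of (x, y \<oplus>\<^bsub>N\<^esub> y') - frag_of (x, y) - frag_of (x, y') | x y y'.
        x \<in> carrier M \<and> y \<in> carrier N \<and> y' \<in> carrier N} \<union>
     {frag_of (c \<odot>\<^bsub>M\<^esub> x, y) - frag_of (x, c \<odot>\<^bsub>N\<^esub> y) | c x y.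
        c \<in> carrier K \<and> x \<in> carrier M \<and> y \<in> carrier N}"

definition tensor_null ::
  "('k, 'r) ring_scheme \<Rightarrow> ('k, 'a, 'm) module_scheme \<Rightarrow> ('k, 'b, 'n) module_scheme
    \<Rightarrow> ('a, 'b) tensor" where
  "tensor_null K M N =
     generate (free_Abelian_group (carrier M \<times> carrier N)) (tensor_relations K M N)"

definition tensor_group ::
  "('k, 'r) ring_scheme \<Rightarrow> ('k, 'a, 'm) module_scheme \<Rightarrow> ('k, 'b, 'n) module_scheme
    \<Rightarrow> ('a, 'b) tensor monoid" where
  "tensor_group K M N =
     free_Abelian_group (carrier M \<times> carrier N) Mod tensor_null K M N"

definition tensor_of ::
  "('k, 'r) ring_scheme \<Rightarrow> ('k, 'a, 'm) module_scheme \<Rightarrow> ('k, 'b, 'n) module_scheme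
    \<Rightarrow> 'a \<Rightarrow> 'b \<Rightarrow> ('a, 'b) tensor" where
  "tensor_of K M N x y =
     tensor_null K M N #>\<^bsub>free_Abelian_group (carrier M \<times> carrier N)\<^esub> frag_of (x, y)"

text \<open>A scalar \<open>c\<close> acts by \<open>x \<otimes> y \<mapsto> (c x) \<otimes> y\<close>, computed on representatives.
  The ring fields of the record, which play no role for a module, are left unspecified.\<close>

definition tensor_module ::
  "('k, 'r) ring_scheme \<Rightarrow> ('k, 'a, 'm) module_scheme \<Rightarrow> ('k, 'b, 'n) module_scheme
    \<Rightarrow> ('k, ('a, 'b) tensor) module" where
  "tensor_module K M N =
     \<lparr>carrier = carrier (tensor_group K M N),
      monoid.mult = undefined,
      monoid.one = undefined,
      ring.zero = \<one>\<^bsub>tensor_group K M N\<^esub>,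
      ring.add = (\<lambda>X Y. X \<otimes>\<^bsub>tensor_group K M N\<^esub> Y),
      module.smult = (\<lambda>c X. tensor_null K M N <#>\<^bsub>free_Abelian_group (carrier M \<times> carrier N)\<^esub>
                 (frag_extend (\<lambda>(x, y). frag_of (c \<odot>\<^bsub>M\<^esub> x, y)) ` X))\<rparr>"

text \<open>\<open>tensor_lift P f\<close> is the additive map on tensors, with values in \<open>P\<close>, that sends
  \<open>x \<otimes> y\<close> to \<open>f x y\<close>. It is meaningful if \<open>f\<close> is bilinear: then all representatives
  of a tensor yield the same value, so that the image below is a singleton.\<close>

definition tensor_lift ::
  "('p, 'm) ring_scheme \<Rightarrow> ('a \<Rightarrow> 'b \<Rightarrow> 'p) \<Rightarrow> ('a, 'b) tensor \<Rightarrow> 'p" where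
  "tensor_lift P f X =
     the_elem ((\<lambda>u. \<Oplus>\<^bsub>P\<^esub>p\<in>Poly_Mapping.keys u.
                  [Poly_Mapping.lookup u p] \<cdot>\<^bsub>P\<^esub> f (fst p) (snd p)) ` X)"

definition tensor_algebra ::
  "('k, 'r) ring_scheme \<Rightarrow> ('k, 'a, 'm) module_scheme \<Rightarrow> ('k, 'b, 'n) module_scheme
    \<Rightarrow> ('k, ('a, 'b) tensor) module" where
  "tensor_algebra K A B = (tensor_module K A B)
     \<lparr>monoid.mult := (\<lambda>X Y.
        tensor_lift (tensor_module K A B) (\<lambda>a b.
          tensor_lift (tensor_module K A B) (\<lambda>a' b'.
            tensor_of K A B (a \<otimes>\<^bsub>A\<^esub> a') (b \<otimes>\<^bsub>B\<^esub> b')) Y) X),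
      monoid.one := tensor_of K A B \<one>\<^bsub>A\<^esub> \<one>\<^bsub>B\<^esub>\<rparr>"


section \<open>Hopf algebras\<close>

record ('k, 'a) hopf = "('k, 'a) module" +
  comult :: "'a \<Rightarrow> ('a, 'a) tensor"
  counit :: "'a \<Rightarrow> 'k"
  antipode :: "'a \<Rightarrow> 'a"

text \<open>Sweedler notation: for multilinear \<open>f\<close> with values in \<open>P\<close>, these are
  \<open>f(h\<^sub>(\<^sub>1\<^sub>), h\<^sub>(\<^sub>2\<^sub>))\<close> and \<open>f(h\<^sub>(\<^sub>1\<^sub>), h\<^sub>(\<^sub>2\<^sub>), h\<^sub>(\<^sub>3\<^sub>))\<close>,
  the latter read off from \<open>(id \<otimes> \<Delta>) \<Delta>(h)\<close>.\<close>

definition sweedler2 ::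
  "('k, 'a, 'm) hopf_scheme \<Rightarrow> ('p, 'n) ring_scheme \<Rightarrow> 'a \<Rightarrow> ('a \<Rightarrow> 'a \<Rightarrow> 'p) \<Rightarrow> 'p" where
  "sweedler2 H P h f = tensor_lift P f (comult H h)"

definition sweedler3 ::
  "('k, 'a, 'm) hopf_scheme \<Rightarrow> ('p, 'n) ring_scheme \<Rightarrow> 'a \<Rightarrow> ('a \<Rightarrow> 'a \<Rightarrow> 'a \<Rightarrow> 'p) \<Rightarrow> 'p" where
  "sweedler3 H P h f =
     sweedler2 H P h (\<lambda>h1 h'. sweedler2 H P h' (\<lambda>h2 h3. f h1 h2 h3))"

locale algebra_over =
  fixes K :: "('k, 'r) ring_scheme" and A :: "('k, 'a, 'm) module_scheme"
  assumes field_K: "field K"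
    and module_A: "Module.module K A"
    and ring_A: "ring A"
    and smult_mult_left: "\<lbrakk>c \<in> carrier K; x \<in> carrier A; y \<in> carrier A\<rbrakk>
          \<Longrightarrow> (c \<odot>\<^bsub>A\<^esub> x) \<otimes>\<^bsub>A\<^esub> y = c \<odot>\<^bsub>A\<^esub> (x \<otimes>\<^bsub>A\<^esub> y)"
    and smult_mult_right: "\<lbrakk>c \<in> carrier K; x \<in> carrier A; y \<in> carrier A\<rbrakk>
          \<Longrightarrow> x \<otimes>\<^bsub>A\<^esub> (c \<odot>\<^bsub>A\<^esub> y) = c \<odot>\<^bsub>A\<^esub> (x \<otimes>\<^bsub>A\<^esub> y)"

locale coalgebra_over =
  fixes K :: "('k, 'r) ring_scheme" and C :: "('k, 'a, 'm) hopf_scheme"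
  assumes field_K: "field K"
    and module_C: "Module.module K C"
    and comult_linear: "linear_map K C (tensor_module K C C) (comult C)"
    and counit_linear: "linear_form K C (counit C)"
    and coassoc: "x \<in> carrier C \<Longrightarrow>
          sweedler2 C (tensor_module K C (tensor_module K C C)) x (\<lambda>x1 x2.
            sweedler2 C (tensor_module K C (tensor_module K C C)) x1 (\<lambda>y z.
              tensor_of K C (tensor_module K C C) y (tensor_of K C C z x2)))
          = sweedler2 C (tensor_module K C (tensor_module K C C)) x (\<lambda>x1 x2.
              tensor_of K C (tensor_module K C C) x1 (comult C x2))"
    and counit_left: "x \<in> carrier C \<Longrightarrow>
          sweedler2 C C x (\<lambda>x1 x2. counit C x1 \<odot>\<^bsub>C\<^esub> x2) = x"
    and counit_right: "x \<in> carrier C \<Longrightarrow>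
          sweedler2 C C x (\<lambda>x1 x2. counit C x2 \<odot>\<^bsub>C\<^esub> x1) = x"

locale hopf_algebra = algebra_over K H + coalgebra_over K H
  for K :: "('k, 'r) ring_scheme" and H :: "('k, 'a, 'm) hopf_scheme" +
  assumes comult_mult: "\<lbrakk>x \<in> carrier H; y \<in> carrier H\<rbrakk>
          \<Longrightarrow> comult H (x \<otimes>\<^bsub>H\<^esub> y) = comult H x \<otimes>\<^bsub>tensor_algebra K H H\<^esub> comult H y"
    and comult_one: "comult H \<one>\<^bsub>H\<^esub> = \<one>\<^bsub>tensor_algebra K H H\<^esub>"
    and counit_mult: "\<lbrakk>x \<in> carrier H; y \<in> carrier H\<rbrakk>
          \<Longrightarrow> counit H (x \<otimes>\<^bsub>H\<^esub> y) = counit H x \<otimes>\<^bsub>K\<^esub> counit H y"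
    and counit_one: "counit H \<one>\<^bsub>H\<^esub> = \<one>\<^bsub>K\<^esub>"
    and antipode_linear: "linear_map K H H (antipode H)"
    and antipode_left: "x \<in> carrier H \<Longrightarrow>
          sweedler2 H H x (\<lambda>x1 x2. antipode H x1 \<otimes>\<^bsub>H\<^esub> x2) = counit H x \<odot>\<^bsub>H\<^esub> \<one>\<^bsub>H\<^esub>"
    and antipode_right: "x \<in> carrier H \<Longrightarrow>
          sweedler2 H H x (\<lambda>x1 x2. x1 \<otimes>\<^bsub>H\<^esub> antipode H x2) = counit H x \<odot>\<^bsub>H\<^esub> \<one>\<^bsub>H\<^esub>"

definition coalgebra_map ::
  "('k, 'r) ring_scheme \<Rightarrow> ('k, 'a, 'm) hopf_scheme \<Rightarrow> ('k, 'b, 'n) hopf_scheme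
    \<Rightarrow> ('a \<Rightarrow> 'b) \<Rightarrow> bool" where
  "coalgebra_map K C D f \<longleftrightarrow>
     linear_map K C D f \<and>
     (\<forall>x\<in>carrier C. comult D (f x) =
        sweedler2 C (tensor_module K D D) x (\<lambda>x1 x2. tensor_of K D D (f x1) (f x2))) \<and>
     (\<forall>x\<in>carrier C. counit D (f x) = counit C x)"

definition coalgebra_iso ::
  "('k, 'r) ring_scheme \<Rightarrow> ('k, 'a, 'm) hopf_scheme \<Rightarrow> ('k, 'b, 'n) hopf_scheme
    \<Rightarrow> ('a \<Rightarrow> 'b) \<Rightarrow> bool" where
  "coalgebra_iso K C D f \<longleftrightarrow>
     coalgebra_map K C D f \<and> bij_betw f (carrier C) (carrier D)"

text \<open>As usual, a morphism of Hopf algebras is a map of algebras and coalgebras;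
  it commutes with the antipodes automatically.\<close>

definition hopf_iso ::
  "('k, 'r) ring_scheme \<Rightarrow> ('k, 'a, 'm) hopf_scheme \<Rightarrow> ('k, 'b, 'n) hopf_scheme
    \<Rightarrow> ('a \<Rightarrow> 'b) \<Rightarrow> bool" where
  "hopf_iso K H L f \<longleftrightarrow>
     f \<in> ring_hom H L \<and> coalgebra_map K H L f \<and> bij_betw f (carrier H) (carrier L)"

definition unitary ::
  "('k, 'a, 'm) hopf_scheme \<Rightarrow> ('k, 'b, 'n) hopf_scheme \<Rightarrow> ('a \<Rightarrow> 'b) \<Rightarrow> bool" where
  "unitary H L f \<longleftrightarrow> f \<one>\<^bsub>H\<^esub> = \<one>\<^bsub>L\<^esub>"

definition cocentral_map ::
  "('k, 'r) ring_scheme \<Rightarrow> ('k, 'h, 'm) hopf_scheme \<Rightarrow> ('k, 'a, 'n) hopf_scheme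
    \<Rightarrow> ('h \<Rightarrow> 'a) \<Rightarrow> bool" where
  "cocentral_map K H A r \<longleftrightarrow>
     coalgebra_map K H A r \<and>
     (\<forall>h\<in>carrier H.
        sweedler2 H (tensor_module K A H) h (\<lambda>h1 h2. tensor_of K A H (r h1) h2) =
        sweedler2 H (tensor_module K A H) h (\<lambda>h1 h2. tensor_of K A H (r h2) h1))"


section \<open>Skew pairings and generalized quantum doubles\<close>

text \<open>A linear map \<open>H \<otimes> A \<rightarrow> K\<close> is given by the bilinear form \<open>(h, a) \<mapsto> \<lambda>(h \<otimes> a)\<close>.\<close>

definition skew_pairing ::
  "('k, 'r) ring_scheme \<Rightarrow> ('k, 'h, 'm) hopf_scheme \<Rightarrow> ('k, 'a, 'n) hopf_scheme
    \<Rightarrow> ('h \<Rightarrow> 'a \<Rightarrow> 'k) \<Rightarrow> bool" where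
  "skew_pairing K H A l \<longleftrightarrow>
     bilinear_form K H A l \<and>
     (\<forall>h\<in>carrier H. \<forall>g\<in>carrier H. \<forall>a\<in>carrier A.
        l (h \<otimes>\<^bsub>H\<^esub> g) a = sweedler2 A K a (\<lambda>a1 a2. l h a1 \<otimes>\<^bsub>K\<^esub> l g a2)) \<and>
     (\<forall>h\<in>carrier H. \<forall>a\<in>carrier A. \<forall>b\<in>carrier A.
        l h (a \<otimes>\<^bsub>A\<^esub> b) = sweedler2 H K h (\<lambda>h1 h2. l h1 b \<otimes>\<^bsub>K\<^esub> l h2 a)) \<and>
     (\<forall>a\<in>carrier A. l \<one>\<^bsub>H\<^esub> a = counit A a) \<and>
     (\<forall>h\<in>carrier H. l h \<one>\<^bsub>A\<^esub> = counit H h)"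

definition pairing_inv ::
  "('k, 'h, 'm) hopf_scheme \<Rightarrow> ('h \<Rightarrow> 'a \<Rightarrow> 'k) \<Rightarrow> 'h \<Rightarrow> 'a \<Rightarrow> 'k" where
  "pairing_inv H l h a = l (antipode H h) a"

text \<open>\<open>act_right K A H l h a\<close> is \<open>h \<triangleleft> a\<close>, an element of \<open>H\<close>,
  and \<open>act_left K A H l h a\<close> is \<open>h \<triangleright> a\<close>, an element of \<open>A\<close>.\<close>

definition act_right ::
  "('k, 'r) ring_scheme \<Rightarrow> ('k, 'a, 'n) hopf_scheme \<Rightarrow> ('k, 'h, 'm) hopf_scheme
    \<Rightarrow> ('h \<Rightarrow> 'a \<Rightarrow> 'k) \<Rightarrow> 'h \<Rightarrow> 'a \<Rightarrow> 'h" where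
  "act_right K A H l h a =
     sweedler3 H H h (\<lambda>h1 h2 h3. sweedler2 A H a (\<lambda>a1 a2.
       (pairing_inv H l h1 a1 \<otimes>\<^bsub>K\<^esub> l h3 a2) \<odot>\<^bsub>H\<^esub> h2))"

definition act_left ::
  "('k, 'r) ring_scheme \<Rightarrow> ('k, 'a, 'n) hopf_scheme \<Rightarrow> ('k, 'h, 'm) hopf_scheme
    \<Rightarrow> ('h \<Rightarrow> 'a \<Rightarrow> 'k) \<Rightarrow> 'h \<Rightarrow> 'a \<Rightarrow> 'a" where
  "act_left K A H l h a =
     sweedler2 H A h (\<lambda>h1 h2. sweedler3 A A a (\<lambda>a1 a2 a3.
       (pairing_inv H l h1 a1 \<otimes>\<^bsub>K\<^esub> l h2 a3) \<odot>\<^bsub>A\<^esub> a2))"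

definition double_mult ::
  "('k, 'r) ring_scheme \<Rightarrow> ('k, 'a, 'n) hopf_scheme \<Rightarrow> ('k, 'h, 'm) hopf_scheme
    \<Rightarrow> ('h \<Rightarrow> 'a \<Rightarrow> 'k) \<Rightarrow> ('a, 'h) tensor \<Rightarrow> ('a, 'h) tensor \<Rightarrow> ('a, 'h) tensor" where
  "double_mult K A H l X Y =
     tensor_lift (tensor_module K A H) (\<lambda>a h.
       tensor_lift (tensor_module K A H) (\<lambda>c g.
         sweedler2 H (tensor_module K A H) h (\<lambda>h1 h2.
           sweedler2 A (tensor_module K A H) c (\<lambda>c1 c2.
             tensor_of K A H (a \<otimes>\<^bsub>A\<^esub> act_left K A H l h1 c1)
                             (act_right K A H l h2 c2 \<otimes>\<^bsub>H\<^esub> g)))) Y) X"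

text \<open>The antipode of the double is \<open>a \<bowtie> h \<mapsto> (1 \<bowtie> S\<^sub>H(h)) (S\<^sub>A(a) \<bowtie> 1)\<close>,
  as forced by \<open>a \<bowtie> h = (a \<bowtie> 1) (1 \<bowtie> h)\<close>.\<close>

definition quantum_double ::
  "('k, 'r) ring_scheme \<Rightarrow> ('k, 'a, 'n) hopf_scheme \<Rightarrow> ('k, 'h, 'm) hopf_scheme
    \<Rightarrow> ('h \<Rightarrow> 'a \<Rightarrow> 'k) \<Rightarrow> ('k, ('a, 'h) tensor) hopf" where
  "quantum_double K A H l =
     (let T = tensor_module K A H in
      \<lparr>carrier = carrier T,
       monoid.mult = double_mult K A H l,
       monoid.one = tensor_of K A H \<one>\<^bsub>A\<^esub> \<one>\<^bsub>H\<^esub>,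
       ring.zero = \<zero>\<^bsub>T\<^esub>,
       ring.add = ring.add T,
       module.smult = module.smult T,
       comult = tensor_lift (tensor_module K T T) (\<lambda>a h.
         sweedler2 A (tensor_module K T T) a (\<lambda>a1 a2.
           sweedler2 H (tensor_module K T T) h (\<lambda>h1 h2.
             tensor_of K T T (tensor_of K A H a1 h1) (tensor_of K A H a2 h2)))),
       counit = tensor_lift K (\<lambda>a h. counit A a \<otimes>\<^bsub>K\<^esub> counit H h),
       antipode = tensor_lift T (\<lambda>a h.
         double_mult K A H l (tensor_of K A H \<one>\<^bsub>A\<^esub> (antipode H h))
                             (tensor_of K A H (antipode A a) \<one>\<^bsub>H\<^esub>))\<rparr>)"

text \<open>Left \<open>A\<close>-linearity of a map between two doubles of \<open>A\<close>, where \<open>A\<close> acts by left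
  multiplication through \<open>a \<mapsto> a \<bowtie> 1\<close>.\<close>

definition left_linear ::
  "('k, 'r) ring_scheme \<Rightarrow> ('k, 'a, 'n) hopf_scheme
    \<Rightarrow> ('k, 'h, 'm) hopf_scheme \<Rightarrow> ('h \<Rightarrow> 'a \<Rightarrow> 'k)
    \<Rightarrow> ('k, 'g, 'q) hopf_scheme \<Rightarrow> ('g \<Rightarrow> 'a \<Rightarrow> 'k)
    \<Rightarrow> (('a, 'h) tensor \<Rightarrow> ('a, 'g) tensor) \<Rightarrow> bool" where
  "left_linear K A H l H' l' f \<longleftrightarrow>
     (\<forall>a\<in>carrier A. \<forall>X\<in>carrier (quantum_double K A H l).
        f (tensor_of K A H a \<one>\<^bsub>H\<^esub> \<otimes>\<^bsub>quantum_double K A H l\<^esub> X) =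
        tensor_of K A H' a \<one>\<^bsub>H'\<^esub> \<otimes>\<^bsub>quantum_double K A H' l'\<^esub> f X)"

end

theory Submission
  imports Defs
begin

text \<open>Write \<open>h \<triangleright> c\<close> and \<open>h \<triangleleft> c\<close> for the two actions attached to \<open>\<lambda>\<close>, and \<open>\<triangleright>'\<close>, \<open>\<triangleleft>'\<close> for those
  attached to \<open>\<lambda>'\<close>. A left \<open>A\<close>-linear map \<open>f\<close> between the doubles is determined by its restriction
  \<open>F(h) = f(1 \<bowtie> h)\<close>, as \<open>f(a \<bowtie> h) = a F(h)\<close>. The proof translates each property of \<open>f\<close> into
  one of \<open>F\<close> and then into properties of the components \<open>r = (id \<otimes> \<epsilon>) F\<close> and
  \<open>v = (\<epsilon> \<otimes> id) F\<close>.

  Coalgebra structure. The double has the tensor product coalgebra structure, so a coalgebra map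
  into it is the product of its components, in either order of the legs:
  \<open>F(h) = r(h\<^sub>1) \<otimes> v(h\<^sub>2) = r(h\<^sub>2) \<otimes> v(h\<^sub>1)\<close> (lemma \<open>f_eq\<close>). Linearity
  over \<open>A\<close> shows that \<open>f\<close> induces \<open>v\<close> on the quotient \<open>H\<close> of the double by the
  augmentation of \<open>A\<close>; hence \<open>v\<close> is bijective if \<open>f\<close> is, and applying \<open>v\<^sup>-\<^sup>1\<close> to the
  equality of the two orders yields that \<open>r\<close> is cocentral. Conversely, cocentrality of \<open>r\<close> is what
  makes \<open>a \<bowtie> h \<mapsto> a r(h\<^sub>1) \<bowtie> v(h\<^sub>2)\<close> comultiplicative, and
  \<open>a \<bowtie> y \<mapsto> a S(r(h\<^sub>1)) \<bowtie> h\<^sub>2\<close> with \<open>h = v\<^sup>-\<^sup>1(y)\<close> is its inverse.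

  Algebra structure. Since \<open>a \<bowtie> h = (a \<bowtie> 1)(1 \<bowtie> h)\<close>, a left linear map is multiplicative if
  and only if \<open>F(hg) = F(h) F(g)\<close> and \<open>f((1 \<bowtie> h)(c \<bowtie> 1)) = F(h)(c \<bowtie> 1)\<close>. Both sides of
  both equations are products of their two components, so each equation amounts to two, one in \<open>A\<close>
  and one in \<open>H'\<close>:
  \<^item> \<open>r(hg) = r(h\<^sub>1) (v(h\<^sub>2) \<triangleright>' r(g))\<close> and \<open>v(hg) = (v(h) \<triangleleft>' r(g\<^sub>1)) v(g\<^sub>2)\<close>,
  \<^item> \<open>(h\<^sub>1 \<triangleright> c\<^sub>1) r(h\<^sub>2 \<triangleleft> c\<^sub>2) = r(h\<^sub>1) (v(h\<^sub>2) \<triangleright>' c)\<close> and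
    \<open>v(h \<triangleleft> c) = v(h) \<triangleleft>' c\<close>.

  These are the four conditions of the theorem, written with the actions. In the first of them the
  translation uses that the square of the antipode fixes the image of a cocentral map, because that
  image is cocommutative (\<open>cocentral_antipode_twice\<close>).

  Cancellations in long Sweedler expressions all come from one operator: conjugation
  \<open>F \<mapsto> \<lambda>\<^sup>-\<^sup>1 * F * \<lambda>\<close> in the convolution algebra of maps on \<open>H \<otimes> A\<close>. It is
  multiplicative (\<open>conv_conjugate\<close>). The actions are the conjugates of \<open>\<epsilon> \<otimes> id\<close> and
  \<open>id \<otimes> \<epsilon>\<close>, the product \<open>(a \<bowtie> h)(c \<bowtie> g)\<close> is the conjugate of
  \<open>(h, c) \<mapsto> a c \<otimes> h g\<close>, and \<open>(h\<^sub>1 \<triangleright> c\<^sub>1) r(h\<^sub>2 \<triangleleft> c\<^sub>2)\<close> is the conjugate of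
  \<open>(h, c) \<mapsto> c r(h)\<close>.

  On the technical side, a Sweedler expression is evaluated as a finite sum over a fixed decomposition
  of the coproduct into pure tensors. This makes exchange of sums and linearity in parameters
  independent of multilinearity, which then enters through coassociativity, the counit and
  the antipode.\<close>

section \<open>Tensor products of modules\<close>

subsection \<open>Evaluation of formal combinations\<close>

text \<open>The formula inside \<open>tensor_lift\<close>, before it is read on cosets.\<close>

definition frag_eval ::
  "('p, 'm) ring_scheme \<Rightarrow> ('a \<Rightarrow> 'b \<Rightarrow> 'p) \<Rightarrow> (('a \<times> 'b) \<Rightarrow>\<^sub>0 int) \<Rightarrow> 'p" where
  "frag_eval P f u =
     (\<Oplus>\<^bsub>P\<^esub>p\<in>Poly_Mapping.keys u. [Poly_Mapping.lookup u p] \<cdot>\<^bsub>P\<^esub> f (fst p) (snd p))"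

lemma (in abelian_group) frag_eval_superset:
  assumes f: "\<And>x y. (x, y) \<in> F \<Longrightarrow> f x y \<in> carrier G"
    and F: "finite F" "Poly_Mapping.keys u \<subseteq> F"
  shows "frag_eval G f u = (\<Oplus>p\<in>F. [Poly_Mapping.lookup u p] \<cdot> f (fst p) (snd p))"
  unfolding frag_eval_def
proof (rule add.finprod_mono_neutral_cong_left)
  show "finite F" "Poly_Mapping.keys u \<subseteq> F" by (fact F)+
  show "[Poly_Mapping.lookup u p] \<cdot> f (fst p) (snd p) = \<zero>"
    if "p \<in> F - Poly_Mapping.keys u" for p
    using that f[of "fst p" "snd p"] by (simp add: in_keys_iff add_pow_def)
  show "(\<lambda>p. [Poly_Mapping.lookup u p] \<cdot> f (fst p) (snd p)) \<in> F \<rightarrow> carrier G"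
    using f by (auto intro!: add.int_pow_closed)
qed auto

lemma (in abelian_group) frag_eval_closed:
  assumes "\<And>x y. (x, y) \<in> S \<Longrightarrow> f x y \<in> carrier G" and "Poly_Mapping.keys u \<subseteq> S"
  shows "frag_eval G f u \<in> carrier G"
  unfolding frag_eval_def using assms by (intro finsum_closed) (auto intro!: add.int_pow_closed)

lemma (in abelian_group) frag_eval_add:
  assumes f: "\<And>x y. (x, y) \<in> S \<Longrightarrow> f x y \<in> carrier G"
    and u: "Poly_Mapping.keys u \<subseteq> S" and v: "Poly_Mapping.keys v \<subseteq> S"
  shows "frag_eval G f (u + v) = frag_eval G f u \<oplus> frag_eval G f v"
proof -
  let ?F = "Poly_Mapping.keys u \<union> Poly_Mapping.keys v"
  have F: "\<And>x y. (x, y) \<in> ?F \<Longrightarrow> f x y \<in> carrier G"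
    using f u v by auto
  have fin: "finite ?F" by simp
  have "frag_eval G f (u + v)
      = (\<Oplus>p\<in>?F. [Poly_Mapping.lookup (u + v) p] \<cdot> f (fst p) (snd p))"
    by (rule frag_eval_superset[OF F fin keys_add])
  also have "\<dots> = (\<Oplus>p\<in>?F. [Poly_Mapping.lookup u p] \<cdot> f (fst p) (snd p)
                      \<oplus> [Poly_Mapping.lookup v p] \<cdot> f (fst p) (snd p))"
    using F by (intro finsum_cong')
       (auto simp: lookup_add add.int_pow_mult intro!: add.int_pow_closed a_closed)
  also have "\<dots> = (\<Oplus>p\<in>?F. [Poly_Mapping.lookup u p] \<cdot> f (fst p) (snd p))
                 \<oplus> (\<Oplus>p\<in>?F. [Poly_Mapping.lookup v p] \<cdot> f (fst p) (snd p))"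
    using F by (intro finsum_addf) (auto intro!: add.int_pow_closed)
  also have "\<dots> = frag_eval G f u \<oplus> frag_eval G f v"
    using frag_eval_superset[of ?F f u] frag_eval_superset[of ?F f v] F fin by auto
  finally show ?thesis .
qed

lemma (in abelian_group) frag_eval_frag_of:
  assumes "f x y \<in> carrier G"
  shows "frag_eval G f (frag_of (x, y)) = f x y"
  using assms by (simp add: frag_eval_def add.int_pow_1)

lemma (in abelian_group) frag_eval_zero: "frag_eval G f 0 = \<zero>"
  by (simp add: frag_eval_def)

lemma (in abelian_group) frag_eval_minus:
  assumes f: "\<And>x y. (x, y) \<in> S \<Longrightarrow> f x y \<in> carrier G" and u: "Poly_Mapping.keys u \<subseteq> S"
  shows "frag_eval G f (- u) = \<ominus> frag_eval G f u"
proof -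
  have "frag_eval G f (- u) \<oplus> frag_eval G f u = frag_eval G f (- u + u)"
    using frag_eval_add[of S f "- u" u] f u by simp
  then have "frag_eval G f (- u) \<oplus> frag_eval G f u = \<zero>"
    by (simp add: frag_eval_zero)
  then show ?thesis
    using frag_eval_closed[of S f u] frag_eval_closed[of S f "- u"] f u
    by (intro minus_equality[symmetric]) auto
qed

lemma (in abelian_group) frag_eval_diff:
  assumes f: "\<And>x y. (x, y) \<in> S \<Longrightarrow> f x y \<in> carrier G"
    and u: "Poly_Mapping.keys u \<subseteq> S" and v: "Poly_Mapping.keys v \<subseteq> S"
  shows "frag_eval G f (u - v) = frag_eval G f u \<ominus> frag_eval G f v"
  using frag_eval_add[of S f u "- v"] frag_eval_minus[of S f v] f u v by (simp add: a_minus_def)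

text \<open>Bilinearity in the form that makes sense for values in an abelian group. It is what the universal
  property of the tensor product uses, and it covers values in the field, which carries no
  scalar multiplication as a record.\<close>

definition balanced ::
  "('k, 'r) ring_scheme \<Rightarrow> ('k, 'a, 'm) module_scheme \<Rightarrow> ('k, 'b, 'n) module_scheme
    \<Rightarrow> ('p, 'q) ring_scheme \<Rightarrow> ('a \<Rightarrow> 'b \<Rightarrow> 'p) \<Rightarrow> bool" where
  "balanced K M N P f \<longleftrightarrow>
     (\<forall>x\<in>carrier M. \<forall>y\<in>carrier N. f x y \<in> carrier P) \<and>
     (\<forall>x\<in>carrier M. \<forall>x'\<in>carrier M. \<forall>y\<in>carrier N. f (x \<oplus>\<^bsub>M\<^esub> x') y = f x y \<oplus>\<^bsub>P\<^esub> f x' y) \<and>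
     (\<forall>x\<in>carrier M. \<forall>y\<in>carrier N. \<forall>y'\<in>carrier N. f x (y \<oplus>\<^bsub>N\<^esub> y') = f x y \<oplus>\<^bsub>P\<^esub> f x y') \<and>
     (\<forall>c\<in>carrier K. \<forall>x\<in>carrier M. \<forall>y\<in>carrier N. f (c \<odot>\<^bsub>M\<^esub> x) y = f x (c \<odot>\<^bsub>N\<^esub> y))"

locale module_pair = M: Module.module K M + N: Module.module K N
  for K :: "('k, 'r) ring_scheme" and M :: "('k, 'a, 'm) module_scheme"
    and N :: "('k, 'b, 'n) module_scheme"
begin

abbreviation "pairs \<equiv> carrier M \<times> carrier N"
abbreviation "F \<equiv> free_Abelian_group pairs"
abbreviation "null \<equiv> tensor_null K M N"
abbreviation "T \<equiv> tensor_module K M N"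
abbreviation "pure_tensor \<equiv> tensor_of K M N"

lemma diff_carrier: "u \<in> carrier F \<Longrightarrow> v \<in> carrier F \<Longrightarrow> u - v \<in> carrier F"
  using keys_diff[of u v] by (simp add: subset_iff) blast

lemma relations_carrier: "tensor_relations K M N \<subseteq> carrier F"
  unfolding tensor_relations_def
  by (intro Un_least subsetI; elim CollectE exE conjE; hypsubst)
    (intro diff_carrier; simp)+

lemma normal_null: "null \<lhd> F"
  unfolding tensor_null_def
  by (intro comm_group.normal_iff_subgroup[THEN iffD2] abelian_free_Abelian_group
      group.generate_is_subgroup group_free_Abelian_group relations_carrier)

lemma null_carrier: "null \<subseteq> carrier F"
  using normal_null by (simp add: normal_imp_subgroup subgroup.subset)

lemma null_rel: "u \<in> tensor_relations K M N \<Longrightarrow> u \<in> null"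
  unfolding tensor_null_def by (rule generate.incl)

lemma null_induct [consumes 1, case_names zero rel neg add]:
  assumes "u \<in> null" "Q 0" "\<And>r. r \<in> tensor_relations K M N \<Longrightarrow> Q r"
    "\<And>r. r \<in> tensor_relations K M N \<Longrightarrow> Q (- r)"
    "\<And>u v. u \<in> null \<Longrightarrow> v \<in> null \<Longrightarrow> Q u \<Longrightarrow> Q v \<Longrightarrow> Q (u + v)"
  shows "Q u"
  using assms(1) unfolding tensor_null_def
proof (induction rule: generate.induct)
  case (inv h)
  then show ?case
    using assms(4) relations_carrier by (auto simp: subset_iff)
qed (use assms in \<open>auto simp: tensor_null_def\<close>)

definition coset :: "(('a \<times> 'b) \<Rightarrow>\<^sub>0 int) \<Rightarrow> ('a, 'b) tensor" where
  "coset u = null #>\<^bsub>F\<^esub> u"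

lemma coset_eq: "coset u = (\<lambda>n. n + u) ` null"
  by (auto simp: coset_def r_coset_def)

lemma tensor_of_coset: "pure_tensor x y = coset (frag_of (x, y))"
  by (simp add: tensor_of_def coset_def)

lemma carrier_T: "carrier T = coset ` carrier F"
  by (auto simp: tensor_module_def tensor_group_def carrier_FactGroup coset_def)

lemma add_coset: "u \<in> carrier F \<Longrightarrow> v \<in> carrier F \<Longrightarrow> coset u \<oplus>\<^bsub>T\<^esub> coset v = coset (u + v)"
  using normal.rcos_sum[OF normal_null, of u v]
  by (simp add: tensor_module_def tensor_group_def coset_def del: carrier_free_Abelian_group_iff)

lemma zero_T: "\<zero>\<^bsub>T\<^esub> = coset 0"
proof -
  have "null #>\<^bsub>F\<^esub> \<one>\<^bsub>F\<^esub> = null"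
    using group.coset_mult_one[OF group_free_Abelian_group null_carrier] .
  then show ?thesis
    by (simp add: tensor_module_def tensor_group_def coset_def)
qed

text \<open>Formal combinations that differ by the subgroup of relations represent the same tensor.\<close>

lemma coset_cong: "u - v \<in> null \<Longrightarrow> coset u = coset v"
proof -
  assume uv: "u - v \<in> null"
  have neg: "n \<in> null \<Longrightarrow> - n \<in> null" and add: "n \<in> null \<Longrightarrow> m \<in> null \<Longrightarrow> n + m \<in> null" for n m
  proof -
    have sub: "subgroup null F" using normal_null by (simp add: normal_imp_subgroup)
    show "n \<in> null \<Longrightarrow> - n \<in> null"
      using subgroup.m_inv_closed[OF sub, of n] null_carrier by (auto simp: subset_iff)
    show "n \<in> null \<Longrightarrow> m \<in> null \<Longrightarrow> n + m \<in> null"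
      using subgroup.m_closed[OF sub, of n m] by simp
  qed
  have "n + u \<in> (\<lambda>n. n + v) ` null" if "n \<in> null" for n
    using add[OF that uv] by (intro image_eqI[of _ _ "n + (u - v)"]) auto
  moreover have "n + v \<in> (\<lambda>n. n + u) ` null" if "n \<in> null" for n
    using add[OF that neg[OF uv]] by (intro image_eqI[of _ _ "n + - (u - v)"]) auto
  ultimately show ?thesis
    by (auto simp: coset_eq)
qed

lemma abelian_group_T: "abelian_group T"
proof -
  have "comm_group (tensor_group K M N)"
    unfolding tensor_group_def
    by (rule comm_group.abelian_FactGroup[OF abelian_free_Abelian_group
          normal_imp_subgroup[OF normal_null]])
  then interpret G: comm_group "tensor_group K M N" .
  show ?thesis
  proof (rule abelian_groupI)
    fix x assume "x \<in> carrier T"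
    then show "\<exists>y\<in>carrier T. y \<oplus>\<^bsub>T\<^esub> x = \<zero>\<^bsub>T\<^esub>"
      using G.l_inv_ex by (auto simp: tensor_module_def)
  qed (simp_all add: tensor_module_def G.m_ac)
qed

text \<open>The relations are the differences on which every balanced map vanishes, so the evaluation of
  a balanced map descends to tensors.\<close>

lemma frag_eval_null:
  assumes P: "abelian_group P" and f: "balanced K M N P f" and u: "u \<in> null"
  shows "frag_eval P f u = \<zero>\<^bsub>P\<^esub>"
proof -
  interpret P: abelian_group P by (fact P)
  have fc: "f x y \<in> carrier P" if "(x, y) \<in> pairs" for x y
    using f that by (auto simp: balanced_def)
  have keys1: "Poly_Mapping.keys (frag_of p - frag_of q) \<subseteq> pairs"
    if "p \<in> pairs" "q \<in> pairs" for p q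
    using diff_carrier[of "frag_of p" "frag_of q"] that by simp
  have ev: "frag_eval P f (frag_of (x, y)) = f x y" if "x \<in> carrier M" "y \<in> carrier N" for x y
    using fc that by (simp add: P.frag_eval_frag_of)
  have diff2: "frag_eval P f (frag_of p - frag_of q)
      = frag_eval P f (frag_of p) \<ominus>\<^bsub>P\<^esub> frag_eval P f (frag_of q)"
    if "p \<in> pairs" "q \<in> pairs" for p q
    by (rule P.frag_eval_diff[of pairs, OF fc]) (use that in auto)
  have diff3: "frag_eval P f (frag_of p - frag_of q - frag_of r)
      = (frag_eval P f (frag_of p) \<ominus>\<^bsub>P\<^esub> frag_eval P f (frag_of q)) \<ominus>\<^bsub>P\<^esub> frag_eval P f (frag_of r)"
    if "p \<in> pairs" "q \<in> pairs" "r \<in> pairs" for p q r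
    using that P.frag_eval_diff[of pairs f "frag_of p - frag_of q" "frag_of r", OF fc keys1]
    by (simp add: diff2)
  have cancel: "((a \<oplus>\<^bsub>P\<^esub> b) \<ominus>\<^bsub>P\<^esub> a) \<ominus>\<^bsub>P\<^esub> b = \<zero>\<^bsub>P\<^esub>"
    if "a \<in> carrier P" "b \<in> carrier P" for a b
  proof -
    have "b \<oplus>\<^bsub>P\<^esub> (\<ominus>\<^bsub>P\<^esub> a \<oplus>\<^bsub>P\<^esub> \<ominus>\<^bsub>P\<^esub> b) = \<ominus>\<^bsub>P\<^esub> a"
      using that by (simp add: P.a_lcomm[of b] P.r_neg)
    then show ?thesis
      using that by (simp add: a_minus_def P.a_assoc P.r_neg)
  qed
  have rel: "frag_eval P f r = \<zero>\<^bsub>P\<^esub>" if "r \<in> tensor_relations K M N" for r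
    using that unfolding tensor_relations_def
  proof (elim UnE CollectE exE conjE)
    fix x x' y
    assume r: "r = frag_of (x \<oplus>\<^bsub>M\<^esub> x', y) - frag_of (x, y) - frag_of (x', y)"
      and xy: "x \<in> carrier M" "x' \<in> carrier M" "y \<in> carrier N"
    have "f (x \<oplus>\<^bsub>M\<^esub> x') y = f x y \<oplus>\<^bsub>P\<^esub> f x' y"
      using f xy by (auto simp: balanced_def)
    then show ?thesis
      using xy unfolding r by (simp add: diff3 ev cancel fc)
  next
    fix x y y'
    assume r: "r = frag_of (x, y \<oplus>\<^bsub>N\<^esub> y') - frag_of (x, y) - frag_of (x, y')"
      and xy: "x \<in> carrier M" "y \<in> carrier N" "y' \<in> carrier N"
    have "f x (y \<oplus>\<^bsub>N\<^esub> y') = f x y \<oplus>\<^bsub>P\<^esub> f x y'"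
      using f xy by (auto simp: balanced_def)
    then show ?thesis
      using xy unfolding r by (simp add: diff3 ev cancel fc)
  next
    fix c x y
    assume r: "r = frag_of (c \<odot>\<^bsub>M\<^esub> x, y) - frag_of (x, c \<odot>\<^bsub>N\<^esub> y)"
      and xy: "c \<in> carrier K" "x \<in> carrier M" "y \<in> carrier N"
    have "f (c \<odot>\<^bsub>M\<^esub> x) y = f x (c \<odot>\<^bsub>N\<^esub> y)"
      using f xy by (auto simp: balanced_def)
    then show ?thesis
      using xy unfolding r by (simp add: diff2 ev fc P.r_neg a_minus_def)
  qed
  show ?thesis
    using u
  proof (induction rule: null_induct)
    case (neg r)
    then show ?case
      using P.frag_eval_minus[of pairs f r, OF fc] relations_carrier rel by (auto simp: subset_iff)
  next
    case (add u v)
    then show ?case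
      using P.frag_eval_add[of pairs f u v, OF fc] null_carrier by (auto simp: subset_iff)
  qed (use P.frag_eval_zero rel in auto)
qed

text \<open>The evaluation is constant on a coset, so \<open>the_elem\<close> is applied to a singleton.\<close>

lemma tensor_lift_coset:
  assumes P: "abelian_group P" and f: "balanced K M N P f" and u: "u \<in> carrier F"
  shows "tensor_lift P f (coset u) = frag_eval P f u"
proof -
  interpret P: abelian_group P by (fact P)
  have fc: "f x y \<in> carrier P" if "(x, y) \<in> pairs" for x y
    using f that by (auto simp: balanced_def)
  have "frag_eval P f (n + u) = frag_eval P f u" if "n \<in> null" for n
  proof -
    have "frag_eval P f (n + u) = \<zero>\<^bsub>P\<^esub> \<oplus>\<^bsub>P\<^esub> frag_eval P f u"
      using P.frag_eval_add[of pairs f n u, OF fc] frag_eval_null[OF P f that] null_carrier that u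
      by (auto simp: subset_iff)
    then show ?thesis
      using P.frag_eval_closed[of pairs f u, OF fc] u by simp
  qed
  moreover have "0 \<in> null"
    using generate.one[of F] by (simp add: tensor_null_def)
  ultimately have "frag_eval P f ` coset u = {frag_eval P f u}"
    by (auto simp: coset_eq image_image intro!: image_eqI)
  then show ?thesis
    by (simp add: tensor_lift_def frag_eval_def[abs_def])
qed

lemma tensor_of_closed: "x \<in> carrier M \<Longrightarrow> y \<in> carrier N \<Longrightarrow> pure_tensor x y \<in> carrier T"
  by (auto simp: tensor_of_coset carrier_T intro!: imageI)

lemma frag_in: "p \<in> pairs \<Longrightarrow> frag_of p \<in> carrier F"
  by simp

lemma tensor_of_add_left:
  assumes "x \<in> carrier M" "x' \<in> carrier M" "y \<in> carrier N"
  shows "pure_tensor (x \<oplus>\<^bsub>M\<^esub> x') y = pure_tensor x y \<oplus>\<^bsub>T\<^esub> pure_tensor x' y"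
proof -
  have "frag_of (x \<oplus>\<^bsub>M\<^esub> x', y) - frag_of (x, y) - frag_of (x', y) \<in> null"
    using assms by (intro null_rel) (auto simp: tensor_relations_def)
  then have "coset (frag_of (x \<oplus>\<^bsub>M\<^esub> x', y)) = coset (frag_of (x, y) + frag_of (x', y))"
    by (intro coset_cong) (simp add: algebra_simps)
  then show ?thesis
    using assms by (subst (2 3) tensor_of_coset) (simp add: add_coset frag_in tensor_of_coset)
qed

lemma tensor_of_add_right:
  assumes "x \<in> carrier M" "y \<in> carrier N" "y' \<in> carrier N"
  shows "pure_tensor x (y \<oplus>\<^bsub>N\<^esub> y') = pure_tensor x y \<oplus>\<^bsub>T\<^esub> pure_tensor x y'"
proof -
  have "frag_of (x, y \<oplus>\<^bsub>N\<^esub> y') - frag_of (x, y) - frag_of (x, y') \<in> null"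
    using assms by (intro null_rel) (auto simp: tensor_relations_def)
  then have "coset (frag_of (x, y \<oplus>\<^bsub>N\<^esub> y')) = coset (frag_of (x, y) + frag_of (x, y'))"
    by (intro coset_cong) (simp add: algebra_simps)
  then show ?thesis
    using assms by (subst (2 3) tensor_of_coset) (simp add: add_coset frag_in tensor_of_coset)
qed

lemma tensor_of_smult_swap:
  assumes "c \<in> carrier K" "x \<in> carrier M" "y \<in> carrier N"
  shows "pure_tensor (c \<odot>\<^bsub>M\<^esub> x) y = pure_tensor x (c \<odot>\<^bsub>N\<^esub> y)"
proof -
  have "frag_of (c \<odot>\<^bsub>M\<^esub> x, y) - frag_of (x, c \<odot>\<^bsub>N\<^esub> y) \<in> null"
    using assms by (intro null_rel) (auto simp: tensor_relations_def)
  then show ?thesis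
    by (simp add: tensor_of_coset coset_cong)
qed

lemma tensor_lift_tensor_of:
  assumes "abelian_group P" "balanced K M N P f" "x \<in> carrier M" "y \<in> carrier N"
  shows "tensor_lift P f (pure_tensor x y) = f x y"
proof -
  have "tensor_lift P f (pure_tensor x y) = frag_eval P f (frag_of (x, y))"
    unfolding tensor_of_coset using assms by (intro tensor_lift_coset frag_in) auto
  also have "\<dots> = f x y"
    using assms by (intro abelian_group.frag_eval_frag_of) (auto simp: balanced_def)
  finally show ?thesis .
qed

lemma tensor_lift_closed:
  assumes P: "abelian_group P" and f: "balanced K M N P f" and X: "X \<in> carrier T"
  shows "tensor_lift P f X \<in> carrier P"
proof -
  obtain u where u: "u \<in> carrier F" "X = coset u"
    using X by (auto simp: carrier_T)
  then show ?thesis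
    using abelian_group.frag_eval_closed[OF P, of pairs f u] f
    by (simp add: tensor_lift_coset[OF P f] balanced_def)
qed

lemma tensor_lift_add:
  assumes P: "abelian_group P" and f: "balanced K M N P f"
    and X: "X \<in> carrier T" and Y: "Y \<in> carrier T"
  shows "tensor_lift P f (X \<oplus>\<^bsub>T\<^esub> Y) = tensor_lift P f X \<oplus>\<^bsub>P\<^esub> tensor_lift P f Y"
proof -
  obtain u v where u: "u \<in> carrier F" "X = coset u" and v: "v \<in> carrier F" "Y = coset v"
    using X Y by (auto simp: carrier_T)
  have uv: "u + v \<in> carrier F"
    using u v keys_add[of u v] by auto
  show ?thesis
    using abelian_group.frag_eval_add[OF P, of pairs f u v] f u v
    by (simp add: add_coset tensor_lift_coset[OF P f uv] tensor_lift_coset[OF P f]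
        balanced_def)
qed

text \<open>The scalar action on representatives is the lift of the balanced map
  \<open>(x, y) \<mapsto> c x \<otimes> y\<close>, which gives it all its properties.\<close>

lemma balanced_smult:
  assumes "c \<in> carrier K"
  shows "balanced K M N T (\<lambda>x y. pure_tensor (c \<odot>\<^bsub>M\<^esub> x) y)"
proof -
  have "c \<odot>\<^bsub>M\<^esub> (d \<odot>\<^bsub>M\<^esub> x) = d \<odot>\<^bsub>M\<^esub> (c \<odot>\<^bsub>M\<^esub> x)" if "d \<in> carrier K" "x \<in> carrier M" for d x
    using assms that by (simp add: M.smult_assoc1[symmetric] M.R.m_comm)
  then show ?thesis
    using assms
    by (simp add: balanced_def tensor_of_closed tensor_of_add_left tensor_of_add_right
        M.smult_r_distr tensor_of_smult_swap)
qed

text \<open>The map \<open>\<phi>\<close> that acts on representatives preserves the subgroup of relations, whence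
  adding that subgroup to the image of a coset gives the coset of an image.\<close>

lemma smult_T_eq_lift:
  assumes c: "c \<in> carrier K" and X: "X \<in> carrier T"
  shows "c \<odot>\<^bsub>T\<^esub> X = tensor_lift T (\<lambda>x y. pure_tensor (c \<odot>\<^bsub>M\<^esub> x) y) X"
proof -
  interpret T: abelian_group T by (rule abelian_group_T)
  let ?\<phi> = "frag_extend (\<lambda>(x, y). frag_of (c \<odot>\<^bsub>M\<^esub> x, y)) :: _ \<Rightarrow> (('a \<times> 'b) \<Rightarrow>\<^sub>0 int)"
  let ?g = "\<lambda>x y. pure_tensor (c \<odot>\<^bsub>M\<^esub> x) y"
  have g: "?g x y \<in> carrier T" if "(x, y) \<in> pairs" for x y
    using that c by (auto intro: tensor_of_closed)
  have \<phi>_closed: "?\<phi> u \<in> carrier F" if "u \<in> carrier F" for u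
    using that c keys_frag_extend[of "\<lambda>(x, y). frag_of (c \<odot>\<^bsub>M\<^esub> x, y)" u]
    by (fastforce simp: subset_iff)
  have \<phi>: "coset (?\<phi> u) = frag_eval T ?g u" if "u \<in> carrier F" for u
  proof -
    have "Poly_Mapping.keys u \<subseteq> pairs" using that by simp
    then show ?thesis
    proof (induction rule: free_Abelian_group_induct [consumes 1])
      case 1
      then show ?case by (simp add: T.frag_eval_zero zero_T)
    next
      case (2 u v)
      have keys: "Poly_Mapping.keys (u - v) \<subseteq> pairs"
        using 2 keys_diff[of u v] by auto
      have u: "u \<in> carrier F" and v: "v \<in> carrier F" and uv: "u - v \<in> carrier F"
        using 2 keys by auto
      have "coset (?\<phi> (u - v)) \<oplus>\<^bsub>T\<^esub> coset (?\<phi> v) = coset (?\<phi> u)"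
        using add_coset[OF \<phi>_closed[OF uv] \<phi>_closed[OF v]]
        by (simp add: frag_extend_diff)
      also have "\<dots> = frag_eval T ?g (u - v) \<oplus>\<^bsub>T\<^esub> frag_eval T ?g v"
        using 2 T.frag_eval_add[of pairs ?g "u - v" v, OF g] keys by simp
      finally show ?case
        using 2 \<phi>_closed[OF uv] T.frag_eval_closed[of pairs ?g "u - v", OF g]
          T.frag_eval_closed[of pairs ?g v, OF g] keys
        by (simp add: T.add.right_cancel carrier_T)
    next
      case (3 p)
      then show ?case
        using g by (cases p) (simp add: T.frag_eval_frag_of tensor_of_coset)
    qed
  qed
  obtain u where u: "u \<in> carrier F" and Xu: "X = coset u"
    using X by (auto simp: carrier_T)
  have null: "m + n \<in> null" if "m \<in> null" "n \<in> null" for m n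
    using subgroup.m_closed[OF normal_imp_subgroup[OF normal_null] that] by simp
  have zero: "0 \<in> null"
    using generate.one[of F] by (simp add: tensor_null_def)
  have \<phi>_null: "?\<phi> n \<in> null" if "n \<in> null" for n
  proof -
    have n: "n \<in> carrier F" using that null_carrier by blast
    have "coset (?\<phi> n) = \<zero>\<^bsub>T\<^esub>"
      using frag_eval_null[OF abelian_group_T balanced_smult[OF c] that] \<phi>[OF n] by simp
    moreover have "?\<phi> n \<in> coset (?\<phi> n)"
      using zero by (auto simp: coset_eq intro!: image_eqI)
    ultimately show ?thesis by (auto simp: zero_T coset_eq)
  qed
  have "c \<odot>\<^bsub>T\<^esub> X = null <#>\<^bsub>F\<^esub> (?\<phi> ` X)"
    by (simp add: tensor_module_def)
  also have "\<dots> = coset (?\<phi> u)"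
  proof
    show "null <#>\<^bsub>F\<^esub> (?\<phi> ` X) \<subseteq> coset (?\<phi> u)"
    proof
      fix w assume "w \<in> null <#>\<^bsub>F\<^esub> (?\<phi> ` X)"
      then obtain m n where mn: "m \<in> null" "n \<in> null" and w: "w = m + ?\<phi> (n + u)"
        unfolding set_mult_def Xu coset_eq mult_free_Abelian_group by blast
      have "w = (m + ?\<phi> n) + ?\<phi> u"
        by (simp only: w frag_extend_add add.assoc)
      then show "w \<in> coset (?\<phi> u)"
        unfolding coset_eq using null[OF mn(1) \<phi>_null[OF mn(2)]] by (rule image_eqI)
    qed
    show "coset (?\<phi> u) \<subseteq> null <#>\<^bsub>F\<^esub> (?\<phi> ` X)"
    proof
      fix w assume "w \<in> coset (?\<phi> u)"
      then obtain m where m: "m \<in> null" and w: "w = m + ?\<phi> u"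
        unfolding coset_eq by blast
      have "u \<in> X"
        unfolding Xu coset_eq using zero by (intro image_eqI[of _ _ 0]) simp_all
      then show "w \<in> null <#>\<^bsub>F\<^esub> (?\<phi> ` X)"
        unfolding set_mult_def mult_free_Abelian_group w using m by blast
    qed
  qed
  also have "\<dots> = tensor_lift T ?g X"
    using \<phi>[OF u] u by (simp add: Xu tensor_lift_coset[OF abelian_group_T balanced_smult[OF c]])
  finally show ?thesis .
qed

lemma smult_tensor_of:
  assumes "c \<in> carrier K" "x \<in> carrier M" "y \<in> carrier N"
  shows "c \<odot>\<^bsub>T\<^esub> pure_tensor x y = pure_tensor (c \<odot>\<^bsub>M\<^esub> x) y"
  using assms
  by (simp add: smult_T_eq_lift tensor_of_closed tensor_lift_tensor_of[OF abelian_group_T balanced_smult])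

text \<open>Zero and negatives are themselves pure tensors or sums of such, as
  \<open>-(x \<otimes> y) = (-x) \<otimes> y\<close>; hence closure under sums suffices. The statement for \<open>coset u\<close> and
  \<open>coset (- u)\<close> together makes the induction over differences go through.\<close>

lemma tensor_induct [consumes 1, case_names pure add]:
  assumes X: "X \<in> carrier T"
    and pure: "\<And>x y. x \<in> carrier M \<Longrightarrow> y \<in> carrier N \<Longrightarrow> Q (pure_tensor x y)"
    and add: "\<And>X Y. X \<in> carrier T \<Longrightarrow> Y \<in> carrier T \<Longrightarrow> Q X \<Longrightarrow> Q Y \<Longrightarrow> Q (X \<oplus>\<^bsub>T\<^esub> Y)"
  shows "Q X"
proof -
  interpret T: abelian_group T by (rule abelian_group_T)
  have zero: "pure_tensor \<zero>\<^bsub>M\<^esub> \<zero>\<^bsub>N\<^esub> = \<zero>\<^bsub>T\<^esub>"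
    using tensor_of_add_left[of "\<zero>\<^bsub>M\<^esub>" "\<zero>\<^bsub>M\<^esub>" "\<zero>\<^bsub>N\<^esub>"]
      tensor_of_closed[of "\<zero>\<^bsub>M\<^esub>" "\<zero>\<^bsub>N\<^esub>"] T.add.l_cancel_one' by simp
  have "Q (coset u) \<and> Q (coset (- u))" if "Poly_Mapping.keys u \<subseteq> pairs" for u
    using that
  proof (induction rule: free_Abelian_group_induct [consumes 1])
    case 1
    then show ?case using pure[of "\<zero>\<^bsub>M\<^esub>" "\<zero>\<^bsub>N\<^esub>"] zero by (simp add: zero_T)
  next
    case (2 u v)
    then have "Q (coset u \<oplus>\<^bsub>T\<^esub> coset (- v))" "Q (coset v \<oplus>\<^bsub>T\<^esub> coset (- u))"
      by (auto intro!: add simp: carrier_T)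
    then show ?case using 2 by (simp add: add_coset)
  next
    case (3 p)
    obtain x y where p: "p = (x, y)" "x \<in> carrier M" "y \<in> carrier N"
      using 3 by auto
    have minus: "coset (- frag_of p) \<in> carrier T"
      using p by (auto simp: carrier_T intro!: imageI)
    have "pure_tensor (\<ominus>\<^bsub>M\<^esub> x) y \<oplus>\<^bsub>T\<^esub> pure_tensor x y = pure_tensor \<zero>\<^bsub>M\<^esub> y"
      using p by (simp add: tensor_of_add_left[symmetric] M.M.l_neg)
    also have "\<dots> = \<zero>\<^bsub>T\<^esub>"
      using tensor_of_add_left[of "\<zero>\<^bsub>M\<^esub>" "\<zero>\<^bsub>M\<^esub>" y] p tensor_of_closed[of "\<zero>\<^bsub>M\<^esub>" y]
        T.add.l_cancel_one' by simp
    also have "\<dots> = coset (- frag_of p) \<oplus>\<^bsub>T\<^esub> pure_tensor x y"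
      using p by (simp add: zero_T tensor_of_coset add_coset)
    finally have "pure_tensor (\<ominus>\<^bsub>M\<^esub> x) y = coset (- frag_of p)"
      using p minus by (subst (asm) T.add.right_cancel) (auto simp: tensor_of_closed)
    moreover have "Q (pure_tensor (\<ominus>\<^bsub>M\<^esub> x) y)"
      using p by (intro pure) auto
    ultimately show ?case
      using p pure by (simp add: tensor_of_coset)
  qed
  then show ?thesis
    using X by (auto simp: carrier_T)
qed

lemma tensor_of_smult_right:
  assumes "c \<in> carrier K" "x \<in> carrier M" "y \<in> carrier N"
  shows "pure_tensor x (c \<odot>\<^bsub>N\<^esub> y) = c \<odot>\<^bsub>T\<^esub> pure_tensor x y"
  using assms by (simp add: smult_tensor_of tensor_of_smult_swap)

lemma module_T: "Module.module K T"
proof -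
  interpret T: abelian_group T by (rule abelian_group_T)
  have closed: "c \<odot>\<^bsub>T\<^esub> X \<in> carrier T" if "c \<in> carrier K" "X \<in> carrier T" for c X
    using that by (simp add: smult_T_eq_lift tensor_lift_closed abelian_group_T balanced_smult)
  have add: "c \<odot>\<^bsub>T\<^esub> (X \<oplus>\<^bsub>T\<^esub> Y) = c \<odot>\<^bsub>T\<^esub> X \<oplus>\<^bsub>T\<^esub> c \<odot>\<^bsub>T\<^esub> Y"
    if "c \<in> carrier K" "X \<in> carrier T" "Y \<in> carrier T" for c X Y
    using that by (simp add: smult_T_eq_lift tensor_lift_add abelian_group_T balanced_smult)
  show ?thesis
  proof (rule moduleI)
    show "cring K" by (rule M.R.is_cring)
    show "abelian_group T" by (rule abelian_group_T)
    show "(a \<oplus>\<^bsub>K\<^esub> b) \<odot>\<^bsub>T\<^esub> X = a \<odot>\<^bsub>T\<^esub> X \<oplus>\<^bsub>T\<^esub> b \<odot>\<^bsub>T\<^esub> X"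
      if "a \<in> carrier K" "b \<in> carrier K" "X \<in> carrier T" for a b X
      using that(3,1,2)
    proof (induction rule: tensor_induct)
      case (pure x y)
      then show ?case
        by (simp add: smult_tensor_of M.smult_l_distr tensor_of_add_left)
    next
      case (add X Y)
      then show ?case
        by (simp add: \<open>\<And>c X Y. _ \<Longrightarrow> _ \<Longrightarrow> _ \<Longrightarrow> c \<odot>\<^bsub>T\<^esub> (X \<oplus>\<^bsub>T\<^esub> Y) = _\<close> closed T.a_ac)
    qed
    show "(a \<otimes>\<^bsub>K\<^esub> b) \<odot>\<^bsub>T\<^esub> X = a \<odot>\<^bsub>T\<^esub> (b \<odot>\<^bsub>T\<^esub> X)"
      if "a \<in> carrier K" "b \<in> carrier K" "X \<in> carrier T" for a b X
      using that(3,1,2)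
    proof (induction rule: tensor_induct)
      case (pure x y)
      then show ?case
        by (simp add: smult_tensor_of M.smult_assoc1)
    qed (simp_all add: \<open>\<And>c X Y. _ \<Longrightarrow> _ \<Longrightarrow> _ \<Longrightarrow> c \<odot>\<^bsub>T\<^esub> (X \<oplus>\<^bsub>T\<^esub> Y) = _\<close> closed)
    show "\<one>\<^bsub>K\<^esub> \<odot>\<^bsub>T\<^esub> X = X" if "X \<in> carrier T" for X
      using that
      by (induction rule: tensor_induct)
        (simp_all add: smult_tensor_of \<open>\<And>c X Y. _ \<Longrightarrow> _ \<Longrightarrow> _ \<Longrightarrow> c \<odot>\<^bsub>T\<^esub> (X \<oplus>\<^bsub>T\<^esub> Y) = _\<close>)
  qed (use closed add in auto)
qed

end

section \<open>Linear maps and Sweedler sums\<close>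

text \<open>The field as a module over itself. It turns linear forms into linear maps and scalar-valued
  Sweedler expressions into instances of module-valued ones.\<close>

definition scalar_module :: "('k, 'r) ring_scheme \<Rightarrow> ('k, 'k) module" where
  "scalar_module K =
     \<lparr>carrier = carrier K, monoid.mult = (\<otimes>\<^bsub>K\<^esub>), monoid.one = \<one>\<^bsub>K\<^esub>, ring.zero = \<zero>\<^bsub>K\<^esub>,
      ring.add = (\<oplus>\<^bsub>K\<^esub>), module.smult = (\<otimes>\<^bsub>K\<^esub>)\<rparr>"

lemma scalar_module_simps [simp]:
  "carrier (scalar_module K) = carrier K"
  "(\<otimes>\<^bsub>scalar_module K\<^esub>) = (\<otimes>\<^bsub>K\<^esub>)" "\<one>\<^bsub>scalar_module K\<^esub> = \<one>\<^bsub>K\<^esub>"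
  "(\<oplus>\<^bsub>scalar_module K\<^esub>) = (\<oplus>\<^bsub>K\<^esub>)" "\<zero>\<^bsub>scalar_module K\<^esub> = \<zero>\<^bsub>K\<^esub>"
  "(\<odot>\<^bsub>scalar_module K\<^esub>) = (\<otimes>\<^bsub>K\<^esub>)"
  by (simp_all add: scalar_module_def)

definition bilinear_map ::
  "('k, 'r) ring_scheme \<Rightarrow> ('k, 'a, 'm) module_scheme \<Rightarrow> ('k, 'b, 'n) module_scheme
    \<Rightarrow> ('k, 'p, 'q) module_scheme \<Rightarrow> ('a \<Rightarrow> 'b \<Rightarrow> 'p) \<Rightarrow> bool" where
  "bilinear_map K M N P f \<longleftrightarrow>
     (\<forall>x\<in>carrier M. linear_map K N P (f x)) \<and> (\<forall>y\<in>carrier N. linear_map K M P (\<lambda>x. f x y))"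

primrec list_sum :: "('p, 'm) ring_scheme \<Rightarrow> 'p list \<Rightarrow> 'p" where
  "list_sum P [] = \<zero>\<^bsub>P\<^esub>"
| "list_sum P (x # xs) = x \<oplus>\<^bsub>P\<^esub> list_sum P xs"

text \<open>A tensor is a finite sum of pure tensors; a fixed choice of such a sum turns every
  expression in Sweedler notation into an honest finite sum. The value \<open>[]\<close> outside the tensor product
  puts the terms in the carriers for every \<open>X\<close>, so that congruence and closure rules have no
  hypothesis on \<open>X\<close>.\<close>

definition pure_terms ::
  "('k, 'r) ring_scheme \<Rightarrow> ('k, 'a, 'm) module_scheme \<Rightarrow> ('k, 'b, 'n) module_scheme
    \<Rightarrow> ('a, 'b) tensor \<Rightarrow> ('a \<times> 'b) list" where
  "pure_terms K M N X =
     (let xs = SOME xs. set xs \<subseteq> carrier M \<times> carrier N \<and>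
        X = list_sum (tensor_module K M N) (map (\<lambda>(x, y). tensor_of K M N x y) xs)
      in if set xs \<subseteq> carrier M \<times> carrier N then xs else [])"

text \<open>For bilinear \<open>f\<close> this is \<open>tensor_lift\<close> (lemma \<open>tensor_lift_tsum\<close>). As it is a finite sum
  for every \<open>f\<close>, sums can be exchanged and linear maps pulled through them whatever \<open>f\<close> is.\<close>

definition tensor_sum ::
  "('k, 'r) ring_scheme \<Rightarrow> ('k, 'a, 'm) module_scheme \<Rightarrow> ('k, 'b, 'n) module_scheme
    \<Rightarrow> ('p, 'q) ring_scheme \<Rightarrow> ('a, 'b) tensor \<Rightarrow> ('a \<Rightarrow> 'b \<Rightarrow> 'p) \<Rightarrow> 'p" where
  "tensor_sum K M N P X f = list_sum P (map (\<lambda>(x, y). f x y) (pure_terms K M N X))"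

definition sweedler_sum ::
  "('k, 'r) ring_scheme \<Rightarrow> ('k, 'a, 'm) hopf_scheme \<Rightarrow> ('p, 'q) ring_scheme
    \<Rightarrow> 'a \<Rightarrow> ('a \<Rightarrow> 'a \<Rightarrow> 'p) \<Rightarrow> 'p" where
  "sweedler_sum K C P x f = tensor_sum K C C P (comult C x) f"

lemma (in abelian_group) list_sum_closed:
  "set xs \<subseteq> carrier G \<Longrightarrow> list_sum G xs \<in> carrier G"
  by (induction xs) auto

lemma (in abelian_group) list_sum_append:
  "set xs \<subseteq> carrier G \<Longrightarrow> set ys \<subseteq> carrier G \<Longrightarrow>
    list_sum G (xs @ ys) = list_sum G xs \<oplus> list_sum G ys"
  by (induction xs) (simp_all add: list_sum_closed a_assoc)

lemma (in abelian_group) list_sum_add: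
  "(\<And>i. i \<in> set xs \<Longrightarrow> f i \<in> carrier G) \<Longrightarrow> (\<And>i. i \<in> set xs \<Longrightarrow> g i \<in> carrier G) \<Longrightarrow>
    list_sum G (map (\<lambda>i. f i \<oplus> g i) xs) = list_sum G (map f xs) \<oplus> list_sum G (map g xs)"
proof (induction xs)
  case (Cons x xs)
  moreover have "list_sum G (map f xs) \<in> carrier G" "list_sum G (map g xs) \<in> carrier G"
    using Cons by (auto intro!: list_sum_closed)
  ultimately show ?case by (simp add: a_ac)
qed simp

lemma (in abelian_group) list_sum_zero: "list_sum G (map (\<lambda>i. \<zero>) xs) = \<zero>"
  by (induction xs) auto

lemma (in abelian_group) list_sum_swap:
  assumes "\<And>i j. i \<in> set xs \<Longrightarrow> j \<in> set ys \<Longrightarrow> f i j \<in> carrier G"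
  shows "list_sum G (map (\<lambda>i. list_sum G (map (f i) ys)) xs)
    = list_sum G (map (\<lambda>j. list_sum G (map (\<lambda>i. f i j) xs)) ys)"
  using assms
proof (induction xs)
  case (Cons x xs)
  have "list_sum G (map (\<lambda>j. f x j \<oplus> list_sum G (map (\<lambda>i. f i j) xs)) ys)
     = list_sum G (map (f x) ys) \<oplus> list_sum G (map (\<lambda>j. list_sum G (map (\<lambda>i. f i j) xs)) ys)"
    using Cons.prems by (intro list_sum_add) (auto intro!: list_sum_closed)
  then show ?case
    using Cons by simp
qed (simp add: list_sum_zero)

locale scalars =
  fixes K :: "('k, 'r) ring_scheme"
  assumes field_K: "field K"
begin

sublocale K: field K by (rule field_K)

abbreviation "vs M \<equiv> Module.module K M"
abbreviation "lin \<equiv> linear_map K"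
abbreviation "bilin \<equiv> bilinear_map K"
abbreviation "tens \<equiv> tensor_of K"
abbreviation "KM \<equiv> scalar_module K"
abbreviation scalar_mult (infixl "\<bullet>" 70) where "c \<bullet> d \<equiv> c \<otimes>\<^bsub>K\<^esub> d"
abbreviation "tsum \<equiv> tensor_sum K"
abbreviation "sw \<equiv> sweedler_sum K"
abbreviation tensor_product (infixr "\<boxtimes>" 70) where "M \<boxtimes> N \<equiv> tensor_module K M N"

lemma vs_abelian: "vs M \<Longrightarrow> abelian_group M"
  by (simp add: Module.module_def)

lemma vs_KM [simp]: "vs KM"
proof (rule moduleI)
  show "cring K" by (rule K.is_cring)
  show "abelian_group KM"
    by (rule abelian_groupI) (auto simp: K.a_ac intro: K.l_neg)
qed (auto simp: K.l_distr K.r_distr K.m_assoc)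

lemma vs_tensor [simp]: "vs M \<Longrightarrow> vs N \<Longrightarrow> vs (M \<boxtimes> N)"
  by (rule module_pair.module_T) (rule module_pair.intro)

lemma vs_zero_closed: "vs M \<Longrightarrow> \<zero>\<^bsub>M\<^esub> \<in> carrier M"
  by (simp add: Module.module_def abelian_group_def abelian_monoid.zero_closed)

lemma vs_add_closed [simp]:
  "vs M \<Longrightarrow> x \<in> carrier M \<Longrightarrow> y \<in> carrier M \<Longrightarrow> x \<oplus>\<^bsub>M\<^esub> y \<in> carrier M"
  by (simp add: Module.module_def abelian_group_def abelian_monoid.a_closed)

lemma vs_smult_closed [simp]:
  "vs M \<Longrightarrow> c \<in> carrier K \<Longrightarrow> x \<in> carrier M \<Longrightarrow> c \<odot>\<^bsub>M\<^esub> x \<in> carrier M"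
  by (rule Module.module.smult_closed)

lemma vs_smult_one [simp]: "vs M \<Longrightarrow> x \<in> carrier M \<Longrightarrow> \<one>\<^bsub>K\<^esub> \<odot>\<^bsub>M\<^esub> x = x"
  by (rule Module.module.smult_one)

lemma vs_smult_smult:
  "vs M \<Longrightarrow> c \<in> carrier K \<Longrightarrow> d \<in> carrier K \<Longrightarrow> x \<in> carrier M \<Longrightarrow>
    c \<odot>\<^bsub>M\<^esub> (d \<odot>\<^bsub>M\<^esub> x) = (c \<otimes>\<^bsub>K\<^esub> d) \<odot>\<^bsub>M\<^esub> x"
  by (simp add: Module.module.smult_assoc1)

lemma linI:
  assumes "\<And>x. x \<in> carrier M \<Longrightarrow> f x \<in> carrier N"
    and "\<And>x y. x \<in> carrier M \<Longrightarrow> y \<in> carrier M \<Longrightarrow> f (x \<oplus>\<^bsub>M\<^esub> y) = f x \<oplus>\<^bsub>N\<^esub> f y"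
    and "\<And>c x. c \<in> carrier K \<Longrightarrow> x \<in> carrier M \<Longrightarrow> f (c \<odot>\<^bsub>M\<^esub> x) = c \<odot>\<^bsub>N\<^esub> f x"
  shows "lin M N f"
  using assms by (auto simp: linear_map_def)

lemma lin_closed: "lin M N f \<Longrightarrow> x \<in> carrier M \<Longrightarrow> f x \<in> carrier N"
  and lin_add: "lin M N f \<Longrightarrow> x \<in> carrier M \<Longrightarrow> y \<in> carrier M \<Longrightarrow> f (x \<oplus>\<^bsub>M\<^esub> y) = f x \<oplus>\<^bsub>N\<^esub> f y"
  and lin_scale: "lin M N f \<Longrightarrow> c \<in> carrier K \<Longrightarrow> x \<in> carrier M \<Longrightarrow> f (c \<odot>\<^bsub>M\<^esub> x) = c \<odot>\<^bsub>N\<^esub> f x"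
  by (auto simp: linear_map_def)

lemma lin_zero:
  assumes "vs M" "vs N" "lin M N f"
  shows "f \<zero>\<^bsub>M\<^esub> = \<zero>\<^bsub>N\<^esub>"
proof -
  interpret M: Module.module K M by fact
  interpret N: Module.module K N by fact
  have "f \<zero>\<^bsub>M\<^esub> = f \<zero>\<^bsub>M\<^esub> \<oplus>\<^bsub>N\<^esub> f \<zero>\<^bsub>M\<^esub>"
    using lin_add[OF assms(3), of "\<zero>\<^bsub>M\<^esub>" "\<zero>\<^bsub>M\<^esub>"] by simp
  then show ?thesis
    using lin_closed[OF assms(3), of "\<zero>\<^bsub>M\<^esub>"] N.add.l_cancel_one' by simp
qed

lemma linear_form_iff: "linear_form K M f \<longleftrightarrow> lin M KM f"
  by (simp add: linear_form_def linear_map_def)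

lemma bilinear_form_iff: "bilinear_form K M N f \<longleftrightarrow> bilin M N KM f"
  by (simp add: bilinear_form_def bilinear_map_def linear_form_iff)

lemma bilinI:
  assumes "\<And>x. x \<in> carrier M \<Longrightarrow> lin N P (f x)" "\<And>y. y \<in> carrier N \<Longrightarrow> lin M P (\<lambda>x. f x y)"
  shows "bilin M N P f"
  using assms by (simp add: bilinear_map_def)

lemma bilin_left: "bilin M N P f \<Longrightarrow> y \<in> carrier N \<Longrightarrow> lin M P (\<lambda>x. f x y)"
  and bilin_right: "bilin M N P f \<Longrightarrow> x \<in> carrier M \<Longrightarrow> lin N P (f x)"
  by (simp_all add: bilinear_map_def)

lemma bilin_closed: "bilin M N P f \<Longrightarrow> x \<in> carrier M \<Longrightarrow> y \<in> carrier N \<Longrightarrow> f x y \<in> carrier P"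
  by (rule lin_closed[OF bilin_right])

lemma lin_comp: "lin N P f \<Longrightarrow> lin M N g \<Longrightarrow> lin M P (\<lambda>x. f (g x))"
  by (intro linI) (simp_all add: lin_closed lin_add lin_scale)

lemma bilin_comp_left: "bilin N Q P f \<Longrightarrow> y \<in> carrier Q \<Longrightarrow> lin M N g \<Longrightarrow> lin M P (\<lambda>x. f (g x) y)"
  by (rule lin_comp[OF bilin_left])

lemma bilin_comp_right: "bilin Q N P f \<Longrightarrow> y \<in> carrier Q \<Longrightarrow> lin M N g \<Longrightarrow> lin M P (\<lambda>x. f y (g x))"
  by (rule lin_comp[OF bilin_right])

lemma bilin_cong:
  assumes "\<And>x y. x \<in> carrier M \<Longrightarrow> y \<in> carrier N \<Longrightarrow> f x y = g x y" "vs M" "vs N"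
  shows "bilin M N P f \<longleftrightarrow> bilin M N P g"
  unfolding bilinear_map_def linear_map_def using assms by (auto simp: Pi_def)

lemma lin_cong:
  assumes "\<And>x. x \<in> carrier M \<Longrightarrow> f x = g x" "vs M"
  shows "lin M P f \<longleftrightarrow> lin M P g"
  unfolding linear_map_def using assms by (auto simp: Pi_def)

text \<open>Linearity of a term in a variable is decided by the structure of the term: the following
  rules, and later ones for each operation, let the simplifier prove such goals.\<close>

lemma lin_id [simp]: "lin M M (\<lambda>x. x)"
  by (rule linI) simp_all

lemma lin_smult [simp]: "vs P \<Longrightarrow> c \<in> carrier K \<Longrightarrow> lin M P g \<Longrightarrow> lin M P (\<lambda>x. c \<odot>\<^bsub>P\<^esub> g x)"
  by (rule linI)
    (simp_all add: lin_closed lin_add lin_scale Module.module.smult_r_distr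
      vs_smult_smult K.m_comm)

lemma lin_smult_left [simp]:
  "vs P \<Longrightarrow> y \<in> carrier P \<Longrightarrow> lin M KM g \<Longrightarrow> lin M P (\<lambda>x. g x \<odot>\<^bsub>P\<^esub> y)"
  using lin_closed[of M KM g] lin_add[of M KM g] lin_scale[of M KM g]
  by (intro linI) (simp_all add: Module.module.smult_l_distr vs_smult_smult)

lemma lin_K_mult_right [simp]: "c \<in> carrier K \<Longrightarrow> lin M KM g \<Longrightarrow> lin M KM (\<lambda>x. c \<otimes>\<^bsub>K\<^esub> g x)"
  using lin_smult[of KM c M g] by simp

lemma lin_K_mult_left [simp]: "c \<in> carrier K \<Longrightarrow> lin M KM g \<Longrightarrow> lin M KM (\<lambda>x. g x \<otimes>\<^bsub>K\<^esub> c)"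
  using lin_smult_left[of KM c M g] by simp

lemma tens_closed [simp]:
  "vs M \<Longrightarrow> vs N \<Longrightarrow> x \<in> carrier M \<Longrightarrow> y \<in> carrier N \<Longrightarrow> tens M N x y \<in> carrier (M \<boxtimes> N)"
  by (intro module_pair.tensor_of_closed module_pair.intro)

lemma bilin_tens: "vs M \<Longrightarrow> vs N \<Longrightarrow> bilin M N (M \<boxtimes> N) (tens M N)"
  by (intro bilinI linI)
    (simp_all add: module_pair.intro module_pair.tensor_of_add_right module_pair.tensor_of_add_left
      module_pair.tensor_of_smult_right module_pair.smult_tensor_of)

lemma lin_tens_left [simp]:
  "vs M \<Longrightarrow> vs N \<Longrightarrow> y \<in> carrier N \<Longrightarrow> lin P M g \<Longrightarrow> lin P (M \<boxtimes> N) (\<lambda>x. tens M N (g x) y)"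
  by (rule bilin_comp_left[OF bilin_tens])

lemma lin_tens_right [simp]:
  "vs M \<Longrightarrow> vs N \<Longrightarrow> x \<in> carrier M \<Longrightarrow> lin P N g \<Longrightarrow> lin P (M \<boxtimes> N) (\<lambda>y. tens M N x (g y))"
  by (rule bilin_comp_right[OF bilin_tens])

lemma smult_tens_left:
  "vs M \<Longrightarrow> vs N \<Longrightarrow> c \<in> carrier K \<Longrightarrow> x \<in> carrier M \<Longrightarrow> y \<in> carrier N \<Longrightarrow>
    tens M N (c \<odot>\<^bsub>M\<^esub> x) y = c \<odot>\<^bsub>M \<boxtimes> N\<^esub> tens M N x y"
  by (simp add: module_pair.intro module_pair.smult_tensor_of)

lemma smult_tens_right:
  "vs M \<Longrightarrow> vs N \<Longrightarrow> c \<in> carrier K \<Longrightarrow> x \<in> carrier M \<Longrightarrow> y \<in> carrier N \<Longrightarrow>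
    tens M N x (c \<odot>\<^bsub>N\<^esub> y) = c \<odot>\<^bsub>M \<boxtimes> N\<^esub> tens M N x y"
  by (simp add: module_pair.intro module_pair.tensor_of_smult_right)

subsection \<open>Sums over tensors\<close>

lemma pure_terms_carrier: "set (pure_terms K M N X) \<subseteq> carrier M \<times> carrier N"
  unfolding pure_terms_def Let_def by (subst if_split) simp

lemma sum_pure_terms:
  assumes "vs M" "vs N" "X \<in> carrier (M \<boxtimes> N)"
  shows "list_sum (M \<boxtimes> N) (map (\<lambda>(x, y). tens M N x y) (pure_terms K M N X)) = X"
proof -
  interpret module_pair K M N using assms by (intro module_pair.intro)
  interpret T: abelian_group "M \<boxtimes> N" by (rule abelian_group_T)
  have *: "set (map (\<lambda>(x, y). tens M N x y) xs) \<subseteq> carrier (M \<boxtimes> N)"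
    if "set xs \<subseteq> carrier M \<times> carrier N" for xs
    using that by (auto simp: tensor_of_closed)
  have "\<exists>xs. set xs \<subseteq> carrier M \<times> carrier N \<and>
     X = list_sum (M \<boxtimes> N) (map (\<lambda>(x, y). tens M N x y) xs)"
    using assms(3)
  proof (induction rule: tensor_induct)
    case (pure x y)
    then show ?case by (intro exI[of _ "[(x, y)]"]) (simp add: tensor_of_closed)
  next
    case (add X Y)
    then obtain xs ys where "set xs \<subseteq> carrier M \<times> carrier N" "set ys \<subseteq> carrier M \<times> carrier N"
      "X = list_sum (M \<boxtimes> N) (map (\<lambda>(x, y). tens M N x y) xs)"
      "Y = list_sum (M \<boxtimes> N) (map (\<lambda>(x, y). tens M N x y) ys)" by blast
    then show ?case
      by (intro exI[of _ "xs @ ys"]) (simp add: T.list_sum_append * del: set_map)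
  qed
  from someI_ex[OF this] show ?thesis
    by (simp add: pure_terms_def Let_def)
qed

text \<open>As a congruence rule this hands the memberships of the summation variables to the simplifier.\<close>

lemma tsum_cong [cong]:
  assumes "X = Y" and "\<And>x y. x \<in> carrier M \<Longrightarrow> y \<in> carrier N \<Longrightarrow> f x y = g x y"
  shows "tsum M N P X f = tsum M N P Y g"
  unfolding tensor_sum_def
  using pure_terms_carrier[of M N Y] assms by (intro arg_cong[where f = "list_sum P"]) auto

lemma tsum_closed:
  assumes "vs P"
    and "\<And>x y. x \<in> carrier M \<Longrightarrow> y \<in> carrier N \<Longrightarrow> f x y \<in> carrier P"
  shows "tsum M N P X f \<in> carrier P"
  unfolding tensor_sum_def
  using pure_terms_carrier[of M N X] assms(2)
  by (intro abelian_group.list_sum_closed vs_abelian assms) auto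

lemma lin_list_sum:
  assumes "vs P" "vs Q" "lin P Q \<phi>" "set xs \<subseteq> carrier P"
  shows "\<phi> (list_sum P xs) = list_sum Q (map \<phi> xs)"
  using assms(4)
proof (induction xs)
  case Nil
  then show ?case using lin_zero assms by simp
next
  case (Cons x xs)
  then show ?case
    using assms by (simp add: lin_add abelian_group.list_sum_closed vs_abelian)
qed

lemma lin_tsum:
  assumes "vs P" "vs Q" "lin P Q \<phi>"
    and "\<And>x y. x \<in> carrier M \<Longrightarrow> y \<in> carrier N \<Longrightarrow> f x y \<in> carrier P"
  shows "\<phi> (tsum M N P X f) = tsum M N Q X (\<lambda>x y. \<phi> (f x y))"
  unfolding tensor_sum_def
  using pure_terms_carrier[of M N X] assms(4)
  by (subst lin_list_sum[OF assms(1-3)]) (auto simp: comp_def case_prod_unfold)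

lemma lin_tsum_body:
  assumes "vs P"
    and "\<And>x y. x \<in> carrier M \<Longrightarrow> y \<in> carrier N \<Longrightarrow> lin Q P (\<lambda>z. f z x y)"
  shows "lin Q P (\<lambda>z. tsum M N P X (f z))"
proof -
  have "lin Q P (\<lambda>z. list_sum P (map (\<lambda>(x, y). f z x y) xs))"
    if "set xs \<subseteq> carrier M \<times> carrier N" for xs
    using that
  proof (induction xs)
    case Nil
    interpret P: Module.module K P by fact
    show ?case by (rule linI) (auto simp: vs_zero_closed assms)
  next
    case (Cons p xs)
    obtain x y where p: "p = (x, y)" "x \<in> carrier M" "y \<in> carrier N"
      using Cons by auto
    interpret P: Module.module K P by fact
    have 1: "lin Q P (\<lambda>z. f z x y)"
      using p assms by simp
    have 2: "lin Q P (\<lambda>z. list_sum P (map (\<lambda>(x, y). f z x y) xs))"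
      using Cons by simp
    show ?case
      using lin_closed[OF 1] lin_closed[OF 2] lin_add[OF 1] lin_add[OF 2]
        lin_scale[OF 1] lin_scale[OF 2] p
      by (intro linI) (auto simp: P.a_ac P.smult_r_distr)
  qed
  then show ?thesis
    unfolding tensor_sum_def using pure_terms_carrier .
qed

lemma tsum_swap:
  assumes "vs P"
    and "\<And>x y x' y'. x \<in> carrier M \<Longrightarrow> y \<in> carrier N \<Longrightarrow> x' \<in> carrier M' \<Longrightarrow> y' \<in> carrier N' \<Longrightarrow>
      f x y x' y' \<in> carrier P"
  shows "tsum M N P X (\<lambda>x y. tsum M' N' P Y (\<lambda>x' y'. f x y x' y'))
    = tsum M' N' P Y (\<lambda>x' y'. tsum M N P X (\<lambda>x y. f x y x' y'))"
  unfolding tensor_sum_def case_prod_unfold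
  using pure_terms_carrier[of M N X] pure_terms_carrier[of M' N' Y] assms(2)
  by (intro abelian_group.list_sum_swap vs_abelian assms(1)) (fastforce simp: subset_iff)

lemma balanced_bilin:
  assumes "vs M" "vs N" "vs P" "bilin M N P f"
  shows "balanced K M N P f"
  unfolding balanced_def
  using bilin_closed[OF assms(4)] lin_add[OF bilin_left[OF assms(4)]]
    lin_add[OF bilin_right[OF assms(4)]] lin_scale[OF bilin_left[OF assms(4)]]
    lin_scale[OF bilin_right[OF assms(4)]] assms
  by simp

lemma tensor_ext:
  assumes "vs M" "vs N" "vs P" "lin (M \<boxtimes> N) P f" "lin (M \<boxtimes> N) P g"
    and "\<And>x y. x \<in> carrier M \<Longrightarrow> y \<in> carrier N \<Longrightarrow> f (tens M N x y) = g (tens M N x y)"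
    and "X \<in> carrier (M \<boxtimes> N)"
  shows "f X = g X"
proof -
  interpret module_pair K M N using assms by (intro module_pair.intro)
  show ?thesis
    using assms(7) by (induction rule: tensor_induct) (simp_all add: assms(6) lin_add[OF assms(4)] lin_add[OF assms(5)])
qed

lemma tensor_lift_lin:
  assumes "vs M" "vs N" "vs P" "bilin M N P f"
  shows "lin (M \<boxtimes> N) P (tensor_lift P f)"
proof -
  interpret module_pair K M N using assms by (intro module_pair.intro)
  note P = vs_abelian[OF assms(3)] and f = balanced_bilin[OF assms]
  interpret P: Module.module K P by fact
  interpret T: Module.module K "M \<boxtimes> N" by (rule module_T)
  show ?thesis
  proof (rule linI)
    show "tensor_lift P f (c \<odot>\<^bsub>M \<boxtimes> N\<^esub> X) = c \<odot>\<^bsub>P\<^esub> tensor_lift P f X"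
      if c: "c \<in> carrier K" and X: "X \<in> carrier (M \<boxtimes> N)" for c X
      using X
    proof (induction rule: tensor_induct)
      case (pure x y)
      then show ?case
        using c lin_scale[OF bilin_left[OF assms(4)]]
        by (simp add: smult_tensor_of tensor_lift_tensor_of[OF P f] M.smult_closed)
    next
      case (add X Y)
      then show ?case
        using c by (simp add: T.smult_r_distr P.smult_r_distr tensor_lift_add[OF P f]
            tensor_lift_closed[OF P f] T.smult_closed)
    qed
  qed (simp_all add: tensor_lift_closed[OF P f] tensor_lift_add[OF P f])
qed

lemma tensor_lift_tens:
  assumes "vs M" "vs N" "vs P" "bilin M N P f" "x \<in> carrier M" "y \<in> carrier N"
  shows "tensor_lift P f (tens M N x y) = f x y"
  using assms
  by (intro module_pair.tensor_lift_tensor_of module_pair.intro vs_abelian balanced_bilin)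

lemma tsum_tens: 
  assumes "vs M" "vs N" "X \<in> carrier (M \<boxtimes> N)"
  shows "tsum M N (M \<boxtimes> N) X (tens M N) = X"
  unfolding tensor_sum_def using sum_pure_terms[OF assms] .

lemma tensor_lift_tsum:
  assumes "vs M" "vs N" "vs P" "bilin M N P f" "X \<in> carrier (M \<boxtimes> N)"
  shows "tensor_lift P f X = tsum M N P X f"
proof -
  have "tensor_lift P f X = tensor_lift P f (tsum M N (M \<boxtimes> N) X (tens M N))"
    by (simp add: tsum_tens assms)
  also have "\<dots> = tsum M N P X (\<lambda>x y. tensor_lift P f (tens M N x y))"
    using assms by (intro lin_tsum tensor_lift_lin) simp_all
  also have "\<dots> = tsum M N P X f"
    using assms by (intro tsum_cong) (simp_all add: tensor_lift_tens)
  finally show ?thesis .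
qed

lemma tsum_lin:
  assumes "vs M" "vs N" "vs P" "bilin M N P f"
  shows "lin (M \<boxtimes> N) P (\<lambda>X. tsum M N P X f)"
  using tensor_lift_lin[OF assms] assms
  by (subst lin_cong[where g = "tensor_lift P f"]) (simp_all add: tensor_lift_tsum)

lemma tsum_pure:
  assumes "vs M" "vs N" "vs P" "bilin M N P f" "x \<in> carrier M" "y \<in> carrier N"
  shows "tsum M N P (tens M N x y) f = f x y"
  using assms by (simp add: tensor_lift_tsum[symmetric] tensor_lift_tens)

lemma lin_tsum_arg:
  "vs M \<Longrightarrow> vs N \<Longrightarrow> vs P \<Longrightarrow> bilin M N P f \<Longrightarrow> lin Q (M \<boxtimes> N) g \<Longrightarrow>
    lin Q P (\<lambda>z. tsum M N P (g z) f)"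
  by (rule lin_comp[OF tsum_lin])

text \<open>Compared with the general case, the target is the field as a ring instead of
  \<open>scalar_module K\<close>; both lifts are additive and agree on pure tensors.\<close>

lemma tensor_lift_K:
  assumes "vs M" "vs N" "bilin M N KM f" "X \<in> carrier (M \<boxtimes> N)"
  shows "tensor_lift K f X = tsum M N KM X f"
proof -
  interpret module_pair K M N using assms by (intro module_pair.intro)
  have f: "balanced K M N KM f"
    using assms by (intro balanced_bilin) auto
  then have f': "balanced K M N K f"
    by (simp add: balanced_def)
  have "abelian_group K" by (rule K.is_abelian_group)
  note 1 = tensor_lift_add[OF this f'] tensor_lift_tensor_of[OF this f']
  note 2 = lin_add[OF tsum_lin[OF assms(1,2) vs_KM assms(3)]] tsum_pure[OF assms(1,2) vs_KM assms(3)]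
  show ?thesis
    using assms(4) by (induction rule: tensor_induct) (simp_all add: 1 2)
qed

section \<open>Sweedler calculus\<close>

subsection \<open>Algebras\<close>

abbreviation "alg \<equiv> algebra_over K"
abbreviation "coalg \<equiv> coalgebra_over K"
abbreviation "hopf \<equiv> hopf_algebra K"

lemma hopf_alg [simp]: "hopf H \<Longrightarrow> alg H"
  and hopf_coalg [simp]: "hopf H \<Longrightarrow> coalg H"
  by (simp_all add: hopf_algebra_def)

lemma alg_vs [simp]: "alg A \<Longrightarrow> vs A"
  by (rule algebra_over.module_A)

lemma coalg_vs [simp]: "coalg C \<Longrightarrow> vs C"
  by (rule coalgebra_over.module_C)

lemma alg_ring: "alg A \<Longrightarrow> ring A"
  by (rule algebra_over.ring_A)

lemma alg_mult_closed [simp]: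
  "alg A \<Longrightarrow> x \<in> carrier A \<Longrightarrow> y \<in> carrier A \<Longrightarrow> x \<otimes>\<^bsub>A\<^esub> y \<in> carrier A"
  by (rule monoid.m_closed[OF ring.is_monoid[OF alg_ring]])

lemma alg_one_closed [simp]: "alg A \<Longrightarrow> \<one>\<^bsub>A\<^esub> \<in> carrier A"
  by (rule monoid.one_closed[OF ring.is_monoid[OF alg_ring]])

lemma alg_one_left [simp]: "alg A \<Longrightarrow> x \<in> carrier A \<Longrightarrow> \<one>\<^bsub>A\<^esub> \<otimes>\<^bsub>A\<^esub> x = x"
  by (rule monoid.l_one[OF ring.is_monoid[OF alg_ring]])

lemma alg_one_right [simp]: "alg A \<Longrightarrow> x \<in> carrier A \<Longrightarrow> x \<otimes>\<^bsub>A\<^esub> \<one>\<^bsub>A\<^esub> = x"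
  by (rule monoid.r_one[OF ring.is_monoid[OF alg_ring]])

lemma alg_assoc:
  "alg A \<Longrightarrow> x \<in> carrier A \<Longrightarrow> y \<in> carrier A \<Longrightarrow> z \<in> carrier A \<Longrightarrow>
    (x \<otimes>\<^bsub>A\<^esub> y) \<otimes>\<^bsub>A\<^esub> z = x \<otimes>\<^bsub>A\<^esub> (y \<otimes>\<^bsub>A\<^esub> z)"
  by (rule monoid.m_assoc[OF ring.is_monoid[OF alg_ring]])

lemma alg_smult_left [simp]:
  "alg A \<Longrightarrow> c \<in> carrier K \<Longrightarrow> x \<in> carrier A \<Longrightarrow> y \<in> carrier A \<Longrightarrow>
    (c \<odot>\<^bsub>A\<^esub> x) \<otimes>\<^bsub>A\<^esub> y = c \<odot>\<^bsub>A\<^esub> (x \<otimes>\<^bsub>A\<^esub> y)"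
  by (rule algebra_over.smult_mult_left)

lemma alg_smult_right [simp]:
  "alg A \<Longrightarrow> c \<in> carrier K \<Longrightarrow> x \<in> carrier A \<Longrightarrow> y \<in> carrier A \<Longrightarrow>
    x \<otimes>\<^bsub>A\<^esub> (c \<odot>\<^bsub>A\<^esub> y) = c \<odot>\<^bsub>A\<^esub> (x \<otimes>\<^bsub>A\<^esub> y)"
  by (rule algebra_over.smult_mult_right)

lemma bilin_alg: "alg A \<Longrightarrow> bilin A A A (\<lambda>x y. x \<otimes>\<^bsub>A\<^esub> y)"
  using ring.ring_simprules(13,23)[OF alg_ring]
  by (intro bilinI linI) simp_all

lemma lin_mult_right [simp]:
  "alg A \<Longrightarrow> a \<in> carrier A \<Longrightarrow> lin M A g \<Longrightarrow> lin M A (\<lambda>x. a \<otimes>\<^bsub>A\<^esub> g x)"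
  by (rule bilin_comp_right[OF bilin_alg])

lemma lin_mult_left [simp]:
  "alg A \<Longrightarrow> a \<in> carrier A \<Longrightarrow> lin M A g \<Longrightarrow> lin M A (\<lambda>x. g x \<otimes>\<^bsub>A\<^esub> a)"
  by (rule bilin_comp_left[OF bilin_alg])

lemma alg_KM [simp]: "alg KM"
proof (rule algebra_over.intro)
  show "ring KM"
    by (rule ringI)
      (auto simp: K.m_assoc K.l_distr K.r_distr vs_abelian intro!: monoidI)
qed (auto simp: field_K K.m_ac)

subsection \<open>Sweedler sums\<close>

lemma counit_lin: "coalg C \<Longrightarrow> lin C KM (counit C)"
  using coalgebra_over.counit_linear linear_form_iff by blast

lemma counit_closed [simp]: "coalg C \<Longrightarrow> x \<in> carrier C \<Longrightarrow> counit C x \<in> carrier K"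
  using lin_closed[OF counit_lin] by simp

lemma lin_counit [simp]: "coalg C \<Longrightarrow> lin M C g \<Longrightarrow> lin M KM (\<lambda>x. counit C (g x))"
  by (rule lin_comp[OF counit_lin])

lemma comult_lin: "coalg C \<Longrightarrow> lin C (C \<boxtimes> C) (comult C)"
  by (rule coalgebra_over.comult_linear)

lemma comult_closed [simp]: "coalg C \<Longrightarrow> x \<in> carrier C \<Longrightarrow> comult C x \<in> carrier (C \<boxtimes> C)"
  by (rule lin_closed[OF comult_lin])

lemma lin_comult [simp]: "coalg C \<Longrightarrow> lin M C g \<Longrightarrow> lin M (C \<boxtimes> C) (\<lambda>x. comult C (g x))"
  by (rule lin_comp[OF comult_lin])

lemma sw_cong [cong]:
  assumes "x = y" and "\<And>a b. a \<in> carrier C \<Longrightarrow> b \<in> carrier C \<Longrightarrow> f a b = g a b"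
  shows "sw C P x f = sw C P y g"
  unfolding sweedler_sum_def using assms by (intro tsum_cong) simp_all

lemma sw_closed [simp]:
  "vs P \<Longrightarrow> (\<And>a b. a \<in> carrier C \<Longrightarrow> b \<in> carrier C \<Longrightarrow> f a b \<in> carrier P) \<Longrightarrow> sw C P x f \<in> carrier P"
  unfolding sweedler_sum_def by (rule tsum_closed)

lemma sw_closed_KM [simp]:
  "(\<And>a b. a \<in> carrier C \<Longrightarrow> b \<in> carrier C \<Longrightarrow> f a b \<in> carrier K) \<Longrightarrow> sw C KM x f \<in> carrier K"
  using sw_closed[of KM C f x] by simp

lemma lin_sw_body [simp]:
  "vs P \<Longrightarrow> (\<And>a b. a \<in> carrier C \<Longrightarrow> b \<in> carrier C \<Longrightarrow> lin Q P (\<lambda>z. f z a b)) \<Longrightarrow>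
    lin Q P (\<lambda>z. sw C P x (\<lambda>a b. f z a b))"
  unfolding sweedler_sum_def by (rule lin_tsum_body)

lemma lin_sw_arg_bilin:
  "coalg C \<Longrightarrow> vs P \<Longrightarrow> bilin C C P f \<Longrightarrow> lin M C g \<Longrightarrow> lin M P (\<lambda>z. sw C P (g z) f)"
  unfolding sweedler_sum_def
  by (rule lin_tsum_arg[where M = C and N = C]) (auto intro: lin_comp[OF comult_lin])

lemma lin_sw_arg [simp]:
  assumes "coalg C" "vs P" "lin M C g"
    and "\<And>a. a \<in> carrier C \<Longrightarrow> lin C P (\<lambda>b. f a b)" "\<And>b. b \<in> carrier C \<Longrightarrow> lin C P (\<lambda>a. f a b)"
  shows "lin M P (\<lambda>z. sw C P (g z) (\<lambda>a b. f a b))"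
  using assms by (intro lin_sw_arg_bilin bilinI) auto

lemma lin_sw:
  "vs P \<Longrightarrow> vs Q \<Longrightarrow> lin P Q \<phi> \<Longrightarrow>
    (\<And>a b. a \<in> carrier C \<Longrightarrow> b \<in> carrier C \<Longrightarrow> f a b \<in> carrier P) \<Longrightarrow>
    \<phi> (sw C P x f) = sw C Q x (\<lambda>a b. \<phi> (f a b))"
  unfolding sweedler_sum_def by (rule lin_tsum)

lemma sw_swap:
  assumes "vs P" and "\<And>a b c d. a \<in> carrier C \<Longrightarrow> b \<in> carrier C \<Longrightarrow> c \<in> carrier D \<Longrightarrow> d \<in> carrier D \<Longrightarrow>
      f a b c d \<in> carrier P"
  shows "sw C P x (\<lambda>a b. sw D P y (\<lambda>c d. f a b c d)) = sw D P y (\<lambda>c d. sw C P x (\<lambda>a b. f a b c d))"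
  unfolding sweedler_sum_def using assms by (rule tsum_swap)

lemma sweedler2_sw:
  assumes "coalg C" "vs P" "bilin C C P f" "x \<in> carrier C"
  shows "sweedler2 C P x f = sw C P x f"
  unfolding sweedler2_def sweedler_sum_def using assms by (intro tensor_lift_tsum) simp_all

lemma sweedler2_sw_lin:
  assumes "coalg C" "vs P" "x \<in> carrier C"
    and "\<And>a. a \<in> carrier C \<Longrightarrow> lin C P (\<lambda>b. f a b)" "\<And>b. b \<in> carrier C \<Longrightarrow> lin C P (\<lambda>a. f a b)"
  shows "sweedler2 C P x (\<lambda>a b. f a b) = sw C P x (\<lambda>a b. f a b)"
  using assms by (intro sweedler2_sw bilinI) auto

lemma sweedler2_K:
  assumes "coalg C" "x \<in> carrier C"
    and "\<And>a. a \<in> carrier C \<Longrightarrow> lin C KM (\<lambda>b. f a b)" "\<And>b. b \<in> carrier C \<Longrightarrow> lin C KM (\<lambda>a. f a b)"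
  shows "sweedler2 C K x (\<lambda>a b. f a b) = sw C KM x (\<lambda>a b. f a b)"
  unfolding sweedler2_def sweedler_sum_def
  using assms by (intro tensor_lift_K bilinI) auto

text \<open>The inner expression equals a sum only for arguments in the carrier, so the multilinearity of the
  outer one is transferred along \<open>bilin_cong\<close>. The same pattern recurs for every nested
  expression below.\<close>

lemma sweedler3_sw:
  assumes C: "coalg C" and P: "vs P" and x: "x \<in> carrier C"
    and "\<And>a b. a \<in> carrier C \<Longrightarrow> b \<in> carrier C \<Longrightarrow> lin C P (\<lambda>c. f a b c)"
    and "\<And>a c. a \<in> carrier C \<Longrightarrow> c \<in> carrier C \<Longrightarrow> lin C P (\<lambda>b. f a b c)"
    and "\<And>b c. b \<in> carrier C \<Longrightarrow> c \<in> carrier C \<Longrightarrow> lin C P (\<lambda>a. f a b c)"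
  shows "sweedler3 C P x (\<lambda>a b c. f a b c) = sw C P x (\<lambda>a z. sw C P z (\<lambda>b c. f a b c))"
proof -
  have eq: "sweedler2 C P z (\<lambda>b c. f a b c) = sw C P z (\<lambda>b c. f a b c)"
    if "a \<in> carrier C" "z \<in> carrier C" for a z
    using assms that by (intro sweedler2_sw_lin) auto
  have "bilin C C P (\<lambda>a z. sweedler2 C P z (\<lambda>b c. f a b c))"
    using assms by (subst bilin_cong[OF eq]) (auto intro!: bilinI)
  then show ?thesis
    unfolding sweedler3_def using C P x by (simp add: sweedler2_sw eq cong: sw_cong)
qed

text \<open>A trilinear map \<open>f\<close> induces a linear map \<open>\<Phi>\<close> on \<open>C \<otimes> (C \<otimes> C)\<close>; apply it to the
  coassociativity axiom.\<close>

lemma sw_coassoc: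
  assumes C: "coalg C" and P: "vs P" and x: "x \<in> carrier C"
    and 1: "\<And>a b. a \<in> carrier C \<Longrightarrow> b \<in> carrier C \<Longrightarrow> lin C P (\<lambda>c. f a b c)"
    and 2: "\<And>a c. a \<in> carrier C \<Longrightarrow> c \<in> carrier C \<Longrightarrow> lin C P (\<lambda>b. f a b c)"
    and 3: "\<And>b c. b \<in> carrier C \<Longrightarrow> c \<in> carrier C \<Longrightarrow> lin C P (\<lambda>a. f a b c)"
  shows "sw C P x (\<lambda>z c. sw C P z (\<lambda>a b. f a b c)) = sw C P x (\<lambda>a z. sw C P z (\<lambda>b c. f a b c))"
proof -
  let ?T = "C \<boxtimes> (C \<boxtimes> C)"
  define \<Phi> where "\<Phi> = (\<lambda>Z. tsum C (C \<boxtimes> C) P Z (\<lambda>a W. tsum C C P W (\<lambda>b c. f a b c)))"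
  have b: "bilin C C P (f a)" if "a \<in> carrier C" for a
    using 1 2 that by (intro bilinI) auto
  have bl: "bilin C (C \<boxtimes> C) P (\<lambda>a W. tsum C C P W (f a))"
    using C P 3 b by (intro bilinI[of C "C \<boxtimes> C"] lin_tsum_arg lin_tsum_body) auto
  then have \<Phi>: "lin ?T P \<Phi>"
    unfolding \<Phi>_def using C P by (intro tsum_lin) auto
  have \<Phi>_pure: "\<Phi> (tens C (C \<boxtimes> C) a W) = tsum C C P W (f a)"
    if "a \<in> carrier C" "W \<in> carrier (C \<boxtimes> C)" for a W
    unfolding \<Phi>_def using C P bl that by (subst tsum_pure) auto
  have "bilin C C ?T (\<lambda>y W. tens C (C \<boxtimes> C) y (comult C W))"
    using C by (auto intro!: bilinI)
  then have R: "sweedler2 C ?T x (\<lambda>y W. tens C (C \<boxtimes> C) y (comult C W))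
      = sw C ?T x (\<lambda>y W. tens C (C \<boxtimes> C) y (comult C W))"
    using C x by (intro sweedler2_sw) auto
  have L': "sweedler2 C ?T z (\<lambda>a b. tens C (C \<boxtimes> C) a (tens C C b c))
      = sw C ?T z (\<lambda>a b. tens C (C \<boxtimes> C) a (tens C C b c))"
    if "z \<in> carrier C" "c \<in> carrier C" for z c
    using C that by (intro sweedler2_sw_lin) auto
  have "bilin C C ?T (\<lambda>z c. sweedler2 C ?T z (\<lambda>a b. tens C (C \<boxtimes> C) a (tens C C b c)))"
    using C by (subst bilin_cong[OF L']) (auto intro!: bilinI)
  then have L: "sweedler2 C ?T x (\<lambda>z c. sweedler2 C ?T z (\<lambda>a b. tens C (C \<boxtimes> C) a (tens C C b c)))
      = sw C ?T x (\<lambda>z c. sw C ?T z (\<lambda>a b. tens C (C \<boxtimes> C) a (tens C C b c)))"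
    using C x by (subst sweedler2_sw) (auto simp: L')
  have "\<Phi> (sw C ?T x (\<lambda>z c. sw C ?T z (\<lambda>a b. tens C (C \<boxtimes> C) a (tens C C b c))))
      = \<Phi> (sw C ?T x (\<lambda>y W. tens C (C \<boxtimes> C) y (comult C W)))"
    using coalgebra_over.coassoc[OF C x] unfolding L R by (rule arg_cong)
  moreover have "\<Phi> (sw C ?T x (\<lambda>z c. sw C ?T z (\<lambda>a b. tens C (C \<boxtimes> C) a (tens C C b c))))
      = sw C P x (\<lambda>z c. sw C P z (\<lambda>a b. f a b c))"
    using C P b by (simp add: lin_sw[OF _ P \<Phi>] \<Phi>_pure tsum_pure)
  moreover have "\<Phi> (sw C ?T x (\<lambda>y W. tens C (C \<boxtimes> C) y (comult C W)))
      = sw C P x (\<lambda>a z. sw C P z (\<lambda>b c. f a b c))"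
    using C P by (simp add: lin_sw[OF _ P \<Phi>] \<Phi>_pure sweedler_sum_def[symmetric])
  ultimately show ?thesis by simp
qed

lemma sw_counit_left:
  assumes C: "coalg C" and P: "vs P" and x: "x \<in> carrier C" and f: "lin C P f"
  shows "sw C P x (\<lambda>a b. counit C a \<odot>\<^bsub>P\<^esub> f b) = f x"
proof -
  have "sweedler2 C C x (\<lambda>a b. counit C a \<odot>\<^bsub>C\<^esub> b) = sw C C x (\<lambda>a b. counit C a \<odot>\<^bsub>C\<^esub> b)"
    using C x by (intro sweedler2_sw_lin) auto
  then have "x = sw C C x (\<lambda>a b. counit C a \<odot>\<^bsub>C\<^esub> b)"
    using coalgebra_over.counit_left[OF C x] by simp
  then have "f x = f (sw C C x (\<lambda>a b. counit C a \<odot>\<^bsub>C\<^esub> b))" by (rule arg_cong)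
  also have "\<dots> = sw C P x (\<lambda>a b. counit C a \<odot>\<^bsub>P\<^esub> f b)"
    using C P by (simp add: lin_sw[OF _ P f] lin_scale[OF f])
  finally show ?thesis by simp
qed

lemma sw_counit_right:
  assumes C: "coalg C" and P: "vs P" and x: "x \<in> carrier C" and f: "lin C P f"
  shows "sw C P x (\<lambda>a b. counit C b \<odot>\<^bsub>P\<^esub> f a) = f x"
proof -
  have "sweedler2 C C x (\<lambda>a b. counit C b \<odot>\<^bsub>C\<^esub> a) = sw C C x (\<lambda>a b. counit C b \<odot>\<^bsub>C\<^esub> a)"
    using C x by (intro sweedler2_sw_lin) auto
  then have "x = sw C C x (\<lambda>a b. counit C b \<odot>\<^bsub>C\<^esub> a)"
    using coalgebra_over.counit_right[OF C x] by simp
  then have "f x = f (sw C C x (\<lambda>a b. counit C b \<odot>\<^bsub>C\<^esub> a))" by (rule arg_cong)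
  also have "\<dots> = sw C P x (\<lambda>a b. counit C b \<odot>\<^bsub>P\<^esub> f a)"
    using C P by (simp add: lin_sw[OF _ P f] lin_scale[OF f])
  finally show ?thesis by simp
qed

lemma sw_coalgebra_map:
  assumes C: "coalg C" and D: "coalg D" and v: "coalgebra_map K C D v" and x: "x \<in> carrier C"
    and P: "vs P" and f: "bilin D D P f"
  shows "sw D P (v x) f = sw C P x (\<lambda>a b. f (v a) (v b))"
proof -
  have vl: "lin C D v" using v by (simp add: coalgebra_map_def)
  have vc: "v a \<in> carrier D" if "a \<in> carrier C" for a using lin_closed[OF vl that] .
  have "comult D (v x) = sweedler2 C (D \<boxtimes> D) x (\<lambda>a b. tens D D (v a) (v b))"
    using v x by (simp add: coalgebra_map_def)
  also have "\<dots> = sw C (D \<boxtimes> D) x (\<lambda>a b. tens D D (v a) (v b))"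
    using C D x vc vl by (intro sweedler2_sw_lin) simp_all
  finally show ?thesis
    unfolding sweedler_sum_def[of K D]
    using C D P vc f by (simp add: lin_sw[OF _ P tsum_lin[OF _ _ P f]] tsum_pure)
qed

subsection \<open>Convolution\<close>

text \<open>Convolution of maps on a coalgebra, the values being multiplied by a bilinear \<open>B\<close>. In \<open>conv\<close>
  the coalgebra is the tensor product of \<open>C\<close> and \<open>D\<close>, and maps on it are given by bilinear
  ones.\<close>

definition conv1 where
  "conv1 C R B F G x = sw C R x (\<lambda>x1 x2. B (F x1) (G x2))"

definition conv where
  "conv C D R B F G x y = sw C R x (\<lambda>x1 x2. sw D R y (\<lambda>y1 y2. B (F x1 y1) (G x2 y2)))"

lemma lin_conv1:
  assumes "coalg C" "vs R" "bilin P Q R B" "lin C P F" "lin C Q G"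
  shows "lin C R (conv1 C R B F G)"
  unfolding conv1_def[abs_def]
  using assms by (simp add: bilin_comp_left[OF assms(3)] bilin_comp_right[OF assms(3)] lin_closed)

lemma bilin_conv:
  assumes "coalg C" "coalg D" "vs R" "bilin P Q R B" "bilin C D P F" "bilin C D Q G"
  shows "bilin C D R (conv C D R B F G)"
  unfolding conv_def[abs_def]
  using assms
  by (intro bilinI; simp add: bilin_comp_left[OF assms(4)] bilin_comp_right[OF assms(4)] bilin_closed bilin_left bilin_right)

lemma bilin_sw_left:
  assumes "bilin P Q R B" "vs P" "vs R" "q \<in> carrier Q"
    and "\<And>a b. a \<in> carrier C \<Longrightarrow> b \<in> carrier C \<Longrightarrow> f a b \<in> carrier P"
  shows "B (sw C P x f) q = sw C R x (\<lambda>a b. B (f a b) q)"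
  using lin_sw[OF assms(2,3) bilin_left[OF assms(1,4)] assms(5)] .

lemma bilin_sw_right:
  assumes "bilin P Q R B" "vs Q" "vs R" "p \<in> carrier P"
    and "\<And>a b. a \<in> carrier C \<Longrightarrow> b \<in> carrier C \<Longrightarrow> f a b \<in> carrier Q"
  shows "B p (sw C Q x f) = sw C R x (\<lambda>a b. B p (f a b))"
  using lin_sw[OF assms(2,3) bilin_right[OF assms(1,4)] assms(5)] .

lemma conv1_assoc:
  assumes C: "coalg C" and vs: "vs R1" "vs R2" "vs U"
    and B1: "bilin P Q R1 B1" and B2: "bilin R1 S U B2"
    and B3: "bilin Q S R2 B3" and B4: "bilin P R2 U B4"
    and assoc: "\<And>p q s. p \<in> carrier P \<Longrightarrow> q \<in> carrier Q \<Longrightarrow> s \<in> carrier S \<Longrightarrow>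
      B2 (B1 p q) s = B4 p (B3 q s)"
    and F: "lin C P F" and G: "lin C Q G" and L: "lin C S L" and x: "x \<in> carrier C"
  shows "conv1 C U B2 (conv1 C R1 B1 F G) L x = conv1 C U B4 F (conv1 C R2 B3 G L) x"
proof -
  note cl = lin_closed[OF F] lin_closed[OF G] lin_closed[OF L]
    bilin_closed[OF B1] bilin_closed[OF B3]
  have "conv1 C U B2 (conv1 C R1 B1 F G) L x
      = sw C U x (\<lambda>z c. sw C U z (\<lambda>a b. B4 (F a) (B3 (G b) (L c))))"
    unfolding conv1_def
    by (simp add: bilin_sw_left[OF B2 vs(1,3)] cl assoc)
  also have "\<dots> = sw C U x (\<lambda>a z. sw C U z (\<lambda>b c. B4 (F a) (B3 (G b) (L c))))"
    using C x vs
    by (intro sw_coassoc)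
      (simp_all add: bilin_comp_left[OF B4] bilin_comp_right[OF B4] bilin_comp_left[OF B3]
        bilin_comp_right[OF B3] F G L cl)
  also have "\<dots> = conv1 C U B4 F (conv1 C R2 B3 G L) x"
    unfolding conv1_def
    by (simp add: bilin_sw_right[OF B4 vs(2,3)] cl)
  finally show ?thesis .
qed

text \<open>Coassociativity of \<open>C\<close> and of \<open>D\<close>, applied separately after an exchange of the sums. Allowing
  four different products covers associativity of an algebra as well as the bimodule laws for
  scalar-valued factors.\<close>

lemma conv_assoc:
  assumes C: "coalg C" and D: "coalg D" and vs: "vs R1" "vs R2" "vs U"
    and B1: "bilin P Q R1 B1" and B2: "bilin R1 S U B2"
    and B3: "bilin Q S R2 B3" and B4: "bilin P R2 U B4"
    and assoc: "\<And>p q s. p \<in> carrier P \<Longrightarrow> q \<in> carrier Q \<Longrightarrow> s \<in> carrier S \<Longrightarrow>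
      B2 (B1 p q) s = B4 p (B3 q s)"
    and F: "bilin C D P F" and G: "bilin C D Q G" and L: "bilin C D S L"
    and x: "x \<in> carrier C" and y: "y \<in> carrier D"
  shows "conv C D U B2 (conv C D R1 B1 F G) L x y = conv C D U B4 F (conv C D R2 B3 G L) x y"
proof -
  note cl = bilin_closed[OF F] bilin_closed[OF G] bilin_closed[OF L]
    bilin_closed[OF B1] bilin_closed[OF B3] bilin_closed[OF B4]
  note li = bilin_comp_left[OF B4] bilin_comp_right[OF B4] bilin_comp_left[OF B3]
        bilin_comp_right[OF B3] bilin_left[OF F] bilin_left[OF G] bilin_left[OF L]
        bilin_right[OF F] bilin_right[OF G] bilin_right[OF L]
  let ?t = "\<lambda>a b c a' b' c'. B4 (F a a') (B3 (G b b') (L c c'))"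
  have "conv C D U B2 (conv C D R1 B1 F G) L x y
      = sw C U x (\<lambda>z c. sw D U y (\<lambda>z' c'. sw C U z (\<lambda>a b. sw D U z' (\<lambda>a' b'. ?t a b c a' b' c'))))"
    unfolding conv_def using vs
    by (simp add: bilin_sw_left[OF B2 vs(1,3)] cl assoc)
  also have "\<dots> = sw C U x (\<lambda>z c. sw C U z (\<lambda>a b. sw D U y (\<lambda>z' c'. sw D U z' (\<lambda>a' b'. ?t a b c a' b' c'))))"
    using vs by (intro sw_cong refl sw_swap) (simp_all add: cl)
  also have "\<dots> = sw C U x (\<lambda>z c. sw C U z (\<lambda>a b. sw D U y (\<lambda>a' z'. sw D U z' (\<lambda>b' c'. ?t a b c a' b' c'))))"
    using D y vs by (intro sw_cong refl sw_coassoc) (simp_all add: li cl)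
  also have "\<dots> = sw C U x (\<lambda>a z. sw C U z (\<lambda>b c. sw D U y (\<lambda>a' z'. sw D U z' (\<lambda>b' c'. ?t a b c a' b' c'))))"
    using C x vs by (intro sw_coassoc) (simp_all add: li cl)
  also have "\<dots> = sw C U x (\<lambda>a z. sw D U y (\<lambda>a' z'. sw C U z (\<lambda>b c. sw D U z' (\<lambda>b' c'. ?t a b c a' b' c'))))"
    using vs by (intro sw_cong refl sw_swap) (simp_all add: cl)
  also have "\<dots> = conv C D U B4 F (conv C D R2 B3 G L) x y"
    unfolding conv_def using vs
    by (simp add: bilin_sw_right[OF B4 vs(2,3)] cl)
  finally show ?thesis .
qed

lemma conv1_cong:
  "(\<And>a. a \<in> carrier C \<Longrightarrow> F a = F' a) \<Longrightarrow> (\<And>a. a \<in> carrier C \<Longrightarrow> G a = G' a) \<Longrightarrow>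
    conv1 C R B F G x = conv1 C R B F' G' x"
  unfolding conv1_def by simp

lemma conv_cong:
  "(\<And>a b. a \<in> carrier C \<Longrightarrow> b \<in> carrier D \<Longrightarrow> F a b = F' a b) \<Longrightarrow>
    (\<And>a b. a \<in> carrier C \<Longrightarrow> b \<in> carrier D \<Longrightarrow> G a b = G' a b) \<Longrightarrow>
    conv C D R B F G x y = conv C D R B F' G' x y"
  unfolding conv_def by simp

text \<open>In a convolution algebra a left inverse and a right inverse of the same element agree.\<close>

lemma conv1_inverse_unique:
  assumes C: "coalg C" and R: "alg R" and F: "lin C R F" and G: "lin C R G" and L: "lin C R L"
    and FG: "\<And>a. a \<in> carrier C \<Longrightarrow> conv1 C R (\<lambda>x y. x \<otimes>\<^bsub>R\<^esub> y) F G a = counit C a \<odot>\<^bsub>R\<^esub> \<one>\<^bsub>R\<^esub>"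
    and GL: "\<And>a. a \<in> carrier C \<Longrightarrow> conv1 C R (\<lambda>x y. x \<otimes>\<^bsub>R\<^esub> y) G L a = counit C a \<odot>\<^bsub>R\<^esub> \<one>\<^bsub>R\<^esub>"
    and x: "x \<in> carrier C"
  shows "F x = L x"
proof -
  let ?c = "conv1 C R (\<lambda>x y. x \<otimes>\<^bsub>R\<^esub> y)"
  have "?c (?c F G) L x = ?c F (?c G L) x"
    using C R F G L x by (intro conv1_assoc[where P = R and Q = R and S = R]) (simp_all add: bilin_alg alg_assoc)
  moreover have "?c (?c F G) L x = ?c (\<lambda>a. counit C a \<odot>\<^bsub>R\<^esub> \<one>\<^bsub>R\<^esub>) L x"
    using FG by (intro conv1_cong) simp_all
  moreover have "?c (\<lambda>a. counit C a \<odot>\<^bsub>R\<^esub> \<one>\<^bsub>R\<^esub>) L x = L x"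
    unfolding conv1_def using C R x sw_counit_left[OF C _ x L] by (simp add: lin_closed[OF L])
  moreover have "?c F (?c G L) x = ?c F (\<lambda>a. counit C a \<odot>\<^bsub>R\<^esub> \<one>\<^bsub>R\<^esub>) x"
    using GL by (intro conv1_cong) simp_all
  moreover have "?c F (\<lambda>a. counit C a \<odot>\<^bsub>R\<^esub> \<one>\<^bsub>R\<^esub>) x = F x"
    unfolding conv1_def using C R x sw_counit_right[OF C _ x F] by (simp add: lin_closed[OF F])
  ultimately show ?thesis by simp
qed

lemma sw_counit_left2:
  assumes "coalg C" "coalg D" "vs P" "x \<in> carrier C" "y \<in> carrier D" "bilin C D P F"
  shows "sw C P x (\<lambda>x1 x2. sw D P y (\<lambda>y1 y2. (counit C x1 \<bullet> counit D y1) \<odot>\<^bsub>P\<^esub> F x2 y2)) = F x y"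
proof -
  have "sw C P x (\<lambda>x1 x2. sw D P y (\<lambda>y1 y2. (counit C x1 \<bullet> counit D y1) \<odot>\<^bsub>P\<^esub> F x2 y2))
     = sw C P x (\<lambda>x1 x2. counit C x1 \<odot>\<^bsub>P\<^esub> sw D P y (\<lambda>y1 y2. counit D y1 \<odot>\<^bsub>P\<^esub> F x2 y2))"
    using assms bilin_closed[OF assms(6)]
    by (simp add: lin_sw[where \<phi> = "\<lambda>z. _ \<odot>\<^bsub>P\<^esub> z" and P = P] vs_smult_smult)
  also have "\<dots> = F x y"
    using assms sw_counit_left[OF assms(1,3,4) bilin_left[OF assms(6)]]
    by (simp add: sw_counit_left bilin_right[OF assms(6)])
  finally show ?thesis .
qed

lemma sw_counit_right2:
  assumes "coalg C" "coalg D" "vs P" "x \<in> carrier C" "y \<in> carrier D" "bilin C D P F"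
  shows "sw C P x (\<lambda>x1 x2. sw D P y (\<lambda>y1 y2. (counit C x2 \<bullet> counit D y2) \<odot>\<^bsub>P\<^esub> F x1 y1)) = F x y"
proof -
  have "sw C P x (\<lambda>x1 x2. sw D P y (\<lambda>y1 y2. (counit C x2 \<bullet> counit D y2) \<odot>\<^bsub>P\<^esub> F x1 y1))
     = sw C P x (\<lambda>x1 x2. counit C x2 \<odot>\<^bsub>P\<^esub> sw D P y (\<lambda>y1 y2. counit D y2 \<odot>\<^bsub>P\<^esub> F x1 y1))"
    using assms bilin_closed[OF assms(6)]
    by (simp add: lin_sw[where \<phi> = "\<lambda>z. _ \<odot>\<^bsub>P\<^esub> z" and P = P] vs_smult_smult)
  also have "\<dots> = F x y"
    using assms sw_counit_right[OF assms(1,3,4) bilin_left[OF assms(6)]]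
    by (simp add: sw_counit_right bilin_right[OF assms(6)])
  finally show ?thesis .
qed

lemma conv_inverse_unique:
  assumes C: "coalg C" and D: "coalg D" and R: "alg R"
    and F: "bilin C D R F" and G: "bilin C D R G" and L: "bilin C D R L"
    and FG: "\<And>a b. a \<in> carrier C \<Longrightarrow> b \<in> carrier D \<Longrightarrow>
      conv C D R (\<lambda>x y. x \<otimes>\<^bsub>R\<^esub> y) F G a b = (counit C a \<bullet> counit D b) \<odot>\<^bsub>R\<^esub> \<one>\<^bsub>R\<^esub>"
    and GL: "\<And>a b. a \<in> carrier C \<Longrightarrow> b \<in> carrier D \<Longrightarrow>
      conv C D R (\<lambda>x y. x \<otimes>\<^bsub>R\<^esub> y) G L a b = (counit C a \<bullet> counit D b) \<odot>\<^bsub>R\<^esub> \<one>\<^bsub>R\<^esub>"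
    and x: "x \<in> carrier C" and y: "y \<in> carrier D"
  shows "F x y = L x y"
proof -
  let ?c = "conv C D R (\<lambda>x y. x \<otimes>\<^bsub>R\<^esub> y)"
  let ?e = "\<lambda>a b. (counit C a \<bullet> counit D b) \<odot>\<^bsub>R\<^esub> \<one>\<^bsub>R\<^esub>"
  have "?c (?c F G) L x y = ?c F (?c G L) x y"
    using C D R F G L x y by (intro conv_assoc[where P = R and Q = R and S = R]) (simp_all add: bilin_alg alg_assoc)
  moreover have "?c (?c F G) L x y = ?c ?e L x y"
    using FG by (intro conv_cong) simp_all
  moreover have "?c ?e L x y = L x y"
    unfolding conv_def using C D R x y sw_counit_left2[OF C D _ x y L] by (simp add: bilin_closed[OF L])
  moreover have "?c F (?c G L) x y = ?c F ?e x y"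
    using GL by (intro conv_cong) simp_all
  moreover have "?c F ?e x y = F x y"
    unfolding conv_def using C D R x y sw_counit_right2[OF C D _ x y F] by (simp add: bilin_closed[OF F])
  ultimately show ?thesis by simp
qed

section \<open>Hopf algebras\<close>

subsection \<open>The tensor product of two algebras\<close>

text \<open>The coproduct of \<open>S(x)\<close> is identified in the convolution algebra of maps from \<open>H\<close> to
  \<open>H \<otimes> H\<close>, which requires \<open>H \<otimes> H\<close> to be an algebra.\<close>

lemma list_sum_tensor_algebra [simp]:
  "list_sum (tensor_algebra K A B) = list_sum (A \<boxtimes> B)"
proof
  show "list_sum (tensor_algebra K A B) xs = list_sum (A \<boxtimes> B) xs" for xs
    by (induction xs) (simp_all add: tensor_algebra_def)
qed

lemma sw_tensor_algebra [simp]: "sw C (tensor_algebra K A B) x f = sw C (A \<boxtimes> B) x f"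
  by (simp add: sweedler_sum_def tensor_sum_def)

lemma tensor_algebra_simps [simp]:
  "carrier (tensor_algebra K A B) = carrier (A \<boxtimes> B)"
  "\<one>\<^bsub>tensor_algebra K A B\<^esub> = tens A B \<one>\<^bsub>A\<^esub> \<one>\<^bsub>B\<^esub>"
  "(\<oplus>\<^bsub>tensor_algebra K A B\<^esub>) = (\<oplus>\<^bsub>A \<boxtimes> B\<^esub>)" "\<zero>\<^bsub>tensor_algebra K A B\<^esub> = \<zero>\<^bsub>A \<boxtimes> B\<^esub>"
  "(\<odot>\<^bsub>tensor_algebra K A B\<^esub>) = (\<odot>\<^bsub>A \<boxtimes> B\<^esub>)"
  by (simp_all add: tensor_algebra_def)

lemma lin_tensor_algebra [simp]: "lin M (tensor_algebra K A B) f \<longleftrightarrow> lin M (A \<boxtimes> B) f"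
  by (simp add: linear_map_def)

lemma tensor_mult_eq:
  assumes A: "alg A" and B: "alg B" and X: "X \<in> carrier (A \<boxtimes> B)" and Y: "Y \<in> carrier (A \<boxtimes> B)"
  shows "X \<otimes>\<^bsub>tensor_algebra K A B\<^esub> Y = tsum A B (A \<boxtimes> B) X (\<lambda>a b. tsum A B (A \<boxtimes> B) Y (\<lambda>a' b'.
      tens A B (a \<otimes>\<^bsub>A\<^esub> a') (b \<otimes>\<^bsub>B\<^esub> b')))"
proof -
  have 1: "tensor_lift (A \<boxtimes> B) (\<lambda>a' b'. tens A B (a \<otimes>\<^bsub>A\<^esub> a') (b \<otimes>\<^bsub>B\<^esub> b')) Y
      = tsum A B (A \<boxtimes> B) Y (\<lambda>a' b'. tens A B (a \<otimes>\<^bsub>A\<^esub> a') (b \<otimes>\<^bsub>B\<^esub> b'))"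
    if "a \<in> carrier A" "b \<in> carrier B" for a b
    using A B Y that by (intro tensor_lift_tsum bilinI) simp_all
  have "bilin A B (A \<boxtimes> B) (\<lambda>a b. tensor_lift (A \<boxtimes> B) (\<lambda>a' b'. tens A B (a \<otimes>\<^bsub>A\<^esub> a') (b \<otimes>\<^bsub>B\<^esub> b')) Y)"
    using A B by (subst bilin_cong[OF 1]) (auto intro!: bilinI lin_tsum_body)
  then show ?thesis
    using A B X by (simp add: tensor_algebra_def tensor_lift_tsum[of A B] 1)
qed

lemma tensor_mult_bilin:
  assumes A: "alg A" and B: "alg B"
  shows "bilin (A \<boxtimes> B) (A \<boxtimes> B) (A \<boxtimes> B) (\<lambda>X Y. X \<otimes>\<^bsub>tensor_algebra K A B\<^esub> Y)"
proof -
  have "bilin A B (A \<boxtimes> B) (\<lambda>a b. tsum A B (A \<boxtimes> B) Y (\<lambda>a' b'. tens A B (a \<otimes>\<^bsub>A\<^esub> a') (b \<otimes>\<^bsub>B\<^esub> b')))"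
    for Y using A B by (intro bilinI lin_tsum_body) simp_all
  moreover have "bilin A B (A \<boxtimes> B) (\<lambda>a' b'. tens A B (a \<otimes>\<^bsub>A\<^esub> a') (b \<otimes>\<^bsub>B\<^esub> b'))"
    if "a \<in> carrier A" "b \<in> carrier B" for a b
    using A B that by (intro bilinI) simp_all
  ultimately have "bilin (A \<boxtimes> B) (A \<boxtimes> B) (A \<boxtimes> B) (\<lambda>X Y. tsum A B (A \<boxtimes> B) X (\<lambda>a b.
      tsum A B (A \<boxtimes> B) Y (\<lambda>a' b'. tens A B (a \<otimes>\<^bsub>A\<^esub> a') (b \<otimes>\<^bsub>B\<^esub> b'))))"
    using A B by (intro bilinI[of "A \<boxtimes> B" "A \<boxtimes> B"] lin_tsum_body tsum_lin) simp_all
  then show ?thesis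
    using A B by (subst bilin_cong[OF tensor_mult_eq]) simp_all
qed

lemma tensor_mult_tens [simp]:
  assumes A: "alg A" and B: "alg B"
    and "a \<in> carrier A" "b \<in> carrier B" "a' \<in> carrier A" "b' \<in> carrier B"
  shows "tens A B a b \<otimes>\<^bsub>tensor_algebra K A B\<^esub> tens A B a' b' = tens A B (a \<otimes>\<^bsub>A\<^esub> a') (b \<otimes>\<^bsub>B\<^esub> b')"
  using assms by (simp add: tensor_mult_eq tsum_pure bilinI lin_tsum_body)

lemma alg_tensor_algebra [simp]:
  assumes A: "alg A" and B: "alg B"
  shows "alg (tensor_algebra K A B)"
proof -
  let ?R = "tensor_algebra K A B"
  note bl = tensor_mult_bilin[OF A B]
  note ad = lin_add[OF bilin_left[OF bl]] lin_add[OF bilin_right[OF bl]]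
    lin_scale[OF bilin_left[OF bl]] lin_scale[OF bilin_right[OF bl]]
  have cl [simp]: "X \<otimes>\<^bsub>?R\<^esub> Y \<in> carrier (A \<boxtimes> B)" if "X \<in> carrier (A \<boxtimes> B)" "Y \<in> carrier (A \<boxtimes> B)" for X Y
    using bilin_closed[OF bl] that by simp
  have vs: "vs ?R"
  proof -
    interpret T: Module.module K "A \<boxtimes> B" using A B by simp
    show ?thesis
    proof (rule moduleI)
      show "abelian_group ?R"
        by (rule abelian_groupI) (auto simp: T.a_ac intro: T.l_neg)
    qed (auto simp: T.smult_l_distr T.smult_r_distr T.smult_assoc1 K.is_cring)
  qed
  interpret MP: module_pair K A B using A B by (intro module_pair.intro) simp_all
  have assoc: "(X \<otimes>\<^bsub>?R\<^esub> Y) \<otimes>\<^bsub>?R\<^esub> Z = X \<otimes>\<^bsub>?R\<^esub> (Y \<otimes>\<^bsub>?R\<^esub> Z)"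
    if X: "X \<in> carrier (A \<boxtimes> B)" and Y: "Y \<in> carrier (A \<boxtimes> B)" and Z: "Z \<in> carrier (A \<boxtimes> B)" for X Y Z
    using X
  proof (induction rule: MP.tensor_induct)
    case (pure a b)
    show ?case using Y
    proof (induction rule: MP.tensor_induct)
      case (pure a' b')
      show ?case using Z
        by (induction rule: MP.tensor_induct)
          (use A B pure \<open>a \<in> carrier A\<close> \<open>b \<in> carrier B\<close> in \<open>simp_all add: ad alg_assoc\<close>)
    next
      case (add Y1 Y2)
      then show ?case using A B pure Z by (simp add: ad)
    qed
  next
    case (add X1 X2)
    then show ?case using Y Z by (simp add: ad)
  qed
  have one: "tens A B \<one>\<^bsub>A\<^esub> \<one>\<^bsub>B\<^esub> \<otimes>\<^bsub>?R\<^esub> X = X \<and> X \<otimes>\<^bsub>?R\<^esub> tens A B \<one>\<^bsub>A\<^esub> \<one>\<^bsub>B\<^esub> = X"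
    if "X \<in> carrier (A \<boxtimes> B)" for X
    using that by (induction rule: MP.tensor_induct) (use A B in \<open>simp_all add: ad\<close>)
  show ?thesis
  proof (rule algebra_over.intro)
    show "ring ?R"
      using A B by (intro ringI vs_abelian vs monoidI) (simp_all add: ad assoc one)
  qed (use vs field_K in \<open>simp_all add: ad\<close>)
qed

subsection \<open>Sweedler rules of a Hopf algebra\<close>

lemma antipode_lin: "hopf H \<Longrightarrow> lin H H (antipode H)"
  by (rule hopf_algebra.antipode_linear)

lemma antipode_closed [simp]: "hopf H \<Longrightarrow> x \<in> carrier H \<Longrightarrow> antipode H x \<in> carrier H"
  by (rule lin_closed[OF antipode_lin])

lemma lin_antipode [simp]: "hopf H \<Longrightarrow> lin M H g \<Longrightarrow> lin M H (\<lambda>x. antipode H (g x))"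
  by (rule lin_comp[OF antipode_lin])

lemma counit_mult [simp]:
  "hopf H \<Longrightarrow> x \<in> carrier H \<Longrightarrow> y \<in> carrier H \<Longrightarrow>
    counit H (x \<otimes>\<^bsub>H\<^esub> y) = counit H x \<bullet> counit H y"
  by (rule hopf_algebra.counit_mult)

lemma counit_one [simp]: "hopf H \<Longrightarrow> counit H \<one>\<^bsub>H\<^esub> = \<one>\<^bsub>K\<^esub>"
  by (rule hopf_algebra.counit_one)

lemma counit_smult [simp]:
  "coalg C \<Longrightarrow> c \<in> carrier K \<Longrightarrow> x \<in> carrier C \<Longrightarrow> counit C (c \<odot>\<^bsub>C\<^esub> x) = c \<bullet> counit C x"
  using lin_scale[OF counit_lin] by simp

lemma sw_one:
  assumes H: "hopf H" and P: "vs P" and f: "bilin H H P f"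
  shows "sw H P \<one>\<^bsub>H\<^esub> f = f \<one>\<^bsub>H\<^esub> \<one>\<^bsub>H\<^esub>"
  using hopf_algebra.comult_one[OF H] assms by (simp add: sweedler_sum_def tsum_pure)

lemma sw_tens:
  assumes "coalg C" "x \<in> carrier C"
  shows "sw C (C \<boxtimes> C) x (tens C C) = comult C x"
  using assms by (simp add: sweedler_sum_def tsum_tens)

lemma sw_mult:
  assumes H: "hopf H" and P: "vs P" and f: "bilin H H P f"
    and x: "x \<in> carrier H" and y: "y \<in> carrier H"
  shows "sw H P (x \<otimes>\<^bsub>H\<^esub> y) f
    = sw H P x (\<lambda>x1 x2. sw H P y (\<lambda>y1 y2. f (x1 \<otimes>\<^bsub>H\<^esub> y1) (x2 \<otimes>\<^bsub>H\<^esub> y2)))"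
proof -
  have "comult H (x \<otimes>\<^bsub>H\<^esub> y) = sw H (H \<boxtimes> H) x (\<lambda>x1 x2. sw H (H \<boxtimes> H) y (\<lambda>y1 y2.
      tens H H (x1 \<otimes>\<^bsub>H\<^esub> y1) (x2 \<otimes>\<^bsub>H\<^esub> y2)))"
    using hopf_algebra.comult_mult[OF H x y] H x y by (simp add: tensor_mult_eq sweedler_sum_def)
  then show ?thesis
    unfolding sweedler_sum_def[of K H P "x \<otimes>\<^bsub>H\<^esub> y"]
    using H P f by (simp add: lin_sw[OF _ P tsum_lin[OF _ _ P f]] tsum_pure)
qed

lemma sw_antipode_left:
  assumes H: "hopf H" and P: "vs P" and f: "lin H P f" and x: "x \<in> carrier H"
  shows "sw H P x (\<lambda>a b. f (antipode H a \<otimes>\<^bsub>H\<^esub> b)) = counit H x \<odot>\<^bsub>P\<^esub> f \<one>\<^bsub>H\<^esub>"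
proof -
  have "sweedler2 H H x (\<lambda>a b. antipode H a \<otimes>\<^bsub>H\<^esub> b) = sw H H x (\<lambda>a b. antipode H a \<otimes>\<^bsub>H\<^esub> b)"
    using H x by (intro sweedler2_sw_lin) simp_all
  then have "f (sw H H x (\<lambda>a b. antipode H a \<otimes>\<^bsub>H\<^esub> b)) = f (counit H x \<odot>\<^bsub>H\<^esub> \<one>\<^bsub>H\<^esub>)"
    using hopf_algebra.antipode_left[OF H x] by simp
  then show ?thesis
    using H P x by (simp add: lin_sw[OF _ P f] lin_scale[OF f])
qed

lemma sw_antipode_right:
  assumes H: "hopf H" and P: "vs P" and f: "lin H P f" and x: "x \<in> carrier H"
  shows "sw H P x (\<lambda>a b. f (a \<otimes>\<^bsub>H\<^esub> antipode H b)) = counit H x \<odot>\<^bsub>P\<^esub> f \<one>\<^bsub>H\<^esub>"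
proof -
  have "sweedler2 H H x (\<lambda>a b. a \<otimes>\<^bsub>H\<^esub> antipode H b) = sw H H x (\<lambda>a b. a \<otimes>\<^bsub>H\<^esub> antipode H b)"
    using H x by (intro sweedler2_sw_lin) simp_all
  then have "f (sw H H x (\<lambda>a b. a \<otimes>\<^bsub>H\<^esub> antipode H b)) = f (counit H x \<odot>\<^bsub>H\<^esub> \<one>\<^bsub>H\<^esub>)"
    using hopf_algebra.antipode_right[OF H x] by simp
  then show ?thesis
    using H P x by (simp add: lin_sw[OF _ P f] lin_scale[OF f])
qed

lemma counit_antipode [simp]:
  assumes H: "hopf H" and x: "x \<in> carrier H"
  shows "counit H (antipode H x) = counit H x"
proof -
  have "sw H KM x (\<lambda>a b. counit H b \<bullet> counit H (antipode H a)) = counit H x"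
    using sw_antipode_left[OF H vs_KM counit_lin x] H x by (simp add: K.m_comm)
  moreover have "sw H KM x (\<lambda>a b. counit H b \<bullet> counit H (antipode H a)) = counit H (antipode H x)"
    using sw_counit_right[of H KM x "\<lambda>a. counit H (antipode H a)"] H x by simp
  ultimately show ?thesis by simp
qed

lemma antipode_one [simp]:
  assumes H: "hopf H"
  shows "antipode H \<one>\<^bsub>H\<^esub> = \<one>\<^bsub>H\<^esub>"
proof -
  have "bilin H H H (\<lambda>a b. antipode H a \<otimes>\<^bsub>H\<^esub> b)"
    using H by (intro bilinI) simp_all
  then show ?thesis
    using sw_antipode_left[OF H _ lin_id, of "\<one>\<^bsub>H\<^esub>"] H by (simp add: sw_one)
qed

text \<open>Both sides are convolution inverse to the multiplication, as maps from \<open>H \<otimes> H\<close> to \<open>H\<close>.\<close>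

lemma antipode_mult:
  assumes H: "hopf H" and x: "x \<in> carrier H" and y: "y \<in> carrier H"
  shows "antipode H (x \<otimes>\<^bsub>H\<^esub> y) = antipode H y \<otimes>\<^bsub>H\<^esub> antipode H x"
proof (rule conv_inverse_unique[where C = H and D = H and R = H and G = "\<lambda>x y. x \<otimes>\<^bsub>H\<^esub> y"
      and F = "\<lambda>x y. antipode H (x \<otimes>\<^bsub>H\<^esub> y)" and L = "\<lambda>x y. antipode H y \<otimes>\<^bsub>H\<^esub> antipode H x"])
  fix a b assume ab: "a \<in> carrier H" "b \<in> carrier H"
  have "bilin H H H (\<lambda>a b. antipode H a \<otimes>\<^bsub>H\<^esub> b)"
    using H by (intro bilinI) simp_all
  then show "conv H H H (\<lambda>x y. x \<otimes>\<^bsub>H\<^esub> y) (\<lambda>x y. antipode H (x \<otimes>\<^bsub>H\<^esub> y)) (\<lambda>x y. x \<otimes>\<^bsub>H\<^esub> y) a b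
      = (counit H a \<bullet> counit H b) \<odot>\<^bsub>H\<^esub> \<one>\<^bsub>H\<^esub>"
    unfolding conv_def
    using sw_antipode_left[OF H _ lin_id, of "a \<otimes>\<^bsub>H\<^esub> b"] H ab by (simp add: sw_mult)
  have "sw H H b (\<lambda>y1 y2. (x1 \<otimes>\<^bsub>H\<^esub> y1) \<otimes>\<^bsub>H\<^esub> (antipode H y2 \<otimes>\<^bsub>H\<^esub> antipode H x2))
      = counit H b \<odot>\<^bsub>H\<^esub> (x1 \<otimes>\<^bsub>H\<^esub> antipode H x2)"
    if "x1 \<in> carrier H" "x2 \<in> carrier H" for x1 x2
    using sw_antipode_right[of H H "\<lambda>z. x1 \<otimes>\<^bsub>H\<^esub> (z \<otimes>\<^bsub>H\<^esub> antipode H x2)" b] H ab that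
    by (simp add: alg_assoc)
  then show "conv H H H (\<lambda>x y. x \<otimes>\<^bsub>H\<^esub> y) (\<lambda>x y. x \<otimes>\<^bsub>H\<^esub> y) (\<lambda>x y. antipode H y \<otimes>\<^bsub>H\<^esub> antipode H x) a b
      = (counit H a \<bullet> counit H b) \<odot>\<^bsub>H\<^esub> \<one>\<^bsub>H\<^esub>"
    unfolding conv_def
    using sw_antipode_right[of H H "\<lambda>z. counit H b \<odot>\<^bsub>H\<^esub> z" a] H ab
    by (simp add: vs_smult_smult)
qed (use H x y in \<open>auto intro!: bilinI\<close>)

text \<open>The antipode reverses the coproduct: \<open>x \<mapsto> \<Delta>(S(x))\<close> and
  \<open>x \<mapsto> S(x\<^sub>2) \<otimes> S(x\<^sub>1)\<close> are both convolution inverse to \<open>\<Delta>\<close>.\<close>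

lemma sw_antipode:
  assumes H: "hopf H" and P: "vs P" and f: "bilin H H P f" and x: "x \<in> carrier H"
  shows "sw H P (antipode H x) f = sw H P x (\<lambda>a b. f (antipode H b) (antipode H a))"
proof -
  let ?R = "tensor_algebra K H H"
  let ?L = "\<lambda>x. sw H (H \<boxtimes> H) x (\<lambda>a b. tens H H (antipode H b) (antipode H a))"
  note bl = tensor_mult_bilin[of H H]
  have vsT: "vs (H \<boxtimes> H)" using H by simp
  have "comult H (antipode H x) = ?L x"
  proof (rule conv1_inverse_unique[where C = H and R = ?R and G = "comult H"])
    fix a assume a: "a \<in> carrier H"
    have "conv1 H ?R (\<lambda>X Y. X \<otimes>\<^bsub>?R\<^esub> Y) (\<lambda>a. comult H (antipode H a)) (comult H) a
        = sw H (H \<boxtimes> H) a (\<lambda>x y. comult H (antipode H x \<otimes>\<^bsub>H\<^esub> y))"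
      unfolding conv1_def using H by (simp add: hopf_algebra.comult_mult[OF H])
    also have "\<dots> = counit H a \<odot>\<^bsub>?R\<^esub> \<one>\<^bsub>?R\<^esub>"
      using H a by (simp add: sw_antipode_left[OF H vsT comult_lin] hopf_algebra.comult_one[OF H])
    finally show "conv1 H ?R (\<lambda>X Y. X \<otimes>\<^bsub>?R\<^esub> Y) (\<lambda>a. comult H (antipode H a)) (comult H) a
        = counit H a \<odot>\<^bsub>?R\<^esub> \<one>\<^bsub>?R\<^esub>" .
    let ?t = "\<lambda>p q a b. tens H H (p \<otimes>\<^bsub>H\<^esub> antipode H b) (q \<otimes>\<^bsub>H\<^esub> antipode H a)"
    have 1: "comult H x1 \<otimes>\<^bsub>?R\<^esub> ?L z = sw H (H \<boxtimes> H) x1 (\<lambda>p q. sw H (H \<boxtimes> H) z (?t p q))"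
      if "x1 \<in> carrier H" "z \<in> carrier H" for x1 z
    proof -
      have "comult H x1 \<otimes>\<^bsub>?R\<^esub> ?L z = sw H (H \<boxtimes> H) x1 (tens H H) \<otimes>\<^bsub>?R\<^esub> ?L z"
        using H that by (simp add: sw_tens)
      also have "\<dots> = sw H (H \<boxtimes> H) x1 (\<lambda>p q. tens H H p q \<otimes>\<^bsub>?R\<^esub> ?L z)"
        using H that by (intro bilin_sw_left[OF bl]) simp_all
      also have "\<dots> = sw H (H \<boxtimes> H) x1 (\<lambda>p q. sw H (H \<boxtimes> H) z (?t p q))"
        using H by (simp add: bilin_sw_right[OF bl vsT vsT])
      finally show ?thesis .
    qed
    have 2: "sw H (H \<boxtimes> H) w (\<lambda>q z. sw H (H \<boxtimes> H) z (?t p q))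
        = tens H H (p \<otimes>\<^bsub>H\<^esub> antipode H w) \<one>\<^bsub>H\<^esub>" if "p \<in> carrier H" "w \<in> carrier H" for p w
    proof -
      have "sw H (H \<boxtimes> H) w (\<lambda>q z. sw H (H \<boxtimes> H) z (?t p q))
          = sw H (H \<boxtimes> H) w (\<lambda>u b. sw H (H \<boxtimes> H) u (\<lambda>q a. ?t p q a b))"
        using H that by (intro sw_coassoc[symmetric]) simp_all
      also have "\<dots> = sw H (H \<boxtimes> H) w (\<lambda>u b. counit H u \<odot>\<^bsub>H \<boxtimes> H\<^esub> tens H H (p \<otimes>\<^bsub>H\<^esub> antipode H b) \<one>\<^bsub>H\<^esub>)"
        using H that
        by (intro sw_cong refl sw_antipode_right[where f = "\<lambda>z. tens H H _ z"]) simp_all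
      also have "\<dots> = tens H H (p \<otimes>\<^bsub>H\<^esub> antipode H w) \<one>\<^bsub>H\<^esub>"
        using H that by (intro sw_counit_left) simp_all
      finally show ?thesis .
    qed
    have "conv1 H ?R (\<lambda>X Y. X \<otimes>\<^bsub>?R\<^esub> Y) (comult H) ?L a
        = sw H (H \<boxtimes> H) a (\<lambda>x1 z. sw H (H \<boxtimes> H) x1 (\<lambda>p q. sw H (H \<boxtimes> H) z (?t p q)))"
      unfolding conv1_def by (simp add: 1)
    also have "\<dots> = sw H (H \<boxtimes> H) a (\<lambda>p w. sw H (H \<boxtimes> H) w (\<lambda>q z. sw H (H \<boxtimes> H) z (?t p q)))"
      using H a by (intro sw_coassoc) simp_all
    also have "\<dots> = counit H a \<odot>\<^bsub>H \<boxtimes> H\<^esub> tens H H \<one>\<^bsub>H\<^esub> \<one>\<^bsub>H\<^esub>"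
      using H a by (simp add: 2 sw_antipode_right[where f = "\<lambda>z. tens H H z \<one>\<^bsub>H\<^esub>"])
    finally show "conv1 H ?R (\<lambda>X Y. X \<otimes>\<^bsub>?R\<^esub> Y) (comult H) ?L a = counit H a \<odot>\<^bsub>?R\<^esub> \<one>\<^bsub>?R\<^esub>"
      by simp
  qed (use H x in \<open>simp_all add: comult_lin\<close>)
  then show ?thesis
    unfolding sweedler_sum_def[of K H P "antipode H x"]
    using H P f by (simp add: lin_sw[OF _ P tsum_lin[OF _ _ P f]] tsum_pure)
qed

subsection \<open>Cocentral maps\<close>

lemma coalgebra_map_lin: "coalgebra_map K C D v \<Longrightarrow> lin C D v"
  and coalgebra_map_counit: "coalgebra_map K C D v \<Longrightarrow> x \<in> carrier C \<Longrightarrow> counit D (v x) = counit C x"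
  by (simp_all add: coalgebra_map_def)

lemma cocentral_coalgebra_map: "cocentral_map K H A r \<Longrightarrow> coalgebra_map K H A r"
  by (simp add: cocentral_map_def)

lemma cocentral_sw:
  assumes H: "coalg H" and A: "coalg A" and r: "cocentral_map K H A r" and x: "x \<in> carrier H"
    and P: "vs P" and f: "bilin A H P f"
  shows "sw H P x (\<lambda>a b. f (r a) b) = sw H P x (\<lambda>a b. f (r b) a)"
proof -
  note rl = coalgebra_map_lin[OF cocentral_coalgebra_map[OF r]]
  note rc = lin_closed[OF rl]
  have "tsum A H P (sw H (A \<boxtimes> H) x (\<lambda>a b. tens A H (r a) b)) f
      = tsum A H P (sw H (A \<boxtimes> H) x (\<lambda>a b. tens A H (r b) a)) f"
    using r x H A sweedler2_sw_lin[of H "A \<boxtimes> H" x "\<lambda>a b. tens A H (r a) b"]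
      sweedler2_sw_lin[of H "A \<boxtimes> H" x "\<lambda>a b. tens A H (r b) a"]
    by (simp add: cocentral_map_def rl rc)
  then show ?thesis
    using H A P f by (simp add: lin_sw[OF _ P tsum_lin[OF _ _ P f]] tsum_pure rc)
qed

text \<open>The image of a cocentral map is cocommutative: \<open>r(h\<^sub>1) \<otimes> r(h\<^sub>2) = r(h\<^sub>2) \<otimes> r(h\<^sub>1)\<close>. Hence
  \<open>S(S(r(h\<^sub>1))) S(r(h\<^sub>2)) = S(r(h\<^sub>2) S(r(h\<^sub>1))) = S(r(h\<^sub>1) S(r(h\<^sub>2))) = \<epsilon>(h) 1\<close>, and
  \<open>S \<circ> S \<circ> r\<close> and \<open>r\<close> are both inverse to \<open>S \<circ> r\<close>.\<close>

lemma cocentral_antipode_twice: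
  assumes H: "hopf H" and A: "hopf A" and r: "cocentral_map K H A r" and x: "x \<in> carrier H"
  shows "antipode A (antipode A (r x)) = r x"
proof (rule conv1_inverse_unique[where C = H and R = A and G = "\<lambda>x. antipode A (r x)"
      and F = "\<lambda>x. antipode A (antipode A (r x))" and L = r])
  note cm = cocentral_coalgebra_map[OF r]
  note rl = coalgebra_map_lin[OF cm]
  note rc = lin_closed[OF rl]
  note re = coalgebra_map_counit[OF cm]
  fix a assume a: "a \<in> carrier H"
  have "bilin A A A (\<lambda>x y. antipode A x \<otimes>\<^bsub>A\<^esub> y)"
    using A by (intro bilinI) simp_all
  then show "conv1 H A (\<lambda>x y. x \<otimes>\<^bsub>A\<^esub> y) (\<lambda>x. antipode A (r x)) r a = counit H a \<odot>\<^bsub>A\<^esub> \<one>\<^bsub>A\<^esub>"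
    unfolding conv1_def
    using H A a rc re sw_coalgebra_map[OF _ _ cm a, of A "\<lambda>x y. antipode A x \<otimes>\<^bsub>A\<^esub> y"]
      sw_antipode_left[OF A _ lin_id, of "r a"] by simp
  have f: "bilin A A A (\<lambda>x y. antipode A (x \<otimes>\<^bsub>A\<^esub> antipode A y))"
    "bilin A H A (\<lambda>x y. antipode A (r y \<otimes>\<^bsub>A\<^esub> antipode A x))"
    using A H by (auto intro!: bilinI lin_comp[OF rl] simp: rc rl)
  have "conv1 H A (\<lambda>x y. x \<otimes>\<^bsub>A\<^esub> y) (\<lambda>x. antipode A (antipode A (r x))) (\<lambda>x. antipode A (r x)) a
      = sw H A a (\<lambda>x y. antipode A (r y \<otimes>\<^bsub>A\<^esub> antipode A (r x)))"
    unfolding conv1_def using A by (simp add: antipode_mult rc)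
  also have "\<dots> = sw H A a (\<lambda>x y. antipode A (r x \<otimes>\<^bsub>A\<^esub> antipode A (r y)))"
    using cocentral_sw[OF _ _ r a _ f(2)] H A by simp
  also have "\<dots> = counit H a \<odot>\<^bsub>A\<^esub> \<one>\<^bsub>A\<^esub>"
    using H A a rc re sw_coalgebra_map[OF _ _ cm a _ f(1)]
      sw_antipode_right[OF A _ antipode_lin[OF A], of "r a"] by simp
  finally show "conv1 H A (\<lambda>x y. x \<otimes>\<^bsub>A\<^esub> y) (\<lambda>x. antipode A (antipode A (r x))) (\<lambda>x. antipode A (r x)) a
      = counit H a \<odot>\<^bsub>A\<^esub> \<one>\<^bsub>A\<^esub>" .
qed (use H A x coalgebra_map_lin[OF cocentral_coalgebra_map[OF r]] in simp_all)

section \<open>Skew pairings and their conjugation operator\<close>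

lemma bilin_smult: "vs P \<Longrightarrow> bilin KM P P (\<lambda>c p. c \<odot>\<^bsub>P\<^esub> p)"
  by (intro bilinI) simp_all

lemma bilin_smult_right: "vs P \<Longrightarrow> bilin P KM P (\<lambda>p c. c \<odot>\<^bsub>P\<^esub> p)"
  by (intro bilinI) simp_all

lemma bilin_K_mult: "bilin KM KM KM (\<lambda>c d. c \<bullet> d)"
  by (intro bilinI) simp_all

lemma smult_sw:
  "vs P \<Longrightarrow> c \<in> carrier K \<Longrightarrow> (\<And>a b. a \<in> carrier C \<Longrightarrow> b \<in> carrier C \<Longrightarrow> f a b \<in> carrier P) \<Longrightarrow>
    c \<odot>\<^bsub>P\<^esub> sw C P x f = sw C P x (\<lambda>a b. c \<odot>\<^bsub>P\<^esub> f a b)"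
  by (rule lin_sw) simp_all

lemma sw_smult:
  "vs P \<Longrightarrow> p \<in> carrier P \<Longrightarrow> (\<And>a b. a \<in> carrier C \<Longrightarrow> b \<in> carrier C \<Longrightarrow> f a b \<in> carrier K) \<Longrightarrow>
    sw C KM x f \<odot>\<^bsub>P\<^esub> p = sw C P x (\<lambda>a b. f a b \<odot>\<^bsub>P\<^esub> p)"
  by (rule lin_sw[of KM P "\<lambda>c. c \<odot>\<^bsub>P\<^esub> p"]) simp_all

text \<open>Conjugation by a product is iterated conjugation: with \<open>\<alpha> = \<alpha>1 * \<alpha>2\<close> and
  \<open>\<beta> = \<beta>1 * \<beta>2\<close> this is \<open>\<alpha> * G * \<beta> = \<alpha>1 * (\<alpha>2 * G * \<beta>1) * \<beta>2\<close>.\<close>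

lemma conjugate1_mult:
  assumes H: "coalg H" and P: "vs P" and \<alpha>: "lin H KM \<alpha>1" "lin H KM \<alpha>2"
    and \<beta>: "lin H KM \<beta>1" "lin H KM \<beta>2" and G: "lin H P G" and h: "h \<in> carrier H"
  shows "sw H P h (\<lambda>h1 h'. sw H P h' (\<lambda>h2 h3.
      (sw H KM h1 (\<lambda>p q. \<alpha>1 p \<bullet> \<alpha>2 q) \<bullet> sw H KM h3 (\<lambda>s t. \<beta>1 s \<bullet> \<beta>2 t)) \<odot>\<^bsub>P\<^esub> G h2))
    = sw H P h (\<lambda>h1 h'. sw H P h' (\<lambda>h2 h3. (\<alpha>1 h1 \<bullet> \<beta>2 h3) \<odot>\<^bsub>P\<^esub>
        sw H P h2 (\<lambda>p w. sw H P w (\<lambda>q s. (\<alpha>2 p \<bullet> \<beta>1 s) \<odot>\<^bsub>P\<^esub> G q))))"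
    (is "?lhs = ?rhs")
proof -
  let ?s = "\<lambda>c p. c \<odot>\<^bsub>P\<^esub> p" and ?t = "\<lambda>p c. c \<odot>\<^bsub>P\<^esub> p" and ?m = "\<lambda>c d. c \<bullet> d"
  note bl = bilin_smult[OF P] bilin_smult_right[OF P] bilin_K_mult
  note lc = lin_conv1[OF H P bl(1)] lin_conv1[OF H P bl(2)] lin_conv1[OF H vs_KM bl(3)]
  note cl = lin_closed[OF \<alpha>(1)] lin_closed[OF \<alpha>(2)] lin_closed[OF \<beta>(1)] lin_closed[OF \<beta>(2)]
    lin_closed[OF G]
  note cl' = cl[simplified]
  note assoc = conv1_assoc[OF H]
  have "?lhs = conv1 H P ?s (conv1 H KM ?m \<alpha>1 \<alpha>2) (conv1 H P ?t G (conv1 H KM ?m \<beta>1 \<beta>2)) h"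
    unfolding conv1_def using P by (simp add: smult_sw vs_smult_smult cl')
  also have "\<dots> = conv1 H P ?s \<alpha>1 (conv1 H P ?s \<alpha>2 (conv1 H P ?t G (conv1 H KM ?m \<beta>1 \<beta>2))) h"
    using P h by (intro assoc[OF _ _ _ bl(3) bl(1) bl(1) bl(1)])
      (simp_all add: vs_smult_smult \<alpha> \<beta> G lc)
  also have "\<dots> = conv1 H P ?s \<alpha>1 (conv1 H P ?s \<alpha>2 (conv1 H P ?t (conv1 H P ?t G \<beta>1) \<beta>2)) h"
    using P by (intro conv1_cong refl assoc[OF _ _ _ bl(2) bl(2) bl(3) bl(2), symmetric])
      (simp_all add: vs_smult_smult K.m_comm \<alpha> \<beta> G)
  also have "\<dots> = conv1 H P ?s \<alpha>1 (conv1 H P ?t (conv1 H P ?s \<alpha>2 (conv1 H P ?t G \<beta>1)) \<beta>2) h"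
    using P by (intro conv1_cong refl assoc[OF _ _ _ bl(1) bl(2) bl(2) bl(1), symmetric])
      (simp_all add: vs_smult_smult K.m_comm \<alpha> \<beta> G lc)
  also have "\<dots> = ?rhs"
    unfolding conv1_def using P by (simp add: smult_sw vs_smult_smult cl' K.m_assoc)
  finally show ?thesis .
qed

end

locale pairing = scalars K for K :: "('k, 'r) ring_scheme" +
  fixes A :: "('k, 'a, 'm) hopf_scheme" and H :: "('k, 'h, 'n) hopf_scheme"
    and l :: "'h \<Rightarrow> 'a \<Rightarrow> 'k"
  assumes hopf_A [simp]: "hopf A" and hopf_H [simp]: "hopf H" and skew: "skew_pairing K H A l"
begin

lemma bilin_l: "bilin H A KM l"
  using skew by (simp add: skew_pairing_def bilinear_form_iff)

lemma l_closed [simp]: "h \<in> carrier H \<Longrightarrow> a \<in> carrier A \<Longrightarrow> l h a \<in> carrier K"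
  using bilin_closed[OF bilin_l] by simp

lemma lin_l_left [simp]: "a \<in> carrier A \<Longrightarrow> lin M H g \<Longrightarrow> lin M KM (\<lambda>x. l (g x) a)"
  by (rule bilin_comp_left[OF bilin_l])

lemma lin_l_right [simp]: "h \<in> carrier H \<Longrightarrow> lin M A g \<Longrightarrow> lin M KM (\<lambda>x. l h (g x))"
  by (rule bilin_comp_right[OF bilin_l])

lemma l_one_left [simp]: "a \<in> carrier A \<Longrightarrow> l \<one>\<^bsub>H\<^esub> a = counit A a"
  and l_one_right [simp]: "h \<in> carrier H \<Longrightarrow> l h \<one>\<^bsub>A\<^esub> = counit H h"
  using skew by (simp_all add: skew_pairing_def)

lemma l_mult_left:
  assumes "h \<in> carrier H" "g \<in> carrier H" "a \<in> carrier A"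
  shows "l (h \<otimes>\<^bsub>H\<^esub> g) a = sw A KM a (\<lambda>a1 a2. l h a1 \<bullet> l g a2)"
proof -
  have "l (h \<otimes>\<^bsub>H\<^esub> g) a = sweedler2 A K a (\<lambda>a1 a2. l h a1 \<bullet> l g a2)"
    using skew assms by (simp add: skew_pairing_def)
  also have "\<dots> = sw A KM a (\<lambda>a1 a2. l h a1 \<bullet> l g a2)"
    using assms by (intro sweedler2_K) simp_all
  finally show ?thesis .
qed

lemma l_mult_right:
  assumes "h \<in> carrier H" "a \<in> carrier A" "b \<in> carrier A"
  shows "l h (a \<otimes>\<^bsub>A\<^esub> b) = sw H KM h (\<lambda>h1 h2. l h1 b \<bullet> l h2 a)"
proof -
  have "l h (a \<otimes>\<^bsub>A\<^esub> b) = sweedler2 H K h (\<lambda>h1 h2. l h1 b \<bullet> l h2 a)"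
    using skew assms by (simp add: skew_pairing_def)
  also have "\<dots> = sw H KM h (\<lambda>h1 h2. l h1 b \<bullet> l h2 a)"
    using assms by (intro sweedler2_K) simp_all
  finally show ?thesis .
qed

lemma l_inverse_right:
  assumes "h \<in> carrier H" "a \<in> carrier A"
  shows "sw H KM h (\<lambda>h1 h2. sw A KM a (\<lambda>a1 a2. l h1 a1 \<bullet> l (antipode H h2) a2))
    = counit H h \<bullet> counit A a"
  using assms sw_antipode_right[of H KM "\<lambda>z. l z a" h] by (simp add: l_mult_left[symmetric])

text \<open>Here the order of the legs is not reversed, because \<open>\<lambda>\<close> and the antipode reverse it once each.\<close>

lemma l_antipode_mult:
  assumes "h \<in> carrier H" "a \<in> carrier A" "b \<in> carrier A"
  shows "l (antipode H h) (a \<otimes>\<^bsub>A\<^esub> b)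
    = sw H KM h (\<lambda>h1 h2. l (antipode H h1) a \<bullet> l (antipode H h2) b)"
proof -
  have "bilin H H KM (\<lambda>h1 h2. l h1 b \<bullet> l h2 a)"
    using assms by (intro bilinI) simp_all
  then show ?thesis
    using assms by (simp add: l_mult_right sw_antipode K.m_comm)
qed

text \<open>Both \<open>\<lambda>(h, a)\<close> and \<open>\<lambda>(S(h), S(a))\<close> are convolution inverse to \<open>\<lambda>(S(h), a)\<close>.\<close>

lemma l_antipode_antipode:
  assumes "h \<in> carrier H" "a \<in> carrier A"
  shows "l (antipode H h) (antipode A a) = l h a"
proof (rule conv_inverse_unique[where C = H and D = A and R = KM and F = l and
      G = "\<lambda>h a. l (antipode H h) a" and L = "\<lambda>h a. l (antipode H h) (antipode A a)", symmetric])
  fix h a assume ha: "h \<in> carrier H" "a \<in> carrier A"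
  show "conv H A KM (\<lambda>x y. x \<otimes>\<^bsub>KM\<^esub> y) l (\<lambda>h a. l (antipode H h) a) h a
      = (counit H h \<bullet> counit A a) \<odot>\<^bsub>KM\<^esub> \<one>\<^bsub>KM\<^esub>"
    unfolding conv_def using ha by (simp add: l_inverse_right)
  have "sw H KM h (\<lambda>x1 x2. sw A KM a (\<lambda>y1 y2. l (antipode H x1) y1 \<bullet> l (antipode H x2) (antipode A y2)))
      = sw A KM a (\<lambda>y1 y2. l (antipode H h) (y1 \<otimes>\<^bsub>A\<^esub> antipode A y2))"
    using ha by (subst sw_swap) (simp_all add: l_antipode_mult)
  also have "\<dots> = counit H h \<bullet> counit A a"
    using ha sw_antipode_right[of A KM "\<lambda>z. l (antipode H h) z" a] by (simp add: K.m_comm)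
  finally show "conv H A KM (\<lambda>x y. x \<otimes>\<^bsub>KM\<^esub> y) (\<lambda>h a. l (antipode H h) a)
        (\<lambda>h a. l (antipode H h) (antipode A a)) h a
      = (counit H h \<bullet> counit A a) \<odot>\<^bsub>KM\<^esub> \<one>\<^bsub>KM\<^esub>"
    unfolding conv_def using ha by simp
qed (use assms bilin_l in \<open>auto intro!: bilinI\<close>)

text \<open>This is \<open>\<lambda>\<^sup>-\<^sup>1 * F * \<lambda>\<close>, the value at \<open>(h, a)\<close> being
  \<open>\<lambda>(S(h\<^sub>1), a\<^sub>1) F(h\<^sub>2, a\<^sub>2) \<lambda>(h\<^sub>3, a\<^sub>3)\<close>.\<close>

definition conjugate where
  "conjugate P F = conv H A P (\<lambda>c p. c \<odot>\<^bsub>P\<^esub> p) (\<lambda>h a. l (antipode H h) a)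
     (conv H A P (\<lambda>p c. c \<odot>\<^bsub>P\<^esub> p) F l)"

lemma bilin_l_inv: "bilin H A KM (\<lambda>h a. l (antipode H h) a)"
  by (intro bilinI) simp_all

lemma bilin_conjugate:
  "vs P \<Longrightarrow> bilin H A P F \<Longrightarrow> bilin H A P (conjugate P F)"
  unfolding conjugate_def
  by (rule bilin_conv[OF _ _ _ bilin_smult bilin_l_inv bilin_conv[OF _ _ _ bilin_smult_right _ bilin_l]])
    simp_all

lemma conjugate_cong:
  "(\<And>h a. h \<in> carrier H \<Longrightarrow> a \<in> carrier A \<Longrightarrow> F h a = G h a) \<Longrightarrow> conjugate P F h a = conjugate P G h a"
  unfolding conjugate_def by (intro conv_cong refl)

lemma conjugate_sw:
  assumes P: "vs P" and F: "\<And>h a. h \<in> carrier H \<Longrightarrow> a \<in> carrier A \<Longrightarrow> F h a \<in> carrier P"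
  shows "conjugate P F h a = sw H P h (\<lambda>h1 h'. sw H P h' (\<lambda>h2 h3. sw A P a (\<lambda>a1 a'. sw A P a' (\<lambda>a2 a3.
      (l (antipode H h1) a1 \<bullet> l h3 a3) \<odot>\<^bsub>P\<^esub> F h2 a2))))"
proof -
  have "conjugate P F h a = sw H P h (\<lambda>h1 h'. sw A P a (\<lambda>a1 a'. sw H P h' (\<lambda>h2 h3. sw A P a' (\<lambda>a2 a3.
      (l (antipode H h1) a1 \<bullet> l h3 a3) \<odot>\<^bsub>P\<^esub> F h2 a2))))"
    unfolding conjugate_def conv_def using P F by (simp add: smult_sw vs_smult_smult)
  also have "\<dots> = sw H P h (\<lambda>h1 h'. sw H P h' (\<lambda>h2 h3. sw A P a (\<lambda>a1 a'. sw A P a' (\<lambda>a2 a3.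
      (l (antipode H h1) a1 \<bullet> l h3 a3) \<odot>\<^bsub>P\<^esub> F h2 a2))))"
    using P F by (intro sw_cong refl sw_swap) simp_all
  finally show ?thesis .
qed

lemma lin_conjugate:
  assumes P: "vs P" and Q: "vs Q" and \<phi>: "lin P Q \<phi>"
    and F: "\<And>h a. h \<in> carrier H \<Longrightarrow> a \<in> carrier A \<Longrightarrow> F h a \<in> carrier P"
  shows "\<phi> (conjugate P F h a) = conjugate Q (\<lambda>h a. \<phi> (F h a)) h a"
  using assms by (simp add: conjugate_sw lin_closed[OF \<phi>] lin_sw[OF P Q \<phi>] lin_scale[OF \<phi>])

lemma conjugate_one_left:
  assumes P: "vs P" and F: "bilin H A P F" and a: "a \<in> carrier A"
  shows "conjugate P F \<one>\<^bsub>H\<^esub> a = F \<one>\<^bsub>H\<^esub> a"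
proof -
  note cl = bilin_closed[OF F] bilin_left[OF F] bilin_right[OF F]
  have "conjugate P F \<one>\<^bsub>H\<^esub> a = sw A P a (\<lambda>a1 a'. sw A P a' (\<lambda>a2 a3.
      (counit A a1 \<bullet> counit A a3) \<odot>\<^bsub>P\<^esub> F \<one>\<^bsub>H\<^esub> a2))"
    using P by (simp add: conjugate_sw sw_one bilinI cl)
  also have "\<dots> = F \<one>\<^bsub>H\<^esub> a"
    using P a by (simp add: vs_smult_smult[symmetric] smult_sw[symmetric] sw_counit_right sw_counit_left cl)
  finally show ?thesis .
qed

lemma conjugate_one_right:
  assumes P: "vs P" and F: "bilin H A P F" and h: "h \<in> carrier H"
  shows "conjugate P F h \<one>\<^bsub>A\<^esub> = F h \<one>\<^bsub>A\<^esub>"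
proof -
  note cl = bilin_closed[OF F] bilin_left[OF F] bilin_right[OF F]
  have "conjugate P F h \<one>\<^bsub>A\<^esub> = sw H P h (\<lambda>h1 h'. sw H P h' (\<lambda>h2 h3.
      (counit H h1 \<bullet> counit H h3) \<odot>\<^bsub>P\<^esub> F h2 \<one>\<^bsub>A\<^esub>))"
    using P by (simp add: conjugate_sw sw_one bilinI cl)
  also have "\<dots> = F h \<one>\<^bsub>A\<^esub>"
    using P h by (simp add: vs_smult_smult[symmetric] smult_sw[symmetric] sw_counit_right sw_counit_left cl)
  finally show ?thesis .
qed

lemma conjugate_left:
  assumes P: "vs P" and G: "lin A P G" and h: "h \<in> carrier H" and a: "a \<in> carrier A"
  shows "conjugate P (\<lambda>h a. counit H h \<odot>\<^bsub>P\<^esub> G a) h a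
    = sw H P h (\<lambda>h1 h2. sw A P a (\<lambda>a1 a'. sw A P a' (\<lambda>a2 a3.
        (l (antipode H h1) a1 \<bullet> l h2 a3) \<odot>\<^bsub>P\<^esub> G a2)))"
proof -
  note cl = lin_closed[OF G]
  have "sw H P h' (\<lambda>h2 h3. sw A P a (\<lambda>a1 a'. sw A P a' (\<lambda>a2 a3.
      (l (antipode H h1) a1 \<bullet> l h3 a3) \<odot>\<^bsub>P\<^esub> (counit H h2 \<odot>\<^bsub>P\<^esub> G a2))))
    = sw A P a (\<lambda>a1 a'. sw A P a' (\<lambda>a2 a3. (l (antipode H h1) a1 \<bullet> l h' a3) \<odot>\<^bsub>P\<^esub> G a2))"
    if "h1 \<in> carrier H" "h' \<in> carrier H" for h1 h'
  proof -
    have "sw H P h' (\<lambda>h2 h3. sw A P a (\<lambda>a1 a'. sw A P a' (\<lambda>a2 a3.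
        (l (antipode H h1) a1 \<bullet> l h3 a3) \<odot>\<^bsub>P\<^esub> (counit H h2 \<odot>\<^bsub>P\<^esub> G a2))))
      = sw H P h' (\<lambda>h2 h3. counit H h2 \<odot>\<^bsub>P\<^esub> sw A P a (\<lambda>a1 a'. sw A P a' (\<lambda>a2 a3.
        (l (antipode H h1) a1 \<bullet> l h3 a3) \<odot>\<^bsub>P\<^esub> G a2)))"
      using P that by (simp add: smult_sw vs_smult_smult cl K.m_comm)
    then show ?thesis
      using P that by (simp add: sw_counit_left[where f = "\<lambda>h3. sw A P a (\<lambda>a1 a'. sw A P a' (\<lambda>a2 a3.
        (l (antipode H h1) a1 \<bullet> l h3 a3) \<odot>\<^bsub>P\<^esub> G a2))"] cl)
  qed
  then show ?thesis
    using P h a by (simp add: conjugate_sw cl)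
qed

lemma conjugate_right:
  assumes P: "vs P" and G: "lin H P G" and h: "h \<in> carrier H" and a: "a \<in> carrier A"
  shows "conjugate P (\<lambda>h a. counit A a \<odot>\<^bsub>P\<^esub> G h) h a
    = sw H P h (\<lambda>h1 h'. sw H P h' (\<lambda>h2 h3. l (antipode H h1 \<otimes>\<^bsub>H\<^esub> h3) a \<odot>\<^bsub>P\<^esub> G h2))"
proof -
  note cl = lin_closed[OF G]
  have "sw A P a' (\<lambda>a2 a3. (x \<bullet> l h3 a3) \<odot>\<^bsub>P\<^esub> (counit A a2 \<odot>\<^bsub>P\<^esub> p)) = (x \<bullet> l h3 a') \<odot>\<^bsub>P\<^esub> p"
    if "x \<in> carrier K" "p \<in> carrier P" "h3 \<in> carrier H" "a' \<in> carrier A" for x p h3 a'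
    using P that sw_counit_left[of A P a' "\<lambda>a3. (x \<bullet> l h3 a3) \<odot>\<^bsub>P\<^esub> p"]
    by (simp add: vs_smult_smult K.m_comm)
  then show ?thesis
    using P h a by (simp add: conjugate_sw cl l_mult_left sw_smult)
qed

text \<open>As \<open>\<lambda>(h, c y) = \<lambda>(h\<^sub>1, y) \<lambda>(h\<^sub>2, c)\<close>, conjugating by \<open>\<lambda>(\<cdot>, c y)\<close> is conjugating by
  \<open>\<lambda>(\<cdot>, y)\<close> and then by \<open>\<lambda>(\<cdot>, c)\<close>. The compatibility of the two actions with the
  product of \<open>A\<close> is contained in this formula.\<close>

lemma conjugate_mult_right:
  assumes P: "vs P" and F: "bilin H A P F"
    and h: "h \<in> carrier H" and c: "c \<in> carrier A" and y: "y \<in> carrier A"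
  shows "conjugate P F h (c \<otimes>\<^bsub>A\<^esub> y)
    = conjugate P (\<lambda>h' c'. conjugate P (\<lambda>h'' y'. F h'' (c' \<otimes>\<^bsub>A\<^esub> y')) h' y) h c"
proof -
  note cl = bilin_closed[OF F]
  note li = bilin_comp_left[OF F] bilin_comp_right[OF F]
  note swap = sw_swap[where C = H and D = A]
  let ?T = "\<lambda>c1 c2 c3 y1 y2 y3. sw H P h (\<lambda>h1 h'. sw H P h' (\<lambda>h2 h3.
      (l (antipode H h1) (c1 \<otimes>\<^bsub>A\<^esub> y1) \<bullet> l h3 (c3 \<otimes>\<^bsub>A\<^esub> y3)) \<odot>\<^bsub>P\<^esub> F h2 (c2 \<otimes>\<^bsub>A\<^esub> y2)))"
  let ?U = "\<lambda>c1 c2 c3 y1 y2 y3. sw H P h (\<lambda>h1 h'. sw H P h' (\<lambda>h2 h3.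
      (l (antipode H h1) c1 \<bullet> l h3 c3) \<odot>\<^bsub>P\<^esub> sw H P h2 (\<lambda>p w. sw H P w (\<lambda>q s.
        (l (antipode H p) y1 \<bullet> l s y3) \<odot>\<^bsub>P\<^esub> F q (c2 \<otimes>\<^bsub>A\<^esub> y2)))))"
  have eq: "?T c1 c2 c3 y1 y2 y3 = ?U c1 c2 c3 y1 y2 y3"
    if "c1 \<in> carrier A" "c2 \<in> carrier A" "c3 \<in> carrier A" "y1 \<in> carrier A" "y2 \<in> carrier A" "y3 \<in> carrier A"
    for c1 c2 c3 y1 y2 y3
    using that P h
      conjugate1_mult[of H P "\<lambda>p. l (antipode H p) c1" "\<lambda>q. l (antipode H q) y1" "\<lambda>s. l s y3"
        "\<lambda>t. l t c3" "\<lambda>q. F q (c2 \<otimes>\<^bsub>A\<^esub> y2)" h]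
    by (simp add: l_antipode_mult[OF _ that(1,4)] l_mult_right[OF _ that(3,6)] li)
  have inner: "sw A P (c \<otimes>\<^bsub>A\<^esub> y) (\<lambda>a1 a'. sw A P a' (\<lambda>a2 a3.
        (l (antipode H h1) a1 \<bullet> l h3 a3) \<odot>\<^bsub>P\<^esub> F h2 a2))
      = sw A P c (\<lambda>c1 c'. sw A P c' (\<lambda>c2 c3. sw A P y (\<lambda>y1 y'. sw A P y' (\<lambda>y2 y3.
        (l (antipode H h1) (c1 \<otimes>\<^bsub>A\<^esub> y1) \<bullet> l h3 (c3 \<otimes>\<^bsub>A\<^esub> y3)) \<odot>\<^bsub>P\<^esub> F h2 (c2 \<otimes>\<^bsub>A\<^esub> y2)))))"
    if "h1 \<in> carrier H" "h2 \<in> carrier H" "h3 \<in> carrier H" for h1 h2 h3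
  proof -
    have "sw A P (c \<otimes>\<^bsub>A\<^esub> y) (\<lambda>a1 a'. sw A P a' (\<lambda>a2 a3.
        (l (antipode H h1) a1 \<bullet> l h3 a3) \<odot>\<^bsub>P\<^esub> F h2 a2))
      = sw A P c (\<lambda>c1 c'. sw A P y (\<lambda>y1 y'. sw A P c' (\<lambda>c2 c3. sw A P y' (\<lambda>y2 y3.
        (l (antipode H h1) (c1 \<otimes>\<^bsub>A\<^esub> y1) \<bullet> l h3 (c3 \<otimes>\<^bsub>A\<^esub> y3)) \<odot>\<^bsub>P\<^esub> F h2 (c2 \<otimes>\<^bsub>A\<^esub> y2)))))"
      using P that c y by (simp add: sw_mult bilinI li cl)
    also have "\<dots> = sw A P c (\<lambda>c1 c'. sw A P c' (\<lambda>c2 c3. sw A P y (\<lambda>y1 y'. sw A P y' (\<lambda>y2 y3.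
        (l (antipode H h1) (c1 \<otimes>\<^bsub>A\<^esub> y1) \<bullet> l h3 (c3 \<otimes>\<^bsub>A\<^esub> y3)) \<odot>\<^bsub>P\<^esub> F h2 (c2 \<otimes>\<^bsub>A\<^esub> y2)))))"
      using P that by (intro sw_cong refl sw_swap) (simp_all add: cl)
    finally show ?thesis .
  qed
  have "conjugate P F h (c \<otimes>\<^bsub>A\<^esub> y) = sw A P c (\<lambda>c1 c'. sw A P c' (\<lambda>c2 c3. sw A P y (\<lambda>y1 y'. sw A P y' (\<lambda>y2 y3.
      ?T c1 c2 c3 y1 y2 y3))))"
    using P by (simp add: conjugate_sw cl inner swap)
  also have "\<dots> = sw A P c (\<lambda>c1 c'. sw A P c' (\<lambda>c2 c3. sw A P y (\<lambda>y1 y'. sw A P y' (\<lambda>y2 y3.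
      ?U c1 c2 c3 y1 y2 y3))))"
    by (intro sw_cong refl eq)
  also have "\<dots> = conjugate P (\<lambda>h' c'. conjugate P (\<lambda>h'' y'. F h'' (c' \<otimes>\<^bsub>A\<^esub> y')) h' y) h c"
    using P by (simp add: conjugate_sw cl smult_sw swap)
  finally show ?thesis .
qed

text \<open>The inner factors cancel in \<open>(\<lambda>\<^sup>-\<^sup>1 * F * \<lambda>) * (\<lambda>\<^sup>-\<^sup>1 * G * \<lambda>)\<close>.\<close>

lemma conv_conjugate:
  assumes P: "vs P" and Q: "vs Q" and R: "vs R" and B: "bilin P Q R B"
    and F: "bilin H A P F" and G: "bilin H A Q G" and h: "h \<in> carrier H" and a: "a \<in> carrier A"
  shows "conv H A R B (conjugate P F) (conjugate Q G) h a = conjugate R (conv H A R B F G) h a"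
proof -
  let ?s = "\<lambda>M c p. c \<odot>\<^bsub>M\<^esub> p" and ?t = "\<lambda>M p c. c \<odot>\<^bsub>M\<^esub> p" and ?m = "\<lambda>c d. c \<bullet> d"
  let ?i = "\<lambda>h a. l (antipode H h) a"
  let ?F' = "conv H A P (?t P) F l" and ?G' = "conv H A Q (?t Q) G l"
  have C: "coalg H" "coalg A" by simp_all
  note bc = bilin_conv[OF C]
  note assoc = conv_assoc[OF C]
  have F': "bilin H A P ?F'" and G': "bilin H A Q ?G'"
    by (rule bc[OF P bilin_smult_right[OF P] F bilin_l], rule bc[OF Q bilin_smult_right[OF Q] G bilin_l])
  note sc = lin_scale[OF bilin_left[OF B]] lin_scale[OF bilin_right[OF B]]
  have iG': "bilin H A Q (conv H A Q (?s Q) ?i ?G')"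
    by (rule bc[OF Q bilin_smult[OF Q] bilin_l_inv G'])
  have cancel: "conv H A Q (?s Q) l (conv H A Q (?s Q) ?i ?G') h a = ?G' h a"
    if ha: "h \<in> carrier H" "a \<in> carrier A" for h a
  proof -
    have "conv H A Q (?s Q) l (conv H A Q (?s Q) ?i ?G') h a
        = conv H A Q (?s Q) (conv H A KM ?m l ?i) ?G' h a"
      using Q ha by (intro assoc[OF _ _ _ bilin_K_mult bilin_smult bilin_smult bilin_smult, symmetric]
          bilin_l bilin_l_inv G') (simp_all add: vs_smult_smult)
    also have "\<dots> = conv H A Q (?s Q) (\<lambda>h a. counit H h \<bullet> counit A a) ?G' h a"
      by (intro conv_cong refl) (simp add: conv_def l_inverse_right)
    also have "\<dots> = ?G' h a"
      unfolding conv_def[of H A Q "?s Q" "\<lambda>h a. counit H h \<bullet> counit A a"]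
      using Q ha by (intro sw_counit_left2 G') simp_all
    finally show ?thesis .
  qed
  have "conv H A R B (conjugate P F) (conjugate Q G) h a
      = conv H A R (?s R) ?i (conv H A R B ?F' (conv H A Q (?s Q) ?i ?G')) h a"
    unfolding conjugate_def using P Q R h a
    by (intro assoc[OF _ _ _ bilin_smult B B bilin_smult] bilin_l_inv F' iG') (simp_all add: sc)
  also have "\<dots> = conv H A R (?s R) ?i (conv H A R B F (conv H A Q (?s Q) l (conv H A Q (?s Q) ?i ?G'))) h a"
    using P Q R
    by (intro conv_cong refl assoc[OF _ _ _ bilin_smult_right B bilin_smult B] F bilin_l iG') (simp_all add: sc)
  also have "\<dots> = conv H A R (?s R) ?i (conv H A R B F ?G') h a"
    by (intro conv_cong refl cancel)
  also have "\<dots> = conv H A R (?s R) ?i (conv H A R (?t R) (conv H A R B F G) l) h a"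
    using P Q R
    by (intro conv_cong refl assoc[OF _ _ _ B bilin_smult_right bilin_smult_right B, symmetric] F G bilin_l) (simp_all add: sc)
  finally show ?thesis
    by (simp add: conjugate_def)
qed

subsection \<open>The two actions\<close>

abbreviation "act_l \<equiv> act_left K A H l"
abbreviation "act_r \<equiv> act_right K A H l"

text \<open>For the two projections of \<open>H \<otimes> A\<close>, the middle legs in the formula for the conjugate meet a
  counit, which leaves the formulas of the actions.\<close>

lemma act_left_conjugate:
  assumes h: "h \<in> carrier H" and a: "a \<in> carrier A"
  shows "act_l h a = conjugate A (\<lambda>h a. counit H h \<odot>\<^bsub>A\<^esub> a) h a"
proof -
  have eq: "sweedler3 A A a (\<lambda>a1 a2 a3. (l (antipode H h1) a1 \<bullet> l h2 a3) \<odot>\<^bsub>A\<^esub> a2)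
      = sw A A a (\<lambda>a1 a'. sw A A a' (\<lambda>a2 a3. (l (antipode H h1) a1 \<bullet> l h2 a3) \<odot>\<^bsub>A\<^esub> a2))"
    if "h1 \<in> carrier H" "h2 \<in> carrier H" for h1 h2
    using a that by (intro sweedler3_sw) simp_all
  have "act_l h a = sweedler2 H A h (\<lambda>h1 h2. sweedler3 A A a (\<lambda>a1 a2 a3.
      (l (antipode H h1) a1 \<bullet> l h2 a3) \<odot>\<^bsub>A\<^esub> a2))"
    by (simp add: act_left_def pairing_inv_def)
  also have "\<dots> = sw H A h (\<lambda>h1 h2. sweedler3 A A a (\<lambda>a1 a2 a3.
      (l (antipode H h1) a1 \<bullet> l h2 a3) \<odot>\<^bsub>A\<^esub> a2))"
  proof (rule sweedler2_sw)
    show "bilin H H A (\<lambda>h1 h2. sweedler3 A A a (\<lambda>a1 a2 a3.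
        (l (antipode H h1) a1 \<bullet> l h2 a3) \<odot>\<^bsub>A\<^esub> a2))"
      using a by (subst bilin_cong[OF eq]) (auto intro!: bilinI)
  qed (use h in simp_all)
  also have "\<dots> = conjugate A (\<lambda>h a. counit H h \<odot>\<^bsub>A\<^esub> a) h a"
    using h a by (simp add: eq conjugate_left)
  finally show ?thesis .
qed

lemma act_right_sw:
  assumes h: "h \<in> carrier H" and a: "a \<in> carrier A"
  shows "act_r h a = sw H H h (\<lambda>h1 h'. sw H H h' (\<lambda>h2 h3. l (antipode H h1 \<otimes>\<^bsub>H\<^esub> h3) a \<odot>\<^bsub>H\<^esub> h2))"
proof -
  have eq: "sweedler2 A H a (\<lambda>a1 a2. (l (antipode H h1) a1 \<bullet> l h3 a2) \<odot>\<^bsub>H\<^esub> h2)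
      = l (antipode H h1 \<otimes>\<^bsub>H\<^esub> h3) a \<odot>\<^bsub>H\<^esub> h2"
    if "h1 \<in> carrier H" "h2 \<in> carrier H" "h3 \<in> carrier H" for h1 h2 h3
    using a that by (subst sweedler2_sw_lin) (simp_all add: l_mult_left sw_smult)
  have "act_r h a = sweedler3 H H h (\<lambda>h1 h2 h3. sweedler2 A H a (\<lambda>a1 a2.
      (l (antipode H h1) a1 \<bullet> l h3 a2) \<odot>\<^bsub>H\<^esub> h2))"
    by (simp add: act_right_def pairing_inv_def)
  also have "\<dots> = sw H H h (\<lambda>h1 h'. sw H H h' (\<lambda>h2 h3. sweedler2 A H a (\<lambda>a1 a2.
      (l (antipode H h1) a1 \<bullet> l h3 a2) \<odot>\<^bsub>H\<^esub> h2)))"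
    using h a by (intro sweedler3_sw; (subst lin_cong[OF eq])?) simp_all
  finally show ?thesis
    by (simp add: eq)
qed

lemma act_right_conjugate:
  assumes h: "h \<in> carrier H" and a: "a \<in> carrier A"
  shows "act_r h a = conjugate H (\<lambda>h a. counit A a \<odot>\<^bsub>H\<^esub> h) h a"
  using assms by (simp add: act_right_sw conjugate_right)

lemma bilin_act_left: "bilin H A A act_l"
  by (subst bilin_cong[OF act_left_conjugate]) (simp_all add: bilin_conjugate bilinI)

lemma bilin_act_right: "bilin H A H act_r"
  by (subst bilin_cong[OF act_right_conjugate]) (simp_all add: bilin_conjugate bilinI)

section \<open>The quantum double\<close>

abbreviation "T \<equiv> A \<boxtimes> H"
abbreviation "D \<equiv> quantum_double K A H l"
abbreviation "dm \<equiv> double_mult K A H l"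
abbreviation "in_A a \<equiv> tens A H a \<one>\<^bsub>H\<^esub>"
abbreviation "in_H h \<equiv> tens A H \<one>\<^bsub>A\<^esub> h"

lemma double_simps [simp]:
  "carrier D = carrier T" "(\<oplus>\<^bsub>D\<^esub>) = (\<oplus>\<^bsub>T\<^esub>)" "(\<odot>\<^bsub>D\<^esub>) = (\<odot>\<^bsub>T\<^esub>)"
  "(\<otimes>\<^bsub>D\<^esub>) = dm" "\<one>\<^bsub>D\<^esub> = tens A H \<one>\<^bsub>A\<^esub> \<one>\<^bsub>H\<^esub>"
  by (simp_all add: quantum_double_def Let_def)

lemma lin_double [simp]: "lin D P f \<longleftrightarrow> lin T P f" "lin Q D g \<longleftrightarrow> lin Q T g"
  by (simp_all add: linear_map_def)

text \<open>The double and its underlying module have the same carrier, addition and scalar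
  multiplication, and the tensor product depends on nothing else.\<close>

lemma tensor_double_rel:
  "tensor_relations K D D = tensor_relations K T T" "tensor_null K D D = tensor_null K T T"
  "tensor_group K D D = tensor_group K T T"
  by (simp_all add: tensor_relations_def tensor_null_def tensor_group_def)

lemma tensor_double [simp]:
  "tensor_module K D D = T \<boxtimes> T" "tens D D = tens T T"
  by (intro module.equality ext; simp add: tensor_module_def tensor_of_def tensor_double_rel)+

subsection \<open>Multiplication\<close>

lemma lin_act_left [simp]:
  "a \<in> carrier A \<Longrightarrow> lin M H g \<Longrightarrow> lin M A (\<lambda>x. act_l (g x) a)"
  "h \<in> carrier H \<Longrightarrow> lin M A g' \<Longrightarrow> lin M A (\<lambda>x. act_l h (g' x))"
  by (rule bilin_comp_left[OF bilin_act_left] bilin_comp_right[OF bilin_act_left]; assumption)+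

lemma lin_act_right [simp]:
  "a \<in> carrier A \<Longrightarrow> lin M H g \<Longrightarrow> lin M H (\<lambda>x. act_r (g x) a)"
  "h \<in> carrier H \<Longrightarrow> lin M A g' \<Longrightarrow> lin M H (\<lambda>x. act_r h (g' x))"
  by (rule bilin_comp_left[OF bilin_act_right] bilin_comp_right[OF bilin_act_right]; assumption)+

lemma act_closed [simp]:
  assumes "h \<in> carrier H" "a \<in> carrier A"
  shows "act_l h a \<in> carrier A" "act_r h a \<in> carrier H"
  using bilin_closed[OF bilin_act_left assms] bilin_closed[OF bilin_act_right assms] .

text \<open>The convolution of the two projections is the identity of \<open>H \<otimes> A\<close>, so that of the two actions
  is its conjugate.\<close>

lemma conv_actions:
  assumes P: "vs P" and B: "bilin A H P B" and h: "h \<in> carrier H" and a: "a \<in> carrier A"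
  shows "conv H A P B act_l act_r h a = conjugate P (\<lambda>h a. B a h) h a"
proof -
  have "conv H A P B act_l act_r h a = conv H A P B (conjugate A (\<lambda>h a. counit H h \<odot>\<^bsub>A\<^esub> a))
      (conjugate H (\<lambda>h a. counit A a \<odot>\<^bsub>H\<^esub> h)) h a"
    by (intro conv_cong act_left_conjugate act_right_conjugate)
  also have "\<dots> = conjugate P (conv H A P B (\<lambda>h a. counit H h \<odot>\<^bsub>A\<^esub> a) (\<lambda>h a. counit A a \<odot>\<^bsub>H\<^esub> h)) h a"
    using P B h a by (intro conv_conjugate) (auto intro!: bilinI)
  also have "\<dots> = conjugate P (\<lambda>h a. B a h) h a"
  proof (rule conjugate_cong)
    fix h a assume ha: "h \<in> carrier H" "a \<in> carrier A"
    note li = bilin_left[OF B] bilin_right[OF B] bilin_closed[OF B]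
      bilin_comp_left[OF B] bilin_comp_right[OF B]
    have "sw A P a (\<lambda>a1 a2. B (counit H h1 \<odot>\<^bsub>A\<^esub> a1) (counit A a2 \<odot>\<^bsub>H\<^esub> h2))
        = counit H h1 \<odot>\<^bsub>P\<^esub> B a h2" if "h1 \<in> carrier H" "h2 \<in> carrier H" for h1 h2
    proof -
      have "sw A P a (\<lambda>a1 a2. B (counit H h1 \<odot>\<^bsub>A\<^esub> a1) (counit A a2 \<odot>\<^bsub>H\<^esub> h2))
          = sw A P a (\<lambda>a1 a2. counit A a2 \<odot>\<^bsub>P\<^esub> (counit H h1 \<odot>\<^bsub>P\<^esub> B a1 h2))"
        using P that
        by (simp add: lin_scale[OF bilin_left[OF B]] lin_scale[OF bilin_right[OF B]] li vs_smult_smult K.m_comm)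
      also have "\<dots> = counit H h1 \<odot>\<^bsub>P\<^esub> B a h2"
        using P that ha by (intro sw_counit_right) (simp_all add: li)
      finally show ?thesis .
    qed
    then show "conv H A P B (\<lambda>h a. counit H h \<odot>\<^bsub>A\<^esub> a) (\<lambda>h a. counit A a \<odot>\<^bsub>H\<^esub> h) h a = B a h"
      unfolding conv_def using P ha by (simp add: sw_counit_left li)
  qed
  finally show ?thesis .
qed

text \<open>The familiar form of the product,
  \<open>(a \<bowtie> h)(c \<bowtie> g) = \<lambda>(S(h\<^sub>1), c\<^sub>1) (a c\<^sub>2 \<bowtie> h\<^sub>2 g) \<lambda>(h\<^sub>3, c\<^sub>3)\<close>.\<close>

definition pure_mult where
  "pure_mult a h c g = conjugate T (\<lambda>h c. tens A H (a \<otimes>\<^bsub>A\<^esub> c) (h \<otimes>\<^bsub>H\<^esub> g)) h c"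

lemma pure_mult_actions:
  assumes "a \<in> carrier A" "h \<in> carrier H" "c \<in> carrier A" "g \<in> carrier H"
  shows "pure_mult a h c g = sw H T h (\<lambda>h1 h2. sw A T c (\<lambda>c1 c2.
    tens A H (a \<otimes>\<^bsub>A\<^esub> act_l h1 c1) (act_r h2 c2 \<otimes>\<^bsub>H\<^esub> g)))"
  using assms conv_actions[of T "\<lambda>x y. tens A H (a \<otimes>\<^bsub>A\<^esub> x) (y \<otimes>\<^bsub>H\<^esub> g)" h c]
  by (simp add: pure_mult_def conv_def bilinI)

lemma bilin_pure_mult_right:
  assumes "a \<in> carrier A" "h \<in> carrier H"
  shows "bilin A H T (\<lambda>c g. pure_mult a h c g)"
  by (subst bilin_cong[OF pure_mult_actions]) (use assms in \<open>auto intro!: bilinI\<close>)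

lemma bilin_pure_mult_left:
  assumes "c \<in> carrier A" "g \<in> carrier H"
  shows "bilin A H T (\<lambda>a h. pure_mult a h c g)"
  by (subst bilin_cong[OF pure_mult_actions]) (use assms in \<open>auto intro!: bilinI\<close>)

lemma double_mult_eq:
  assumes X: "X \<in> carrier T" and Y: "Y \<in> carrier T"
  shows "dm X Y = tsum A H T X (\<lambda>a h. tsum A H T Y (\<lambda>c g. pure_mult a h c g))"
proof -
  have 1: "sweedler2 H T h (\<lambda>h1 h2. sweedler2 A T c (\<lambda>c1 c2.
      tens A H (a \<otimes>\<^bsub>A\<^esub> act_l h1 c1) (act_r h2 c2 \<otimes>\<^bsub>H\<^esub> g))) = pure_mult a h c g"
    if "a \<in> carrier A" "h \<in> carrier H" "c \<in> carrier A" "g \<in> carrier H" for a h c g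
  proof -
    have 2: "sweedler2 A T c (\<lambda>c1 c2. tens A H (a \<otimes>\<^bsub>A\<^esub> act_l h1 c1) (act_r h2 c2 \<otimes>\<^bsub>H\<^esub> g))
        = sw A T c (\<lambda>c1 c2. tens A H (a \<otimes>\<^bsub>A\<^esub> act_l h1 c1) (act_r h2 c2 \<otimes>\<^bsub>H\<^esub> g))"
      if "h1 \<in> carrier H" "h2 \<in> carrier H" for h1 h2
      using \<open>a \<in> carrier A\<close> \<open>c \<in> carrier A\<close> \<open>g \<in> carrier H\<close> that by (intro sweedler2_sw_lin) simp_all
    have "bilin H H T (\<lambda>h1 h2. sweedler2 A T c (\<lambda>c1 c2.
        tens A H (a \<otimes>\<^bsub>A\<^esub> act_l h1 c1) (act_r h2 c2 \<otimes>\<^bsub>H\<^esub> g)))"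
      by (subst bilin_cong[OF 2]) (use that in \<open>auto intro!: bilinI\<close>)
    then show ?thesis
      using that by (simp add: sweedler2_sw 2 pure_mult_actions)
  qed
  let ?f = "\<lambda>a h c g. sweedler2 H T h (\<lambda>h1 h2. sweedler2 A T c (\<lambda>c1 c2.
      tens A H (a \<otimes>\<^bsub>A\<^esub> act_l h1 c1) (act_r h2 c2 \<otimes>\<^bsub>H\<^esub> g)))"
  have 3: "tensor_lift T (\<lambda>c g. ?f a h c g) Y = tsum A H T Y (\<lambda>c g. pure_mult a h c g)"
    if "a \<in> carrier A" "h \<in> carrier H" for a h
  proof -
    have "bilin A H T (\<lambda>c g. ?f a h c g)"
      using that by (subst bilin_cong[OF 1]) (simp_all add: bilin_pure_mult_right)
    then show ?thesis
      using Y that by (simp add: tensor_lift_tsum[of A H] 1)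
  qed
  have "bilin A H T (\<lambda>a h. tsum A H T Y (\<lambda>c g. pure_mult a h c g))"
    by (intro bilinI lin_tsum_body) (simp_all add: bilin_left[OF bilin_pure_mult_left] bilin_right[OF bilin_pure_mult_left])
  then have "bilin A H T (\<lambda>a h. tensor_lift T (\<lambda>c g. ?f a h c g) Y)"
    by (subst bilin_cong[OF 3]) simp_all
  then show ?thesis
    unfolding double_mult_def using X by (simp add: tensor_lift_tsum[of A H T "\<lambda>a h. tensor_lift T (\<lambda>c g. ?f a h c g) Y"] 3)
qed

lemma bilin_double_mult: "bilin T T T dm"
proof -
  have "bilin A H T (\<lambda>a h. tsum A H T Y (\<lambda>c g. pure_mult a h c g))" for Y
    by (intro bilinI lin_tsum_body) (simp_all add: bilin_left[OF bilin_pure_mult_left] bilin_right[OF bilin_pure_mult_left])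
  then have "bilin T T T (\<lambda>X Y. tsum A H T X (\<lambda>a h. tsum A H T Y (\<lambda>c g. pure_mult a h c g)))"
    by (intro bilinI[of T T] lin_tsum_body tsum_lin) (simp_all add: bilin_pure_mult_right)
  then show ?thesis
    by (subst bilin_cong[OF double_mult_eq]) simp_all
qed

lemma double_mult_pure:
  assumes "a \<in> carrier A" "h \<in> carrier H" "c \<in> carrier A" "g \<in> carrier H"
  shows "dm (tens A H a h) (tens A H c g) = pure_mult a h c g"
proof -
  have "bilin A H T (\<lambda>a h. tsum A H T Y (\<lambda>c g. pure_mult a h c g))" for Y
    by (intro bilinI lin_tsum_body) (simp_all add: bilin_left[OF bilin_pure_mult_left] bilin_right[OF bilin_pure_mult_left])
  then show ?thesis
    using assms
    by (simp add: double_mult_eq tsum_pure bilin_pure_mult_right bilin_pure_mult_left)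
qed

lemma double_mult_closed [simp]: "X \<in> carrier T \<Longrightarrow> Y \<in> carrier T \<Longrightarrow> dm X Y \<in> carrier T"
  by (rule bilin_closed[OF bilin_double_mult])

lemma lin_double_mult_left [simp]: "Y \<in> carrier T \<Longrightarrow> lin M T g \<Longrightarrow> lin M T (\<lambda>x. dm (g x) Y)"
  by (rule bilin_comp_left[OF bilin_double_mult])

lemma lin_double_mult_right [simp]: "X \<in> carrier T \<Longrightarrow> lin M T g \<Longrightarrow> lin M T (\<lambda>x. dm X (g x))"
  by (rule bilin_comp_right[OF bilin_double_mult])

lemma double_mult_actions:
  assumes "a \<in> carrier A" "h \<in> carrier H" "c \<in> carrier A" "g \<in> carrier H"
  shows "dm (tens A H a h) (tens A H c g) = sw H T h (\<lambda>h1 h2. sw A T c (\<lambda>c1 c2.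
    tens A H (a \<otimes>\<^bsub>A\<^esub> act_l h1 c1) (act_r h2 c2 \<otimes>\<^bsub>H\<^esub> g)))"
  using assms by (simp add: double_mult_pure pure_mult_actions)

lemma mult_A_left [simp]:
  assumes "a \<in> carrier A" "c \<in> carrier A" "g \<in> carrier H"
  shows "dm (in_A a) (tens A H c g) = tens A H (a \<otimes>\<^bsub>A\<^esub> c) g"
  using assms by (simp add: double_mult_pure pure_mult_def conjugate_one_left bilinI)

lemma mult_H_right [simp]:
  assumes "a \<in> carrier A" "h \<in> carrier H" "g \<in> carrier H"
  shows "dm (tens A H a h) (in_H g) = tens A H a (h \<otimes>\<^bsub>H\<^esub> g)"
  using assms by (simp add: double_mult_pure pure_mult_def conjugate_one_right bilinI)

lemma double_ext:
  assumes "vs P" "lin T P f" "lin T P g"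
    and "\<And>a h. a \<in> carrier A \<Longrightarrow> h \<in> carrier H \<Longrightarrow> f (tens A H a h) = g (tens A H a h)"
    and "X \<in> carrier T"
  shows "f X = g X"
  by (rule tensor_ext[where M = A and N = H and f = f and g = g]) (use assms in simp_all)

lemma mult_A_assoc:
  assumes a: "a \<in> carrier A" and X: "X \<in> carrier T" and Y: "Y \<in> carrier T"
  shows "dm (in_A a) (dm X Y) = dm (dm (in_A a) X) Y"
proof (rule double_ext[where f = "\<lambda>X. dm (in_A a) (dm X Y)" and P = T and
      g = "\<lambda>X. dm (dm (in_A a) X) Y"])
  fix c h assume ch: "c \<in> carrier A" "h \<in> carrier H"
  show "dm (in_A a) (dm (tens A H c h) Y) = dm (dm (in_A a) (tens A H c h)) Y"
  proof (rule double_ext[where f = "\<lambda>Y. dm (in_A a) (dm (tens A H c h) Y)" and P = T and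
      g = "\<lambda>Y. dm (dm (in_A a) (tens A H c h)) Y"])
    fix d g assume dg: "d \<in> carrier A" "g \<in> carrier H"
    have "lin T T (dm (in_A a))"
      using a by (simp add: bilin_right[OF bilin_double_mult])
    then show "dm (in_A a) (dm (tens A H c h) (tens A H d g))
        = dm (dm (in_A a) (tens A H c h)) (tens A H d g)"
      using a ch dg
      by (simp add: double_mult_actions[of c h] double_mult_actions[of "a \<otimes>\<^bsub>A\<^esub> c" h] alg_assoc
          lin_sw[where \<phi> = "dm (in_A a)" and P = T and Q = T])
  qed (use a ch Y in simp_all)
qed (use a X Y in simp_all)

text \<open>On pure tensors, both sides are the conjugate in the variables \<open>h\<close> and \<open>c y\<close>, once directly
  and once as an iterated conjugate.\<close>

lemma mult_middle_A_assoc: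
  assumes X: "X \<in> carrier T" and c: "c \<in> carrier A" and Y: "Y \<in> carrier T"
  shows "dm (dm X (in_A c)) Y = dm X (dm (in_A c) Y)"
proof (rule double_ext[where f = "\<lambda>X. dm (dm X (in_A c)) Y" and P = T and
      g = "\<lambda>X. dm X (dm (in_A c) Y)"])
  fix x h assume xh: "x \<in> carrier A" "h \<in> carrier H"
  show "dm (dm (tens A H x h) (in_A c)) Y = dm (tens A H x h) (dm (in_A c) Y)"
  proof (rule double_ext[where f = "\<lambda>Y. dm (dm (tens A H x h) (in_A c)) Y" and P = T and
      g = "\<lambda>Y. dm (tens A H x h) (dm (in_A c) Y)"])
    fix y g assume yg: "y \<in> carrier A" "g \<in> carrier H"
    let ?F = "\<lambda>h c. tens A H (x \<otimes>\<^bsub>A\<^esub> c) (h \<otimes>\<^bsub>H\<^esub> g)"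
    have "dm (dm (tens A H x h) (in_A c)) (tens A H y g)
        = dm (conjugate T (\<lambda>h c. tens A H (x \<otimes>\<^bsub>A\<^esub> c) (h \<otimes>\<^bsub>H\<^esub> \<one>\<^bsub>H\<^esub>)) h c) (tens A H y g)"
      using xh c by (simp add: double_mult_pure pure_mult_def)
    also have "\<dots> = conjugate T (\<lambda>h c. dm (tens A H (x \<otimes>\<^bsub>A\<^esub> c) (h \<otimes>\<^bsub>H\<^esub> \<one>\<^bsub>H\<^esub>)) (tens A H y g)) h c"
      using xh yg by (intro lin_conjugate[where \<phi> = "\<lambda>Z. dm Z (tens A H y g)"]) simp_all
    also have "\<dots> = conjugate T (\<lambda>h' c'. conjugate T (\<lambda>h'' y'. ?F h'' (c' \<otimes>\<^bsub>A\<^esub> y')) h' y) h c"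
      using xh yg by (intro conjugate_cong)
        (auto simp: double_mult_pure pure_mult_def alg_assoc intro!: conjugate_cong)
    also have "\<dots> = conjugate T ?F h (c \<otimes>\<^bsub>A\<^esub> y)"
      using xh yg c by (intro conjugate_mult_right[symmetric]) (auto intro!: bilinI)
    also have "\<dots> = dm (tens A H x h) (dm (in_A c) (tens A H y g))"
      using xh yg c by (simp add: double_mult_pure[of x h "c \<otimes>\<^bsub>A\<^esub> y"] pure_mult_def)
    finally show "dm (dm (tens A H x h) (in_A c)) (tens A H y g)
        = dm (tens A H x h) (dm (in_A c) (tens A H y g))" .
  qed (use xh c Y in simp_all)
qed (use c X Y in simp_all)

subsection \<open>The two projections\<close>

text \<open>The maps \<open>id \<otimes> \<epsilon>\<close> and \<open>\<epsilon> \<otimes> id\<close>. On products they recover the two actions, and as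
  coalgebra maps they determine an element together with its coproduct.\<close>

definition "proj_A X = tsum A H A X (\<lambda>a h. counit H h \<odot>\<^bsub>A\<^esub> a)"
definition "proj_H X = tsum A H H X (\<lambda>a h. counit A a \<odot>\<^bsub>H\<^esub> h)"

lemma lin_proj: "lin T A proj_A" "lin T H proj_H"
  unfolding proj_A_def[abs_def] proj_H_def[abs_def]
  by (auto intro!: tsum_lin bilinI)

lemma lin_proj_comp [simp]:
  "lin M T g \<Longrightarrow> lin M A (\<lambda>x. proj_A (g x))" "lin M T g \<Longrightarrow> lin M H (\<lambda>x. proj_H (g x))"
  by (rule lin_comp[OF lin_proj(1)] lin_comp[OF lin_proj(2)]; assumption)+

lemma proj_closed [simp]: "X \<in> carrier T \<Longrightarrow> proj_A X \<in> carrier A" "X \<in> carrier T \<Longrightarrow> proj_H X \<in> carrier H"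
  by (simp_all add: lin_closed[OF lin_proj(1)] lin_closed[OF lin_proj(2)])

lemma proj_pure [simp]:
  assumes "a \<in> carrier A" "h \<in> carrier H"
  shows "proj_A (tens A H a h) = counit H h \<odot>\<^bsub>A\<^esub> a" "proj_H (tens A H a h) = counit A a \<odot>\<^bsub>H\<^esub> h"
  using assms by (simp_all add: proj_A_def proj_H_def tsum_pure bilinI)

lemma proj_mult:
  assumes "a \<in> carrier A" "h \<in> carrier H" "c \<in> carrier A" "g \<in> carrier H"
  shows "proj_A (dm (tens A H a h) (tens A H c g)) = counit H g \<odot>\<^bsub>A\<^esub> (a \<otimes>\<^bsub>A\<^esub> act_l h c)"
    and "proj_H (dm (tens A H a h) (tens A H c g)) = counit A a \<odot>\<^bsub>H\<^esub> (act_r h c \<otimes>\<^bsub>H\<^esub> g)"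
proof -
  have "proj_A (dm (tens A H a h) (tens A H c g))
      = conjugate A (\<lambda>h c. proj_A (tens A H (a \<otimes>\<^bsub>A\<^esub> c) (h \<otimes>\<^bsub>H\<^esub> g))) h c"
    using assms by (simp add: double_mult_pure pure_mult_def lin_conjugate[OF _ _ lin_proj(1)])
  also have "\<dots> = conjugate A (\<lambda>h c. counit H g \<odot>\<^bsub>A\<^esub> (a \<otimes>\<^bsub>A\<^esub> (counit H h \<odot>\<^bsub>A\<^esub> c))) h c"
    using assms by (intro conjugate_cong) (simp add: vs_smult_smult K.m_comm)
  also have "\<dots> = counit H g \<odot>\<^bsub>A\<^esub> (a \<otimes>\<^bsub>A\<^esub> act_l h c)"
    using assms by (simp add: act_left_conjugate
        lin_conjugate[where \<phi> = "\<lambda>z. counit H g \<odot>\<^bsub>A\<^esub> (a \<otimes>\<^bsub>A\<^esub> z)" and P = A and Q = A] del: alg_smult_right)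
  finally show "proj_A (dm (tens A H a h) (tens A H c g)) = counit H g \<odot>\<^bsub>A\<^esub> (a \<otimes>\<^bsub>A\<^esub> act_l h c)" .
  have "proj_H (dm (tens A H a h) (tens A H c g))
      = conjugate H (\<lambda>h c. proj_H (tens A H (a \<otimes>\<^bsub>A\<^esub> c) (h \<otimes>\<^bsub>H\<^esub> g))) h c"
    using assms by (simp add: double_mult_pure pure_mult_def lin_conjugate[OF _ _ lin_proj(2)])
  also have "\<dots> = conjugate H (\<lambda>h c. counit A a \<odot>\<^bsub>H\<^esub> ((counit A c \<odot>\<^bsub>H\<^esub> h) \<otimes>\<^bsub>H\<^esub> g)) h c"
    using assms by (intro conjugate_cong) (simp add: vs_smult_smult)
  also have "\<dots> = counit A a \<odot>\<^bsub>H\<^esub> (act_r h c \<otimes>\<^bsub>H\<^esub> g)"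
    using assms by (simp add: act_right_conjugate
        lin_conjugate[where \<phi> = "\<lambda>z. counit A a \<odot>\<^bsub>H\<^esub> (z \<otimes>\<^bsub>H\<^esub> g)" and P = H and Q = H] del: alg_smult_left)
  finally show "proj_H (dm (tens A H a h) (tens A H c g)) = counit A a \<odot>\<^bsub>H\<^esub> (act_r h c \<otimes>\<^bsub>H\<^esub> g)" .
qed

lemma proj_mult_A:
  assumes a: "a \<in> carrier A" and X: "X \<in> carrier T"
  shows "proj_A (dm (in_A a) X) = a \<otimes>\<^bsub>A\<^esub> proj_A X"
    and "proj_H (dm (in_A a) X) = counit A a \<odot>\<^bsub>H\<^esub> proj_H X"
proof -
  show "proj_A (dm (in_A a) X) = a \<otimes>\<^bsub>A\<^esub> proj_A X"
    by (rule double_ext[where f = "\<lambda>X. proj_A (dm (in_A a) X)" and g = "\<lambda>X. a \<otimes>\<^bsub>A\<^esub> proj_A X" and P = A])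
      (use a X in \<open>simp_all add: lin_proj\<close>)
  show "proj_H (dm (in_A a) X) = counit A a \<odot>\<^bsub>H\<^esub> proj_H X"
    by (rule double_ext[where f = "\<lambda>X. proj_H (dm (in_A a) X)" and g = "\<lambda>X. counit A a \<odot>\<^bsub>H\<^esub> proj_H X" and P = H])
      (use a X in \<open>simp_all add: lin_proj vs_smult_smult\<close>)
qed

subsection \<open>Comultiplication\<close>

lemma comult_double_aux:
  assumes "a \<in> carrier A" "h \<in> carrier H"
  shows "sweedler2 A (T \<boxtimes> T) a (\<lambda>a1 a2. sweedler2 H (T \<boxtimes> T) h (\<lambda>h1 h2.
      tens T T (tens A H a1 h1) (tens A H a2 h2)))
    = sw A (T \<boxtimes> T) a (\<lambda>a1 a2. sw H (T \<boxtimes> T) h (\<lambda>h1 h2. tens T T (tens A H a1 h1) (tens A H a2 h2)))"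
proof -
  have 1: "sweedler2 H (T \<boxtimes> T) h (\<lambda>h1 h2. tens T T (tens A H a1 h1) (tens A H a2 h2))
      = sw H (T \<boxtimes> T) h (\<lambda>h1 h2. tens T T (tens A H a1 h1) (tens A H a2 h2))"
    if "a1 \<in> carrier A" "a2 \<in> carrier A" for a1 a2
    using that assms by (intro sweedler2_sw_lin) simp_all
  have "bilin A A (T \<boxtimes> T) (\<lambda>a1 a2. sweedler2 H (T \<boxtimes> T) h (\<lambda>h1 h2. tens T T (tens A H a1 h1) (tens A H a2 h2)))"
    by (subst bilin_cong[OF 1]) (auto intro!: bilinI)
  then show ?thesis
    using assms by (simp add: sweedler2_sw 1)
qed

lemma bilin_comult_double:
  "bilin A H (T \<boxtimes> T) (\<lambda>a h. sweedler2 A (T \<boxtimes> T) a (\<lambda>a1 a2. sweedler2 H (T \<boxtimes> T) h (\<lambda>h1 h2.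
      tens T T (tens A H a1 h1) (tens A H a2 h2))))"
  by (subst bilin_cong[OF comult_double_aux]) (auto intro!: bilinI)

lemma comult_double:
  "comult D = tensor_lift (T \<boxtimes> T) (\<lambda>a h. sweedler2 A (T \<boxtimes> T) a (\<lambda>a1 a2. sweedler2 H (T \<boxtimes> T) h (\<lambda>h1 h2.
      tens T T (tens A H a1 h1) (tens A H a2 h2))))"
  by (simp add: quantum_double_def Let_def)

lemma lin_comult_double: "lin T (T \<boxtimes> T) (comult D)"
  unfolding comult_double by (intro tensor_lift_lin bilin_comult_double) simp_all

lemma comult_double_closed [simp]: "X \<in> carrier T \<Longrightarrow> comult D X \<in> carrier (T \<boxtimes> T)"
  by (rule lin_closed[OF lin_comult_double])

lemma comult_double_pure:
  assumes "a \<in> carrier A" "h \<in> carrier H"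
  shows "comult D (tens A H a h) =
    sw A (T \<boxtimes> T) a (\<lambda>a1 a2. sw H (T \<boxtimes> T) h (\<lambda>h1 h2. tens T T (tens A H a1 h1) (tens A H a2 h2)))"
  unfolding comult_double
  using assms by (subst tensor_lift_tens) (simp_all add: bilin_comult_double comult_double_aux)

lemma lin_counit_double: "lin T KM (counit D)"
  and counit_double_pure: "a \<in> carrier A \<Longrightarrow> h \<in> carrier H \<Longrightarrow>
    counit D (tens A H a h) = counit A a \<bullet> counit H h"
proof -
  have bl: "bilin A H KM (\<lambda>a h. counit A a \<bullet> counit H h)"
    by (intro bilinI) simp_all
  have eq: "counit D X = tsum A H KM X (\<lambda>a h. counit A a \<bullet> counit H h)" if "X \<in> carrier T" for X
    using that bl by (simp add: quantum_double_def Let_def tensor_lift_K)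
  show "lin T KM (counit D)"
    by (subst lin_cong[OF eq]) (simp_all add: tsum_lin bl)
  show "counit D (tens A H a h) = counit A a \<bullet> counit H h"
    if "a \<in> carrier A" "h \<in> carrier H"
    using that by (simp add: eq tsum_pure bl)
qed

lemma tsum_comult_pure:
  assumes P: "vs P" and f: "bilin T T P f" and a: "a \<in> carrier A" and h: "h \<in> carrier H"
  shows "tsum T T P (comult D (tens A H a h)) f
    = sw A P a (\<lambda>a1 a2. sw H P h (\<lambda>h1 h2. f (tens A H a1 h1) (tens A H a2 h2)))"
  using a h f P
  by (simp add: comult_double_pure lin_sw[OF _ P tsum_lin[OF _ _ P f]] tsum_pure)

lemma lin_tsum_comult:
  assumes P: "vs P" and f: "bilin T T P f"
  shows "lin T P (\<lambda>X. tsum T T P (comult D X) f)"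
  using P f by (intro lin_tsum_arg lin_comult_double) simp_all

text \<open>The coproduct of \<open>a \<otimes> h\<close> is \<open>(a\<^sub>1 \<otimes> h\<^sub>1) \<otimes> (a\<^sub>2 \<otimes> h\<^sub>2)\<close>; projecting one leg to \<open>A\<close> and
  the other to \<open>H\<close> leaves a counit on each side, whichever leg goes where.\<close>

lemma comult_proj_split:
  assumes X: "X \<in> carrier T"
  shows "tsum T T T (comult D X) (\<lambda>Y Z. tens A H (proj_A Y) (proj_H Z)) = X"
    and "tsum T T T (comult D X) (\<lambda>Y Z. tens A H (proj_A Z) (proj_H Y)) = X"
proof -
  have b: "bilin T T T (\<lambda>Y Z. tens A H (proj_A Y) (proj_H Z))"
    "bilin T T T (\<lambda>Y Z. tens A H (proj_A Z) (proj_H Y))"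
    by (auto intro!: bilinI simp: lin_proj)
  show "tsum T T T (comult D X) (\<lambda>Y Z. tens A H (proj_A Y) (proj_H Z)) = X"
    by (rule double_ext[where P = T and f = "\<lambda>X. tsum T T T (comult D X) (\<lambda>Y Z. tens A H (proj_A Y) (proj_H Z))"
          and g = "\<lambda>X. X"])
      (use X in \<open>simp_all add: lin_tsum_comult b tsum_comult_pure smult_tens_left smult_tens_right
          smult_sw[symmetric] sw_counit_left sw_counit_right\<close>)
  show "tsum T T T (comult D X) (\<lambda>Y Z. tens A H (proj_A Z) (proj_H Y)) = X"
    by (rule double_ext[where P = T and f = "\<lambda>X. tsum T T T (comult D X) (\<lambda>Y Z. tens A H (proj_A Z) (proj_H Y))"
          and g = "\<lambda>X. X"])
      (use X in \<open>simp_all add: lin_tsum_comult b tsum_comult_pure smult_tens_left smult_tens_right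
          smult_sw[symmetric] sw_counit_left sw_counit_right\<close>)
qed

lemma comult_proj_A:
  assumes X: "X \<in> carrier T"
  shows "comult A (proj_A X) = tsum T T (A \<boxtimes> A) (comult D X) (\<lambda>Y Z. tens A A (proj_A Y) (proj_A Z))"
proof -
  have b: "bilin T T (A \<boxtimes> A) (\<lambda>Y Z. tens A A (proj_A Y) (proj_A Z))"
    by (auto intro!: bilinI simp: lin_proj)
  show ?thesis
  proof (rule double_ext[where P = "A \<boxtimes> A" and f = "\<lambda>X. comult A (proj_A X)" and
        g = "\<lambda>X. tsum T T (A \<boxtimes> A) (comult D X) (\<lambda>Y Z. tens A A (proj_A Y) (proj_A Z))"])
    fix a h assume ah: "a \<in> carrier A" "h \<in> carrier H"
    have "sw H (A \<boxtimes> A) h (\<lambda>h1 h2. counit H h2 \<odot>\<^bsub>A \<boxtimes> A\<^esub> (counit H h1 \<odot>\<^bsub>A \<boxtimes> A\<^esub> tens A A a1 a2))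
       = counit H h \<odot>\<^bsub>A \<boxtimes> A\<^esub> tens A A a1 a2" if "a1 \<in> carrier A" "a2 \<in> carrier A" for a1 a2
      using ah that by (intro sw_counit_right) simp_all
    then show "comult A (proj_A (tens A H a h))
        = tsum T T (A \<boxtimes> A) (comult D (tens A H a h)) (\<lambda>Y Z. tens A A (proj_A Y) (proj_A Z))"
      using ah
      by (simp add: tsum_comult_pure b smult_tens_left smult_tens_right
          lin_scale[OF comult_lin] smult_sw[symmetric] sw_tens)
  qed (use X in \<open>simp_all add: lin_tsum_comult b lin_proj\<close>)
qed

lemma comult_proj_H:
  assumes X: "X \<in> carrier T"
  shows "comult H (proj_H X) = tsum T T (H \<boxtimes> H) (comult D X) (\<lambda>Y Z. tens H H (proj_H Y) (proj_H Z))"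
proof -
  have b: "bilin T T (H \<boxtimes> H) (\<lambda>Y Z. tens H H (proj_H Y) (proj_H Z))"
    by (auto intro!: bilinI simp: lin_proj)
  show ?thesis
  proof (rule double_ext[where P = "H \<boxtimes> H" and f = "\<lambda>X. comult H (proj_H X)" and
        g = "\<lambda>X. tsum T T (H \<boxtimes> H) (comult D X) (\<lambda>Y Z. tens H H (proj_H Y) (proj_H Z))"])
    fix a h assume ah: "a \<in> carrier A" "h \<in> carrier H"
    have "sw A (H \<boxtimes> H) a (\<lambda>a1 a2. counit A a2 \<odot>\<^bsub>H \<boxtimes> H\<^esub> (counit A a1 \<odot>\<^bsub>H \<boxtimes> H\<^esub> comult H h))
       = counit A a \<odot>\<^bsub>H \<boxtimes> H\<^esub> comult H h"
      using ah by (intro sw_counit_right) simp_all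
    then show "comult H (proj_H (tens A H a h))
        = tsum T T (H \<boxtimes> H) (comult D (tens A H a h)) (\<lambda>Y Z. tens H H (proj_H Y) (proj_H Z))"
      using ah
      by (simp add: tsum_comult_pure b smult_tens_left smult_tens_right
          lin_scale[OF comult_lin] smult_sw[symmetric] sw_tens)
  qed (use X in \<open>simp_all add: lin_tsum_comult b lin_proj\<close>)
qed

lemma counit_proj:
  assumes X: "X \<in> carrier T"
  shows "counit A (proj_A X) = counit D X" "counit H (proj_H X) = counit D X"
proof -
  show "counit A (proj_A X) = counit D X"
    by (rule double_ext[where P = KM and f = "\<lambda>X. counit A (proj_A X)" and g = "counit D"])
      (use X in \<open>simp_all add: lin_counit_double lin_proj counit_double_pure K.m_comm\<close>)
  show "counit H (proj_H X) = counit D X"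
    by (rule double_ext[where P = KM and f = "\<lambda>X. counit H (proj_H X)" and g = "counit D"])
      (use X in \<open>simp_all add: lin_counit_double lin_proj counit_double_pure\<close>)
qed

lemma sweedler2_double:
  assumes "vs P" "bilin T T P f" "X \<in> carrier T"
  shows "sweedler2 D P X f = tsum T T P (comult D X) f"
  unfolding sweedler2_def using assms by (intro tensor_lift_tsum) simp_all

end

section \<open>Left linear isomorphisms of quantum doubles\<close>

locale two_pairings = scalars K + P: pairing K A H l + P': pairing K A H' l'
  for K :: "('k, 'r) ring_scheme" and A :: "('k, 'a, 'm) hopf_scheme"
    and H :: "('k, 'h, 'n) hopf_scheme" and l :: "'h \<Rightarrow> 'a \<Rightarrow> 'k"
    and H' :: "('k, 'g, 'q) hopf_scheme" and l' :: "'g \<Rightarrow> 'a \<Rightarrow> 'k"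

text \<open>The data of the second statement, without the four conditions.\<close>

locale double_data = two_pairings K A H l H' l'
  for K :: "('k, 'r) ring_scheme" and A :: "('k, 'a, 'm) hopf_scheme"
    and H :: "('k, 'h, 'n) hopf_scheme" and l :: "'h \<Rightarrow> 'a \<Rightarrow> 'k"
    and H' :: "('k, 'g, 'q) hopf_scheme" and l' :: "'g \<Rightarrow> 'a \<Rightarrow> 'k" +
  fixes r :: "'h \<Rightarrow> 'a" and v :: "'h \<Rightarrow> 'g"
  assumes cocentral: "cocentral_map K H A r" and r_unit [simp]: "r \<one>\<^bsub>H\<^esub> = \<one>\<^bsub>A\<^esub>"
    and v_iso: "coalgebra_iso K H H' v" and v_unit [simp]: "v \<one>\<^bsub>H\<^esub> = \<one>\<^bsub>H'\<^esub>"
begin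

lemma r_coalg: "coalgebra_map K H A r"
  by (rule cocentral_coalgebra_map[OF cocentral])

lemma v_coalg: "coalgebra_map K H H' v"
  using v_iso by (simp add: coalgebra_iso_def)

lemma r_closed [simp]: "h \<in> carrier H \<Longrightarrow> r h \<in> carrier A"
  by (rule lin_closed[OF coalgebra_map_lin[OF r_coalg]])

lemma v_closed [simp]: "h \<in> carrier H \<Longrightarrow> v h \<in> carrier H'"
  by (rule lin_closed[OF coalgebra_map_lin[OF v_coalg]])

lemma lin_r [simp]: "lin M H g \<Longrightarrow> lin M A (\<lambda>x. r (g x))"
  by (rule lin_comp[OF coalgebra_map_lin[OF r_coalg]])

lemma lin_v [simp]: "lin M H g \<Longrightarrow> lin M H' (\<lambda>x. v (g x))"
  by (rule lin_comp[OF coalgebra_map_lin[OF v_coalg]])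

lemma counit_r [simp]: "h \<in> carrier H \<Longrightarrow> counit A (r h) = counit H h"
  by (rule coalgebra_map_counit[OF r_coalg])

lemma counit_v [simp]: "h \<in> carrier H \<Longrightarrow> counit H' (v h) = counit H h"
  by (rule coalgebra_map_counit[OF v_coalg])

lemma sw_r: "h \<in> carrier H \<Longrightarrow> vs P \<Longrightarrow> bilin A A P f \<Longrightarrow> sw A P (r h) f = sw H P h (\<lambda>a b. f (r a) (r b))"
  by (rule sw_coalgebra_map[OF _ _ r_coalg]) simp_all

lemma sw_v: "h \<in> carrier H \<Longrightarrow> vs P \<Longrightarrow> bilin H' H' P f \<Longrightarrow> sw H' P (v h) f = sw H P h (\<lambda>a b. f (v a) (v b))"
  by (rule sw_coalgebra_map[OF _ _ v_coalg]) simp_all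

subsection \<open>The four conditions in terms of the actions\<close>

text \<open>For \<open>x\<close> in \<open>H'\<close> the factor \<open>\<lambda>'(S(x\<^sub>1), r(g\<^sub>1)) \<lambda>'(x\<^sub>2, r(g\<^sub>3))\<close> of the action equals
  \<open>\<lambda>'(x, r(g\<^sub>3) S(r(g\<^sub>1)))\<close>, because \<open>\<lambda>'(S(x), r(g)) = \<lambda>'(x, S(r(g)))\<close>; the latter holds as
  \<open>S(S(r(g))) = r(g)\<close>.\<close>

lemma r_condition_actions:
  assumes h: "h \<in> carrier H" and g: "g \<in> carrier H"
  shows "sweedler2 H A h (\<lambda>h1 h2. sweedler3 H A g (\<lambda>g1 g2 g3.
      l' (v h2) (r g3 \<otimes>\<^bsub>A\<^esub> antipode A (r g1)) \<odot>\<^bsub>A\<^esub> (r h1 \<otimes>\<^bsub>A\<^esub> r g2)))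
    = sw H A h (\<lambda>h1 h2. r h1 \<otimes>\<^bsub>A\<^esub> P'.act_l (v h2) (r g))"
proof -
  have pair: "l' x (r g3 \<otimes>\<^bsub>A\<^esub> antipode A (r g1))
      = sw H' KM x (\<lambda>x1 x2. l' (antipode H' x1) (r g1) \<bullet> l' x2 (r g3))"
    if "x \<in> carrier H'" "g1 \<in> carrier H" "g3 \<in> carrier H" for x g1 g3
  proof -
    have "l' y (antipode A (r g1)) = l' (antipode H' y) (r g1)" if "y \<in> carrier H'" for y
      using P'.l_antipode_antipode[of y "antipode A (r g1)"] that \<open>g1 \<in> carrier H\<close>
        cocentral_antipode_twice[OF _ _ cocentral, of g1] by simp
    then show ?thesis
      using that by (simp add: P'.l_mult_right)
  qed
  have act: "P'.act_l x (r g) = sw H A g (\<lambda>g1 g'. sw H A g' (\<lambda>g2 g3.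
      l' x (r g3 \<otimes>\<^bsub>A\<^esub> antipode A (r g1)) \<odot>\<^bsub>A\<^esub> r g2))" if x: "x \<in> carrier H'" for x
  proof -
    have "P'.act_l x (r g) = sw H' A x (\<lambda>x1 x2. sw A A (r g) (\<lambda>a1 a'. sw A A a' (\<lambda>a2 a3.
        (l' (antipode H' x1) a1 \<bullet> l' x2 a3) \<odot>\<^bsub>A\<^esub> a2)))"
      using x g by (simp add: P'.act_left_conjugate P'.conjugate_left)
    also have "\<dots> = sw H' A x (\<lambda>x1 x2. sw H A g (\<lambda>g1 g'. sw H A g' (\<lambda>g2 g3.
        (l' (antipode H' x1) (r g1) \<bullet> l' x2 (r g3)) \<odot>\<^bsub>A\<^esub> r g2)))"
      using g by (simp add: sw_r bilinI)
    also have "\<dots> = sw H A g (\<lambda>g1 g'. sw H A g' (\<lambda>g2 g3. sw H' A x (\<lambda>x1 x2.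
        (l' (antipode H' x1) (r g1) \<bullet> l' x2 (r g3)) \<odot>\<^bsub>A\<^esub> r g2)))"
      by (subst sw_swap, simp, simp, intro sw_cong refl sw_swap) simp_all
    also have "\<dots> = sw H A g (\<lambda>g1 g'. sw H A g' (\<lambda>g2 g3.
      l' x (r g3 \<otimes>\<^bsub>A\<^esub> antipode A (r g1)) \<odot>\<^bsub>A\<^esub> r g2))"
      using x by (simp add: pair sw_smult)
    finally show ?thesis .
  qed
  have eq: "sweedler3 H A g (\<lambda>g1 g2 g3. l' (v h2) (r g3 \<otimes>\<^bsub>A\<^esub> antipode A (r g1)) \<odot>\<^bsub>A\<^esub> (r h1 \<otimes>\<^bsub>A\<^esub> r g2))
      = r h1 \<otimes>\<^bsub>A\<^esub> P'.act_l (v h2) (r g)" if "h1 \<in> carrier H" "h2 \<in> carrier H" for h1 h2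
  proof -
    have "sweedler3 H A g (\<lambda>g1 g2 g3. l' (v h2) (r g3 \<otimes>\<^bsub>A\<^esub> antipode A (r g1)) \<odot>\<^bsub>A\<^esub> (r h1 \<otimes>\<^bsub>A\<^esub> r g2))
      = sw H A g (\<lambda>g1 g'. sw H A g' (\<lambda>g2 g3. l' (v h2) (r g3 \<otimes>\<^bsub>A\<^esub> antipode A (r g1)) \<odot>\<^bsub>A\<^esub> (r h1 \<otimes>\<^bsub>A\<^esub> r g2)))"
      using g that by (intro sweedler3_sw) simp_all
    then show ?thesis
      using that by (simp add: act lin_sw[where \<phi> = "\<lambda>z. r h1 \<otimes>\<^bsub>A\<^esub> z" and P = A and Q = A])
  qed
  have "bilin H H A (\<lambda>h1 h2. sweedler3 H A g (\<lambda>g1 g2 g3.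
      l' (v h2) (r g3 \<otimes>\<^bsub>A\<^esub> antipode A (r g1)) \<odot>\<^bsub>A\<^esub> (r h1 \<otimes>\<^bsub>A\<^esub> r g2)))"
    using g by (subst bilin_cong[OF eq]) (auto intro!: bilinI)
  then show ?thesis
    using h by (simp add: sweedler2_sw eq)
qed

lemma act_right_v:
  assumes h: "h \<in> carrier H" and a: "a \<in> carrier A"
  shows "P'.act_r (v h) a = sw H H' h (\<lambda>h1 h'. sw H H' h' (\<lambda>h2 h3.
    l' (antipode H' (v h1) \<otimes>\<^bsub>H'\<^esub> v h3) a \<odot>\<^bsub>H'\<^esub> v h2))"
  using assms by (simp add: P'.act_right_sw sw_v bilinI)

lemma v_condition_actions:
  assumes h: "h \<in> carrier H" and g: "g \<in> carrier H"
  shows "sweedler3 H H' h (\<lambda>h1 h2 h3. sweedler2 H H' g (\<lambda>g1 g2.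
      l' (antipode H' (v h1) \<otimes>\<^bsub>H'\<^esub> v h3) (r g1) \<odot>\<^bsub>H'\<^esub> (v h2 \<otimes>\<^bsub>H'\<^esub> v g2)))
    = sw H H' g (\<lambda>g1 g2. P'.act_r (v h) (r g1) \<otimes>\<^bsub>H'\<^esub> v g2)"
proof -
  let ?f = "\<lambda>h1 h2 h3 g1 g2. l' (antipode H' (v h1) \<otimes>\<^bsub>H'\<^esub> v h3) (r g1) \<odot>\<^bsub>H'\<^esub> (v h2 \<otimes>\<^bsub>H'\<^esub> v g2)"
  have eq: "sweedler2 H H' g (\<lambda>g1 g2. ?f h1 h2 h3 g1 g2) = sw H H' g (\<lambda>g1 g2. ?f h1 h2 h3 g1 g2)"
    if "h1 \<in> carrier H" "h2 \<in> carrier H" "h3 \<in> carrier H" for h1 h2 h3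
    using that g by (intro sweedler2_sw_lin) simp_all
  have "sweedler3 H H' h (\<lambda>h1 h2 h3. sweedler2 H H' g (\<lambda>g1 g2. ?f h1 h2 h3 g1 g2))
      = sw H H' h (\<lambda>h1 h'. sw H H' h' (\<lambda>h2 h3. sweedler2 H H' g (\<lambda>g1 g2. ?f h1 h2 h3 g1 g2)))"
    using h by (intro sweedler3_sw; (subst lin_cong[OF eq])?) simp_all
  also have "\<dots> = sw H H' h (\<lambda>h1 h'. sw H H' g (\<lambda>g1 g2. sw H H' h' (\<lambda>h2 h3. ?f h1 h2 h3 g1 g2)))"
    by (simp add: eq) (intro sw_cong refl sw_swap; simp)
  also have "\<dots> = sw H H' g (\<lambda>g1 g2. sw H H' h (\<lambda>h1 h'. sw H H' h' (\<lambda>h2 h3. ?f h1 h2 h3 g1 g2)))"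
    by (intro sw_swap) simp_all
  also have "\<dots> = sw H H' g (\<lambda>g1 g2. P'.act_r (v h) (r g1) \<otimes>\<^bsub>H'\<^esub> v g2)"
    using h by (simp add: act_right_v lin_sw[where \<phi> = "\<lambda>z. z \<otimes>\<^bsub>H'\<^esub> v _" and P = H' and Q = H'])
  finally show ?thesis .
qed

text \<open>In the remaining two conditions, each side is recognised as a conjugate or as an action.\<close>

lemma act_right_condition_left:
  assumes h: "h \<in> carrier H" and a: "a \<in> carrier A"
  shows "sweedler3 H H' h (\<lambda>h1 h2 h3. l (antipode H h1 \<otimes>\<^bsub>H\<^esub> h3) a \<odot>\<^bsub>H'\<^esub> v h2) = v (P.act_r h a)"
proof -
  note vl = coalgebra_map_lin[OF v_coalg]
  have "sweedler3 H H' h (\<lambda>h1 h2 h3. l (antipode H h1 \<otimes>\<^bsub>H\<^esub> h3) a \<odot>\<^bsub>H'\<^esub> v h2)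
      = sw H H' h (\<lambda>h1 h'. sw H H' h' (\<lambda>h2 h3. l (antipode H h1 \<otimes>\<^bsub>H\<^esub> h3) a \<odot>\<^bsub>H'\<^esub> v h2))"
    using assms by (intro sweedler3_sw) simp_all
  then show ?thesis
    using assms by (simp add: P.act_right_sw lin_sw[OF _ _ vl] lin_scale[OF vl])
qed

lemma act_right_condition_right:
  assumes h: "h \<in> carrier H" and a: "a \<in> carrier A"
  shows "sweedler3 H H' h (\<lambda>h1 h2 h3. l' (antipode H' (v h1) \<otimes>\<^bsub>H'\<^esub> v h3) a \<odot>\<^bsub>H'\<^esub> v h2)
    = P'.act_r (v h) a"
proof -
  have "sweedler3 H H' h (\<lambda>h1 h2 h3. l' (antipode H' (v h1) \<otimes>\<^bsub>H'\<^esub> v h3) a \<odot>\<^bsub>H'\<^esub> v h2)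
      = sw H H' h (\<lambda>h1 h'. sw H H' h' (\<lambda>h2 h3. l' (antipode H' (v h1) \<otimes>\<^bsub>H'\<^esub> v h3) a \<odot>\<^bsub>H'\<^esub> v h2))"
    using assms by (intro sweedler3_sw) simp_all
  then show ?thesis
    using assms by (simp add: act_right_v)
qed

lemma act_left_condition_left:
  assumes h: "h \<in> carrier H" and a: "a \<in> carrier A"
  shows "sweedler3 H A h (\<lambda>h1 h2 h3. sweedler3 A A a (\<lambda>a1 a2 a3.
      (l (antipode H h1) a1 \<bullet> l h3 a3) \<odot>\<^bsub>A\<^esub> (a2 \<otimes>\<^bsub>A\<^esub> r h2)))
    = P.conjugate A (\<lambda>h a. a \<otimes>\<^bsub>A\<^esub> r h) h a"
proof -
  let ?f = "\<lambda>h1 h2 h3 a1 a2 a3. (l (antipode H h1) a1 \<bullet> l h3 a3) \<odot>\<^bsub>A\<^esub> (a2 \<otimes>\<^bsub>A\<^esub> r h2)"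
  have eq: "sweedler3 A A a (\<lambda>a1 a2 a3. ?f h1 h2 h3 a1 a2 a3)
      = sw A A a (\<lambda>a1 a'. sw A A a' (\<lambda>a2 a3. ?f h1 h2 h3 a1 a2 a3))"
    if "h1 \<in> carrier H" "h2 \<in> carrier H" "h3 \<in> carrier H" for h1 h2 h3
    using a that by (intro sweedler3_sw) simp_all
  have "sweedler3 H A h (\<lambda>h1 h2 h3. sweedler3 A A a (\<lambda>a1 a2 a3. ?f h1 h2 h3 a1 a2 a3))
      = sw H A h (\<lambda>h1 h'. sw H A h' (\<lambda>h2 h3. sweedler3 A A a (\<lambda>a1 a2 a3. ?f h1 h2 h3 a1 a2 a3)))"
    using h a by (intro sweedler3_sw; (subst lin_cong[OF eq])?) simp_all
  then show ?thesis
    by (simp add: eq P.conjugate_sw)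
qed

lemma act_left_condition_right:
  assumes h: "h \<in> carrier H" and a: "a \<in> carrier A"
  shows "sweedler3 H A h (\<lambda>h1 h2 h3. sweedler3 A A a (\<lambda>a1 a2 a3.
      (l' (v h3) a3 \<bullet> l' (antipode H' (v h2)) a1) \<odot>\<^bsub>A\<^esub> (r h1 \<otimes>\<^bsub>A\<^esub> a2)))
    = sw H A h (\<lambda>h1 h2. r h1 \<otimes>\<^bsub>A\<^esub> P'.act_l (v h2) a)"
proof -
  let ?f = "\<lambda>h1 h2 h3 a1 a2 a3.
      (l' (v h3) a3 \<bullet> l' (antipode H' (v h2)) a1) \<odot>\<^bsub>A\<^esub> (r h1 \<otimes>\<^bsub>A\<^esub> a2)"
  have eq: "sweedler3 A A a (\<lambda>a1 a2 a3. ?f h1 h2 h3 a1 a2 a3)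
      = sw A A a (\<lambda>a1 a'. sw A A a' (\<lambda>a2 a3. ?f h1 h2 h3 a1 a2 a3))"
    if "h1 \<in> carrier H" "h2 \<in> carrier H" "h3 \<in> carrier H" for h1 h2 h3
    using a that by (intro sweedler3_sw) simp_all
  have act: "P'.act_l (v h') a = sw H A h' (\<lambda>h2 h3. sw A A a (\<lambda>a1 a'. sw A A a' (\<lambda>a2 a3.
      (l' (v h3) a3 \<bullet> l' (antipode H' (v h2)) a1) \<odot>\<^bsub>A\<^esub> a2)))" if "h' \<in> carrier H" for h'
    using that a
    by (simp add: P'.act_left_conjugate P'.conjugate_left sw_v bilinI K.m_comm[of "l' (antipode H' _) _"])
  have "sweedler3 H A h (\<lambda>h1 h2 h3. sweedler3 A A a (\<lambda>a1 a2 a3. ?f h1 h2 h3 a1 a2 a3))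
      = sw H A h (\<lambda>h1 h'. sw H A h' (\<lambda>h2 h3. sweedler3 A A a (\<lambda>a1 a2 a3. ?f h1 h2 h3 a1 a2 a3)))"
    using h a by (intro sweedler3_sw; (subst lin_cong[OF eq])?) simp_all
  then show ?thesis
    by (simp add: eq act lin_sw[where \<phi> = "\<lambda>z. r _ \<otimes>\<^bsub>A\<^esub> z" and P = A and Q = A])
qed

subsection \<open>From maps to an isomorphism\<close>

text \<open>The restriction to \<open>H\<close> of the isomorphism that belongs to \<open>r\<close> and \<open>v\<close>.\<close>

definition "on_H h = sw H P'.T h (\<lambda>h1 h2. tens A H' (r h1) (v h2))"

lemma lin_on_H [simp]: "lin M H g \<Longrightarrow> lin M P'.T (\<lambda>x. on_H (g x))"
  unfolding on_H_def[abs_def] by simp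

lemma on_H_closed [simp]: "h \<in> carrier H \<Longrightarrow> on_H h \<in> carrier P'.T"
  unfolding on_H_def by simp

lemma on_H_one: "on_H \<one>\<^bsub>H\<^esub> = tens A H' \<one>\<^bsub>A\<^esub> \<one>\<^bsub>H'\<^esub>"
  unfolding on_H_def by (simp add: sw_one bilinI)

lemma mult_A_on_H:
  assumes "a \<in> carrier A" "h \<in> carrier H"
  shows "P'.dm (P'.in_A a) (on_H h) = sw H P'.T h (\<lambda>h1 h2. tens A H' (a \<otimes>\<^bsub>A\<^esub> r h1) (v h2))"
  unfolding on_H_def
  using assms
  by (simp add: lin_sw[where \<phi> = "P'.dm (P'.in_A a)" and P = P'.T and Q = P'.T]
      bilin_right[OF P'.bilin_double_mult])

definition "double_map X = tsum A H P'.T X (\<lambda>a h. P'.dm (P'.in_A a) (on_H h))"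

lemma lin_double_map: "lin P.T P'.T double_map"
  unfolding double_map_def[abs_def] by (auto intro!: tsum_lin bilinI)

lemma lin_double_map_comp [simp]: "lin M P.T g \<Longrightarrow> lin M P'.T (\<lambda>x. double_map (g x))"
  by (rule lin_comp[OF lin_double_map])

lemma double_map_closed [simp]: "X \<in> carrier P.T \<Longrightarrow> double_map X \<in> carrier P'.T"
  by (rule lin_closed[OF lin_double_map])

lemma double_map_pure:
  assumes "a \<in> carrier A" "h \<in> carrier H"
  shows "double_map (tens A H a h) = P'.dm (P'.in_A a) (on_H h)"
  using assms by (simp add: double_map_def tsum_pure bilinI)

lemma double_map_left_linear:
  assumes a: "a \<in> carrier A" and X: "X \<in> carrier P.T"
  shows "double_map (P.dm (P.in_A a) X) = P'.dm (P'.in_A a) (double_map X)"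
  by (rule P.double_ext[where P = P'.T and f = "\<lambda>X. double_map (P.dm (P.in_A a) X)" and
        g = "\<lambda>X. P'.dm (P'.in_A a) (double_map X)"])
    (use a X in \<open>simp_all add: double_map_pure P'.mult_A_assoc lin_double_map\<close>)

text \<open>With the summand \<open>(a\<^sub>1 r(h\<^sub>1) \<otimes> v(h\<^sub>2)) \<otimes> (a\<^sub>2 r(h\<^sub>3) \<otimes> v(h\<^sub>4))\<close> on one side, the other side has the
  roles of \<open>h\<^sub>2\<close> and \<open>h\<^sub>3\<close> exchanged.\<close>

lemma double_map_coalgebra:
  assumes X: "X \<in> carrier P.T"
  shows "comult P'.D (double_map X)
    = tsum P.T P.T (P'.T \<boxtimes> P'.T) (comult P.D X) (\<lambda>Y Z. tens P'.T P'.T (double_map Y) (double_map Z))"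
proof -
  let ?TT = "P'.T \<boxtimes> P'.T"
  have b: "bilin P.T P.T ?TT (\<lambda>Y Z. tens P'.T P'.T (double_map Y) (double_map Z))"
    by (auto intro!: bilinI simp: lin_double_map)
  have c: "lin M ?TT (\<lambda>x. comult P'.D (g x))" if "lin M P'.T g" for M :: "('k, ('a, 'h) tensor) module" and g
    by (rule lin_comp[OF P'.lin_comult_double that])
  show ?thesis
  proof (rule P.double_ext[where P = ?TT and f = "\<lambda>X. comult P'.D (double_map X)" and
      g = "\<lambda>X. tsum P.T P.T ?TT (comult P.D X) (\<lambda>Y Z. tens P'.T P'.T (double_map Y) (double_map Z))"])
    fix a h assume ah: "a \<in> carrier A" "h \<in> carrier H"
    let ?t = "\<lambda>a1 a2 p x y q. tens P'.T P'.T (tens A H' (a1 \<otimes>\<^bsub>A\<^esub> r p) (v x)) (tens A H' (a2 \<otimes>\<^bsub>A\<^esub> r y) (v q))"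
    \<comment> \<open>cocentrality, with the outer legs \<open>p\<close> and \<open>q\<close> as parameters\<close>
    have mid: "sw H ?TT z (\<lambda>x y. ?t a1 a2 p y x q) = sw H ?TT z (\<lambda>x y. ?t a1 a2 p x y q)"
      if "a1 \<in> carrier A" "a2 \<in> carrier A" "p \<in> carrier H" "q \<in> carrier H" "z \<in> carrier H" for a1 a2 p q z
    proof -
      have "bilin A H ?TT (\<lambda>s y. tens P'.T P'.T (tens A H' (a1 \<otimes>\<^bsub>A\<^esub> r p) (v y)) (tens A H' (a2 \<otimes>\<^bsub>A\<^esub> s) (v q)))"
        using that by (intro bilinI) simp_all
      from cocentral_sw[OF _ _ cocentral _ _ this] that show ?thesis by simp
    qed
    have "comult P'.D (double_map (tens A H a h))
        = sw H ?TT h (\<lambda>h1 h2. sw A ?TT a (\<lambda>a1 a2. sw H ?TT h1 (\<lambda>p x. sw H ?TT h2 (\<lambda>y q. ?t a1 a2 p y x q))))"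
      using ah
      by (simp add: double_map_pure mult_A_on_H lin_sw[OF _ _ P'.lin_comult_double] P'.comult_double_pure
          sw_mult bilinI sw_r sw_v)
    also have "\<dots> = sw A ?TT a (\<lambda>a1 a2. sw H ?TT h (\<lambda>h1 h2. sw H ?TT h1 (\<lambda>p x. sw H ?TT h2 (\<lambda>y q. ?t a1 a2 p y x q))))"
      by (intro sw_swap) simp_all
    also have "\<dots> = sw A ?TT a (\<lambda>a1 a2. sw H ?TT h (\<lambda>p w. sw H ?TT w (\<lambda>x h2. sw H ?TT h2 (\<lambda>y q. ?t a1 a2 p y x q))))"
      using ah by (intro sw_cong refl sw_coassoc) simp_all
    also have "\<dots> = sw A ?TT a (\<lambda>a1 a2. sw H ?TT h (\<lambda>p w. sw H ?TT w (\<lambda>z q. sw H ?TT z (\<lambda>x y. ?t a1 a2 p y x q))))"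
      using ah by (intro sw_cong refl sw_coassoc[symmetric]) simp_all
    also have "\<dots> = sw A ?TT a (\<lambda>a1 a2. sw H ?TT h (\<lambda>p w. sw H ?TT w (\<lambda>z q. sw H ?TT z (\<lambda>x y. ?t a1 a2 p x y q))))"
      by (intro sw_cong refl mid)
    also have "\<dots> = sw A ?TT a (\<lambda>a1 a2. sw H ?TT h (\<lambda>p w. sw H ?TT w (\<lambda>x h2. sw H ?TT h2 (\<lambda>y q. ?t a1 a2 p x y q))))"
      using ah by (intro sw_cong refl sw_coassoc) simp_all
    also have "\<dots> = sw A ?TT a (\<lambda>a1 a2. sw H ?TT h (\<lambda>h1 h2. sw H ?TT h1 (\<lambda>p x. sw H ?TT h2 (\<lambda>y q. ?t a1 a2 p x y q))))"
      using ah by (intro sw_cong refl sw_coassoc[symmetric]) simp_all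
    also have "\<dots> = tsum P.T P.T ?TT (comult P.D (tens A H a h)) (\<lambda>Y Z. tens P'.T P'.T (double_map Y) (double_map Z))"
      using ah
      by (simp add: P.tsum_comult_pure b double_map_pure mult_A_on_H
          bilin_sw_left[OF bilin_tens] bilin_sw_right[OF bilin_tens])
        (intro sw_cong refl sw_swap; simp)
    finally show "comult P'.D (double_map (tens A H a h))
        = tsum P.T P.T ?TT (comult P.D (tens A H a h)) (\<lambda>Y Z. tens P'.T P'.T (double_map Y) (double_map Z))" .
  qed (use X in \<open>simp_all add: P.lin_tsum_comult b c lin_double_map\<close>)
qed

lemma double_map_counit:
  assumes X: "X \<in> carrier P.T"
  shows "counit P'.D (double_map X) = counit P.D X"
proof (rule P.double_ext[where P = KM and f = "\<lambda>X. counit P'.D (double_map X)" and g = "counit P.D"])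
  fix a h assume ah: "a \<in> carrier A" "h \<in> carrier H"
  have "counit P'.D (double_map (tens A H a h))
      = sw H KM h (\<lambda>h1 h2. counit H h1 \<bullet> (counit A a \<bullet> counit H h2))"
    using ah
    by (simp add: double_map_pure mult_A_on_H lin_sw[OF _ _ P'.lin_counit_double] P'.counit_double_pure K.m_ac)
  also have "\<dots> = counit A a \<bullet> counit H h"
    using sw_counit_left[of H KM h "\<lambda>h2. counit A a \<bullet> counit H h2"] ah by simp
  finally show "counit P'.D (double_map (tens A H a h)) = counit P.D (tens A H a h)"
    using ah by (simp add: P.counit_double_pure)
qed (use X in \<open>simp_all add: P.lin_counit_double lin_comp[OF P'.lin_counit_double] lin_double_map\<close>)

lemma double_map_one: "double_map (tens A H \<one>\<^bsub>A\<^esub> \<one>\<^bsub>H\<^esub>) = tens A H' \<one>\<^bsub>A\<^esub> \<one>\<^bsub>H'\<^esub>"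
  by (simp add: double_map_pure on_H_one)

subsubsection \<open>Bijectivity\<close>

definition "v_inv = inv_into (carrier H) v"

lemma v_bij: "bij_betw v (carrier H) (carrier H')"
  using v_iso by (simp add: coalgebra_iso_def)

lemma v_inv_v [simp]: "h \<in> carrier H \<Longrightarrow> v_inv (v h) = h"
  unfolding v_inv_def using v_bij by (simp add: bij_betw_inv_into_left)

lemma v_v_inv [simp]: "g \<in> carrier H' \<Longrightarrow> v (v_inv g) = g"
  unfolding v_inv_def using v_bij by (simp add: bij_betw_inv_into_right)

lemma v_inv_closed [simp]: "g \<in> carrier H' \<Longrightarrow> v_inv g \<in> carrier H"
  unfolding v_inv_def using v_bij by (metis bij_betw_def inv_into_into)

lemma lin_v_inv [simp]:
  assumes "lin M H' g" shows "lin M H (\<lambda>x. v_inv (g x))"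
proof (rule lin_comp[OF _ assms], rule linI)
  note vl = coalgebra_map_lin[OF v_coalg]
  show "v_inv (x \<oplus>\<^bsub>H'\<^esub> y) = v_inv x \<oplus>\<^bsub>H\<^esub> v_inv y" if "x \<in> carrier H'" "y \<in> carrier H'" for x y
    using that v_inv_v[of "v_inv x \<oplus>\<^bsub>H\<^esub> v_inv y"] by (simp add: lin_add[OF vl])
  show "v_inv (c \<odot>\<^bsub>H'\<^esub> x) = c \<odot>\<^bsub>H\<^esub> v_inv x" if "c \<in> carrier K" "x \<in> carrier H'" for c x
    using that v_inv_v[of "c \<odot>\<^bsub>H\<^esub> v_inv x"] by (simp add: lin_scale[OF vl])
qed simp

text \<open>As a coalgebra map, \<open>r\<close> has the convolution inverse \<open>S \<circ> r\<close>.\<close>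

lemma sw_r_antipode:
  assumes Q: "vs Q" and f: "lin A Q f" and a: "a \<in> carrier A" and z: "z \<in> carrier H"
  shows "sw H Q z (\<lambda>x y. f (a \<otimes>\<^bsub>A\<^esub> (r x \<otimes>\<^bsub>A\<^esub> antipode A (r y)))) = counit H z \<odot>\<^bsub>Q\<^esub> f a"
    and "sw H Q z (\<lambda>x y. f (a \<otimes>\<^bsub>A\<^esub> (antipode A (r x) \<otimes>\<^bsub>A\<^esub> r y))) = counit H z \<odot>\<^bsub>Q\<^esub> f a"
proof -
  have l: "lin A Q (\<lambda>z. f (a \<otimes>\<^bsub>A\<^esub> z))"
    using a by (intro lin_comp[OF f]) simp
  have b: "bilin A A Q (\<lambda>x y. f (a \<otimes>\<^bsub>A\<^esub> (x \<otimes>\<^bsub>A\<^esub> antipode A y)))"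
    "bilin A A Q (\<lambda>x y. f (a \<otimes>\<^bsub>A\<^esub> (antipode A x \<otimes>\<^bsub>A\<^esub> y)))"
    using a by (auto intro!: bilinI lin_comp[OF f])
  show "sw H Q z (\<lambda>x y. f (a \<otimes>\<^bsub>A\<^esub> (r x \<otimes>\<^bsub>A\<^esub> antipode A (r y)))) = counit H z \<odot>\<^bsub>Q\<^esub> f a"
    using sw_antipode_right[OF _ Q l, of "r z"] sw_r[OF z Q b(1)] a z by simp
  show "sw H Q z (\<lambda>x y. f (a \<otimes>\<^bsub>A\<^esub> (antipode A (r x) \<otimes>\<^bsub>A\<^esub> r y))) = counit H z \<odot>\<^bsub>Q\<^esub> f a"
    using sw_antipode_left[OF _ Q l, of "r z"] sw_r[OF z Q b(2)] a z by simp
qed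

text \<open>The inverse sends \<open>a \<otimes> y\<close> to \<open>a S(r(h\<^sub>1)) \<otimes> h\<^sub>2\<close>, where \<open>h\<close> is the preimage of \<open>y\<close> under
  \<open>v\<close>.\<close>

lemma double_map_bij: "bij_betw double_map (carrier P.T) (carrier P'.T)"
proof -
  define G where "G = (\<lambda>a y. sw H P.T (v_inv y) (\<lambda>h1 h2. tens A H (a \<otimes>\<^bsub>A\<^esub> antipode A (r h1)) h2))"
  define g where "g = (\<lambda>X. tsum A H' P.T X G)"
  have bG: "bilin A H' P.T G"
    unfolding G_def by (intro bilinI) simp_all
  have lg: "lin P'.T P.T g"
    unfolding g_def by (intro tsum_lin bG) simp_all
  have g_pure: "g (tens A H' a y) = sw H P.T (v_inv y) (\<lambda>h1 h2. tens A H (a \<otimes>\<^bsub>A\<^esub> antipode A (r h1)) h2)"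
    if "a \<in> carrier A" "y \<in> carrier H'" for a y
    unfolding g_def using that bG by (simp add: tsum_pure) (simp add: G_def)
  have lg': "lin M P.T (\<lambda>x. g (q x))" if "lin M P'.T q" for M :: "('k, ('a, 'h) tensor) module" and q
    by (rule lin_comp[OF lg that])
  have ld': "lin M P'.T (\<lambda>x. double_map (q x))" if "lin M P.T q" for M :: "('k, ('a, 'g) tensor) module" and q
    by (rule lin_comp[OF lin_double_map that])
  have gf: "g (double_map X) = X" if X: "X \<in> carrier P.T" for X
  proof (rule P.double_ext[where P = P.T and f = "\<lambda>X. g (double_map X)" and g = "\<lambda>X. X"])
    fix a h assume ah: "a \<in> carrier A" "h \<in> carrier H"
    have "g (double_map (tens A H a h))
        = sw H P.T h (\<lambda>x z. sw H P.T z (\<lambda>y b. tens A H (a \<otimes>\<^bsub>A\<^esub> (r x \<otimes>\<^bsub>A\<^esub> antipode A (r y))) b))"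
      using ah by (simp add: double_map_pure mult_A_on_H lin_sw[OF _ _ lg] g_pure alg_assoc)
    also have "\<dots> = sw H P.T h (\<lambda>z b. sw H P.T z (\<lambda>x y. tens A H (a \<otimes>\<^bsub>A\<^esub> (r x \<otimes>\<^bsub>A\<^esub> antipode A (r y))) b))"
      using ah by (intro sw_coassoc[symmetric]) simp_all
    also have "\<dots> = sw H P.T h (\<lambda>z b. counit H z \<odot>\<^bsub>P.T\<^esub> tens A H a b)"
      using ah by (intro sw_cong refl sw_r_antipode(1)[where f = "\<lambda>s. tens A H s _"]) simp_all
    also have "\<dots> = tens A H a h"
      using ah by (intro sw_counit_left) simp_all
    finally show "g (double_map (tens A H a h)) = tens A H a h" .
  qed (use X in \<open>simp_all add: lg' lin_double_map\<close>)
  have fg: "double_map (g X) = X" if X: "X \<in> carrier P'.T" for X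
  proof (rule P'.double_ext[where P = P'.T and f = "\<lambda>X. double_map (g X)" and g = "\<lambda>X. X"])
    fix a y assume ay: "a \<in> carrier A" "y \<in> carrier H'"
    have "double_map (g (tens A H' a y))
        = sw H P'.T (v_inv y) (\<lambda>x z. sw H P'.T z (\<lambda>y b. tens A H' (a \<otimes>\<^bsub>A\<^esub> (antipode A (r x) \<otimes>\<^bsub>A\<^esub> r y)) (v b)))"
      using ay by (simp add: g_pure lin_sw[OF _ _ lin_double_map] double_map_pure mult_A_on_H alg_assoc)
    also have "\<dots> = sw H P'.T (v_inv y) (\<lambda>z b. sw H P'.T z (\<lambda>x y. tens A H' (a \<otimes>\<^bsub>A\<^esub> (antipode A (r x) \<otimes>\<^bsub>A\<^esub> r y)) (v b)))"
      using ay by (intro sw_coassoc[symmetric]) simp_all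
    also have "\<dots> = sw H P'.T (v_inv y) (\<lambda>z b. counit H z \<odot>\<^bsub>P'.T\<^esub> tens A H' a (v b))"
      using ay by (intro sw_cong refl sw_r_antipode(2)[where f = "\<lambda>s. tens A H' s _"]) simp_all
    also have "\<dots> = tens A H' a (v (v_inv y))"
      using ay by (intro sw_counit_left[where f = "\<lambda>b. tens A H' a (v b)"]) simp_all
    finally show "double_map (g (tens A H' a y)) = tens A H' a y"
      using ay by simp
  qed (use X in \<open>simp_all add: lg ld'\<close>)
  show ?thesis
    by (rule bij_betw_byWitness[of _ g]) (use gf fg lin_closed[OF lg] in auto)
qed

end

subsection \<open>Multiplicativity\<close>

text \<open>The four conditions, in the form that the actions give them.\<close>

locale compatible_data = double_data K A H l H' l' r v
  for K :: "('k, 'r) ring_scheme" and A :: "('k, 'a, 'm) hopf_scheme"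
    and H :: "('k, 'h, 'n) hopf_scheme" and l :: "'h \<Rightarrow> 'a \<Rightarrow> 'k"
    and H' :: "('k, 'g, 'q) hopf_scheme" and l' :: "'g \<Rightarrow> 'a \<Rightarrow> 'k"
    and r :: "'h \<Rightarrow> 'a" and v :: "'h \<Rightarrow> 'g" +
  assumes r_mult: "\<lbrakk>h \<in> carrier H; g \<in> carrier H\<rbrakk> \<Longrightarrow>
      r (h \<otimes>\<^bsub>H\<^esub> g) = sw H A h (\<lambda>h1 h2. r h1 \<otimes>\<^bsub>A\<^esub> P'.act_l (v h2) (r g))"
    and v_mult: "\<lbrakk>h \<in> carrier H; g \<in> carrier H\<rbrakk> \<Longrightarrow>
      v (h \<otimes>\<^bsub>H\<^esub> g) = sw H H' g (\<lambda>g1 g2. P'.act_r (v h) (r g1) \<otimes>\<^bsub>H'\<^esub> v g2)"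
    and v_act: "\<lbrakk>h \<in> carrier H; a \<in> carrier A\<rbrakk> \<Longrightarrow> v (P.act_r h a) = P'.act_r (v h) a"
    and r_act: "\<lbrakk>h \<in> carrier H; a \<in> carrier A\<rbrakk> \<Longrightarrow>
      P.conjugate A (\<lambda>h a. a \<otimes>\<^bsub>A\<^esub> r h) h a = sw H A h (\<lambda>h1 h2. r h1 \<otimes>\<^bsub>A\<^esub> P'.act_l (v h2) a)"
begin

text \<open>By \<open>r_mult\<close> and \<open>v_mult\<close>, the map is multiplicative on \<open>H\<close>. By \<open>r_act\<close> and \<open>v_act\<close>, it respects
  the product of \<open>h\<close> and \<open>c\<close>, where multiplicativity of conjugation is used to split the image
  of that product into its two components. The general case follows by moving factors from \<open>A\<close> to
  the left.\<close>

lemma double_map_mult: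
  assumes X: "X \<in> carrier P.T" and Y: "Y \<in> carrier P.T"
  shows "double_map (P.dm X Y) = P'.dm (double_map X) (double_map Y)"
proof -
  let ?T = "P'.T" and ?i = "P'.in_A"
  let ?t = "\<lambda>p q g1 h2 s t. tens A H' (r p \<otimes>\<^bsub>A\<^esub> P'.act_l (v q) (r g1)) (P'.act_r (v h2) (r s) \<otimes>\<^bsub>H'\<^esub> v t)"
  have on_H_mult: "on_H (h \<otimes>\<^bsub>H\<^esub> g) = P'.dm (on_H h) (on_H g)" if h: "h \<in> carrier H" and g: "g \<in> carrier H" for h g
  proof -
    have "on_H (h \<otimes>\<^bsub>H\<^esub> g) = sw H ?T h (\<lambda>h1 h2. sw H ?T g (\<lambda>g1 g2. tens A H' (r (h1 \<otimes>\<^bsub>H\<^esub> g1)) (v (h2 \<otimes>\<^bsub>H\<^esub> g2))))"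
      using h g by (simp add: on_H_def sw_mult bilinI)
    also have "\<dots> = sw H ?T h (\<lambda>h1 h2. sw H ?T g (\<lambda>g1 g2. sw H ?T h1 (\<lambda>p q. sw H ?T g2 (\<lambda>s t. ?t p q g1 h2 s t))))"
      by (simp add: r_mult v_mult bilin_sw_left[OF bilin_tens] bilin_sw_right[OF bilin_tens])
        (intro sw_cong refl sw_swap; simp)
    also have "\<dots> = sw H ?T h (\<lambda>h1 h2. sw H ?T h1 (\<lambda>p q. sw H ?T g (\<lambda>g1 g2. sw H ?T g2 (\<lambda>s t. ?t p q g1 h2 s t))))"
      by (intro sw_cong refl sw_swap) simp_all
    also have "\<dots> = sw H ?T h (\<lambda>p z. sw H ?T z (\<lambda>q h2. sw H ?T g (\<lambda>g1 g2. sw H ?T g2 (\<lambda>s t. ?t p q g1 h2 s t))))"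
      using h by (intro sw_coassoc) simp_all
    also have "\<dots> = sw H ?T h (\<lambda>p z. sw H ?T z (\<lambda>q h2. sw H ?T g (\<lambda>g' t. sw H ?T g' (\<lambda>g1 s. ?t p q g1 h2 s t))))"
      using g by (intro sw_cong refl sw_coassoc[symmetric]) simp_all
    also have "\<dots> = sw H ?T h (\<lambda>p z. sw H ?T g (\<lambda>g' t. sw H ?T z (\<lambda>q h2. sw H ?T g' (\<lambda>g1 s. ?t p q g1 h2 s t))))"
      by (intro sw_cong refl sw_swap) simp_all
    also have "\<dots> = sw H ?T h (\<lambda>p z. sw H ?T g (\<lambda>g' t. P'.dm (tens A H' (r p) (v z)) (tens A H' (r g') (v t))))"
      by (simp add: P'.double_mult_actions sw_v sw_r bilinI)
    also have "\<dots> = P'.dm (on_H h) (on_H g)"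
      by (simp add: on_H_def bilin_sw_left[OF P'.bilin_double_mult] bilin_sw_right[OF P'.bilin_double_mult])
        (intro sw_swap; simp)
    finally show ?thesis .
  qed
  have on_H_act: "sw H ?T h (\<lambda>h1 h2. sw A ?T c (\<lambda>c1 c2. P'.dm (?i (P.act_l h1 c1)) (on_H (P.act_r h2 c2))))
      = P'.dm (on_H h) (?i c)" if h: "h \<in> carrier H" and c: "c \<in> carrier A" for h c
  proof -
    let ?B = "\<lambda>x y. P'.dm (?i x) (on_H y)"
    have "sw H ?T h (\<lambda>h1 h2. sw A ?T c (\<lambda>c1 c2. ?B (P.act_l h1 c1) (P.act_r h2 c2)))
        = P.conjugate ?T (\<lambda>h c. ?B c h) h c"
      using P.conv_actions[of ?T ?B h c] h c by (simp add: conv_def bilinI)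
    also have "\<dots> = P.conjugate ?T (conv H A ?T (tens A H') (\<lambda>h c. c \<otimes>\<^bsub>A\<^esub> r h) (\<lambda>h c. counit A c \<odot>\<^bsub>H'\<^esub> v h)) h c"
    proof (rule P.conjugate_cong)
      fix h c assume hc: "h \<in> carrier H" "c \<in> carrier A"
      have "sw A ?T c (\<lambda>c1 c2. tens A H' (c1 \<otimes>\<^bsub>A\<^esub> r h1) (counit A c2 \<odot>\<^bsub>H'\<^esub> v h2)) = tens A H' (c \<otimes>\<^bsub>A\<^esub> r h1) (v h2)"
        if "h1 \<in> carrier H" "h2 \<in> carrier H" for h1 h2
        using that hc sw_counit_right[of A ?T c "\<lambda>c. tens A H' (c \<otimes>\<^bsub>A\<^esub> r h1) (v h2)"] by (simp add: smult_tens_right)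
      then show "?B c h = conv H A ?T (tens A H') (\<lambda>h c. c \<otimes>\<^bsub>A\<^esub> r h) (\<lambda>h c. counit A c \<odot>\<^bsub>H'\<^esub> v h) h c"
        using hc by (simp add: conv_def mult_A_on_H)
    qed
    also have "\<dots> = conv H A ?T (tens A H') (P.conjugate A (\<lambda>h c. c \<otimes>\<^bsub>A\<^esub> r h))
        (P.conjugate H' (\<lambda>h c. counit A c \<odot>\<^bsub>H'\<^esub> v h)) h c"
      using h c by (intro P.conv_conjugate[symmetric] bilin_tens) (auto intro!: bilinI)
    also have "\<dots> = conv H A ?T (tens A H') (\<lambda>h a. sw H A h (\<lambda>h1 h2. r h1 \<otimes>\<^bsub>A\<^esub> P'.act_l (v h2) a))
        (\<lambda>h a. P'.act_r (v h) a) h c"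
    proof (rule conv_cong[OF r_act])
      note vl = coalgebra_map_lin[OF v_coalg]
      show "P.conjugate H' (\<lambda>h c. counit A c \<odot>\<^bsub>H'\<^esub> v h) h a = P'.act_r (v h) a"
        if "h \<in> carrier H" "a \<in> carrier A" for h a
        using that by (simp add: v_act[symmetric] P.act_right_conjugate P.lin_conjugate[OF _ _ vl] lin_scale[OF vl]
            cong: P.conjugate_cong)
    qed
    also have "\<dots> = sw H ?T h (\<lambda>h' h3. sw A ?T c (\<lambda>c1 c2. sw H ?T h' (\<lambda>h1 h2.
        tens A H' (r h1 \<otimes>\<^bsub>A\<^esub> P'.act_l (v h2) c1) (P'.act_r (v h3) c2))))"
      by (simp add: conv_def bilin_sw_left[OF bilin_tens])
    also have "\<dots> = sw H ?T h (\<lambda>h' h3. sw H ?T h' (\<lambda>h1 h2. sw A ?T c (\<lambda>c1 c2.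
        tens A H' (r h1 \<otimes>\<^bsub>A\<^esub> P'.act_l (v h2) c1) (P'.act_r (v h3) c2))))"
      by (intro sw_cong refl sw_swap) simp_all
    also have "\<dots> = sw H ?T h (\<lambda>h1 z. sw H ?T z (\<lambda>h2 h3. sw A ?T c (\<lambda>c1 c2.
        tens A H' (r h1 \<otimes>\<^bsub>A\<^esub> P'.act_l (v h2) c1) (P'.act_r (v h3) c2))))"
      using h by (intro sw_coassoc) simp_all
    also have "\<dots> = sw H ?T h (\<lambda>h1 z. P'.dm (tens A H' (r h1) (v z)) (?i c))"
      using c by (simp add: P'.double_mult_actions sw_v bilinI)
    also have "\<dots> = P'.dm (on_H h) (?i c)"
      using c by (simp add: on_H_def bilin_sw_left[OF P'.bilin_double_mult])
    finally show ?thesis .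
  qed
  have pure: "double_map (P.dm (tens A H a h) (tens A H c g))
      = P'.dm (double_map (tens A H a h)) (double_map (tens A H c g))"
    if "a \<in> carrier A" "h \<in> carrier H" "c \<in> carrier A" "g \<in> carrier H" for a h c g
  proof -
    have "double_map (P.dm (tens A H a h) (tens A H c g))
        = sw H ?T h (\<lambda>h1 h2. sw A ?T c (\<lambda>c1 c2. P'.dm (?i (a \<otimes>\<^bsub>A\<^esub> P.act_l h1 c1)) (on_H (P.act_r h2 c2 \<otimes>\<^bsub>H\<^esub> g))))"
      using that by (simp add: P.double_mult_actions lin_sw[OF _ _ lin_double_map] double_map_pure)
    also have "\<dots> = sw H ?T h (\<lambda>h1 h2. sw A ?T c (\<lambda>c1 c2.
        P'.dm (?i a) (P'.dm (P'.dm (?i (P.act_l h1 c1)) (on_H (P.act_r h2 c2))) (on_H g))))"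
      using that by (simp add: on_H_mult P'.mult_A_assoc)
    also have "\<dots> = P'.dm (?i a) (P'.dm (P'.dm (on_H h) (?i c)) (on_H g))"
      using that by (simp add: on_H_act[symmetric]
          lin_sw[where \<phi> = "\<lambda>z. P'.dm (?i a) (P'.dm z (on_H g))" and P = ?T and Q = ?T])
    also have "\<dots> = P'.dm (P'.dm (?i a) (on_H h)) (P'.dm (?i c) (on_H g))"
      using that by (simp add: P'.mult_middle_A_assoc P'.mult_A_assoc)
    finally show ?thesis
      using that by (simp add: double_map_pure)
  qed
  show ?thesis
  proof (rule P.double_ext[where P = ?T and f = "\<lambda>X. double_map (P.dm X Y)" and
        g = "\<lambda>X. P'.dm (double_map X) (double_map Y)"])
    fix a h assume ah: "a \<in> carrier A" "h \<in> carrier H"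
    show "double_map (P.dm (tens A H a h) Y) = P'.dm (double_map (tens A H a h)) (double_map Y)"
      by (rule P.double_ext[where P = ?T and f = "\<lambda>Y. double_map (P.dm (tens A H a h) Y)" and
          g = "\<lambda>Y. P'.dm (double_map (tens A H a h)) (double_map Y)"])
        (use ah Y in \<open>simp_all add: pure lin_double_map\<close>)
  qed (use X Y in \<open>simp_all add: lin_double_map\<close>)
qed

lemma hopf_iso_double_map:
  shows "hopf_iso K P.D P'.D double_map" "left_linear K A H l H' l' double_map"
proof -
  have "double_map \<in> ring_hom P.D P'.D"
    by (intro ring_hom_memI) (simp_all add: double_map_mult double_map_one lin_add[OF lin_double_map])
  moreover have "coalgebra_map K P.D P'.D double_map"
    unfolding coalgebra_map_def
  proof (intro conjI ballI)
    fix X assume X: "X \<in> carrier P.D"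
    have "bilin P.T P.T (P'.T \<boxtimes> P'.T) (\<lambda>Y Z. tens P'.T P'.T (double_map Y) (double_map Z))"
      by (auto intro!: bilinI simp: lin_double_map)
    then show "comult P'.D (double_map X) = sweedler2 P.D (tensor_module K P'.D P'.D) X
        (\<lambda>Y Z. tens P'.D P'.D (double_map Y) (double_map Z))"
      using X by (simp add: P.sweedler2_double double_map_coalgebra)
    show "counit P'.D (double_map X) = counit P.D X"
      using X by (simp add: double_map_counit)
  qed (simp add: lin_double_map)
  ultimately show "hopf_iso K P.D P'.D double_map"
    by (simp add: hopf_iso_def double_map_bij)
  show "left_linear K A H l H' l' double_map"
    by (simp add: left_linear_def double_map_left_linear)
qed

end

subsection \<open>From an isomorphism to maps\<close>

locale double_iso = two_pairings K A H l H' l'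
  for K :: "('k, 'r) ring_scheme" and A :: "('k, 'a, 'm) hopf_scheme"
    and H :: "('k, 'h, 'n) hopf_scheme" and l :: "'h \<Rightarrow> 'a \<Rightarrow> 'k"
    and H' :: "('k, 'g, 'q) hopf_scheme" and l' :: "'g \<Rightarrow> 'a \<Rightarrow> 'k" +
  fixes f :: "('a, 'h) tensor \<Rightarrow> ('a, 'g) tensor"
  assumes iso: "hopf_iso K (quantum_double K A H l) (quantum_double K A H' l') f"
    and left_lin: "left_linear K A H l H' l' f"
begin

lemma f_hom: "f \<in> ring_hom P.D P'.D"
  and f_coalg: "coalgebra_map K P.D P'.D f"
  and f_bij: "bij_betw f (carrier P.T) (carrier P'.T)"
  using iso by (simp_all add: hopf_iso_def)

lemma lin_f: "lin P.T P'.T f"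
  using f_coalg by (simp add: coalgebra_map_def)

lemma lin_f_comp [simp]: "lin M P.T g \<Longrightarrow> lin M P'.T (\<lambda>x. f (g x))"
  by (rule lin_comp[OF lin_f])

lemma f_closed [simp]: "X \<in> carrier P.T \<Longrightarrow> f X \<in> carrier P'.T"
  by (rule lin_closed[OF lin_f])

lemma f_mult: "X \<in> carrier P.T \<Longrightarrow> Y \<in> carrier P.T \<Longrightarrow> f (P.dm X Y) = P'.dm (f X) (f Y)"
  using ring_hom_mult[OF f_hom, of X Y] by simp

lemma f_one: "f (tens A H \<one>\<^bsub>A\<^esub> \<one>\<^bsub>H\<^esub>) = tens A H' \<one>\<^bsub>A\<^esub> \<one>\<^bsub>H'\<^esub>"
  using ring_hom_one[OF f_hom] by simp

lemma f_left:
  "a \<in> carrier A \<Longrightarrow> X \<in> carrier P.T \<Longrightarrow>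
    f (P.dm (P.in_A a) X) = P'.dm (P'.in_A a) (f X)"
  using left_lin by (simp add: left_linear_def)

definition "r h = P'.proj_A (f (P.in_H h))"
definition "v h = P'.proj_H (f (P.in_H h))"

lemma rv_closed [simp]: "h \<in> carrier H \<Longrightarrow> r h \<in> carrier A" "h \<in> carrier H \<Longrightarrow> v h \<in> carrier H'"
  by (simp_all add: r_def v_def)

lemma lin_rv [simp]: "lin M H g \<Longrightarrow> lin M A (\<lambda>x. r (g x))" "lin M H g \<Longrightarrow> lin M H' (\<lambda>x. v (g x))"
  by (simp_all add: r_def v_def)

lemma comult_f:
  assumes h: "h \<in> carrier H"
  shows "comult P'.D (f (P.in_H h)) = sw H (P'.T \<boxtimes> P'.T) h (\<lambda>h1 h2.
      tens P'.T P'.T (f (P.in_H h1)) (f (P.in_H h2)))"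
proof -
  have b: "bilin P.T P.T (P'.T \<boxtimes> P'.T) (\<lambda>Y Z. tens P'.T P'.T (f Y) (f Z))"
    by (auto intro!: bilinI simp: lin_f)
  have "comult P'.D (f (P.in_H h))
      = sweedler2 P.D (P'.T \<boxtimes> P'.T) (P.in_H h) (\<lambda>Y Z. tens P'.T P'.T (f Y) (f Z))"
    using f_coalg h by (simp add: coalgebra_map_def)
  then show ?thesis
    using h b by (simp add: P.sweedler2_double P.tsum_comult_pure sw_one bilinI)
qed

lemma tsum_comult_f:
  assumes h: "h \<in> carrier H" and P: "vs P" and q: "bilin P'.T P'.T P q"
  shows "tsum P'.T P'.T P (comult P'.D (f (P.in_H h))) q
    = sw H P h (\<lambda>h1 h2. q (f (P.in_H h1)) (f (P.in_H h2)))"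
  using h P q by (simp add: comult_f lin_sw[OF _ P tsum_lin[OF _ _ P q]] tsum_pure)

text \<open>A coalgebra map into the tensor product of two coalgebras is the product of its components,
  in either order.\<close>

lemma f_eq:
  assumes h: "h \<in> carrier H"
  shows "f (P.in_H h) = sw H P'.T h (\<lambda>h1 h2. tens A H' (r h1) (v h2))"
    and "f (P.in_H h) = sw H P'.T h (\<lambda>h1 h2. tens A H' (r h2) (v h1))"
proof -
  have b: "bilin P'.T P'.T P'.T (\<lambda>Y Z. tens A H' (P'.proj_A Y) (P'.proj_H Z))"
    "bilin P'.T P'.T P'.T (\<lambda>Y Z. tens A H' (P'.proj_A Z) (P'.proj_H Y))"
    by (auto intro!: bilinI simp: P'.lin_proj)
  show "f (P.in_H h) = sw H P'.T h (\<lambda>h1 h2. tens A H' (r h1) (v h2))"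
    "f (P.in_H h) = sw H P'.T h (\<lambda>h1 h2. tens A H' (r h2) (v h1))"
    using P'.comult_proj_split[of "f (P.in_H h)"] h
    by (simp_all add: tsum_comult_f b r_def v_def)
qed

lemma f_pure:
  assumes "a \<in> carrier A" "h \<in> carrier H"
  shows "f (tens A H a h) = P'.dm (P'.in_A a) (f (P.in_H h))"
  using f_left[of a "P.in_H h"] assms by simp

lemma proj_f_pure:
  assumes "a \<in> carrier A" "h \<in> carrier H"
  shows "P'.proj_A (f (tens A H a h)) = a \<otimes>\<^bsub>A\<^esub> r h" "P'.proj_H (f (tens A H a h)) = counit A a \<odot>\<^bsub>H'\<^esub> v h"
  using assms by (simp_all add: f_pure[OF assms] P'.proj_mult_A r_def v_def)

text \<open>So \<open>f\<close> induces \<open>v\<close> on the quotient \<open>H\<close> of the double; the same holds for the inverse of \<open>f\<close>,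
  whence \<open>v\<close> is bijective.\<close>

lemma proj_H_f:
  assumes "X \<in> carrier P.T"
  shows "P'.proj_H (f X) = v (P.proj_H X)"
  by (rule P.double_ext[where P = H' and f = "\<lambda>X. P'.proj_H (f X)" and g = "\<lambda>X. v (P.proj_H X)"])
    (use assms lin_scale[OF lin_rv(2)[OF lin_id]] in \<open>simp_all add: proj_f_pure P.lin_proj lin_f\<close>)

lemma coalgebra_maps: "coalgebra_map K H A r" "coalgebra_map K H H' v"
proof -
  have A: "bilin P'.T P'.T (A \<boxtimes> A) (\<lambda>Y Z. tens A A (P'.proj_A Y) (P'.proj_A Z))"
    and H: "bilin P'.T P'.T (H' \<boxtimes> H') (\<lambda>Y Z. tens H' H' (P'.proj_H Y) (P'.proj_H Z))"
    by (auto intro!: bilinI simp: P'.lin_proj)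
  have eps: "counit P'.D (f (P.in_H h)) = counit H h" if "h \<in> carrier H" for h
    using f_coalg that by (simp add: coalgebra_map_def P.counit_double_pure)
  show "coalgebra_map K H A r"
    unfolding coalgebra_map_def
  proof (intro conjI ballI)
    fix h assume h: "h \<in> carrier H"
    have "sweedler2 H (A \<boxtimes> A) h (\<lambda>h1 h2. tens A A (r h1) (r h2)) = sw H (A \<boxtimes> A) h (\<lambda>h1 h2. tens A A (r h1) (r h2))"
      using h by (intro sweedler2_sw_lin) simp_all
    then show "comult A (r h) = sweedler2 H (A \<boxtimes> A) h (\<lambda>h1 h2. tens A A (r h1) (r h2))"
      using h by (simp add: r_def P'.comult_proj_A tsum_comult_f A)
    show "counit A (r h) = counit H h"
      using h by (simp add: r_def P'.counit_proj eps)
  qed (use lin_rv(1)[OF lin_id] in simp)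
  show "coalgebra_map K H H' v"
    unfolding coalgebra_map_def
  proof (intro conjI ballI)
    fix h assume h: "h \<in> carrier H"
    have "sweedler2 H (H' \<boxtimes> H') h (\<lambda>h1 h2. tens H' H' (v h1) (v h2)) = sw H (H' \<boxtimes> H') h (\<lambda>h1 h2. tens H' H' (v h1) (v h2))"
      using h by (intro sweedler2_sw_lin) simp_all
    then show "comult H' (v h) = sweedler2 H (H' \<boxtimes> H') h (\<lambda>h1 h2. tens H' H' (v h1) (v h2))"
      using h by (simp add: v_def P'.comult_proj_H tsum_comult_f H)
    show "counit H' (v h) = counit H h"
      using h by (simp add: v_def P'.counit_proj eps)
  qed (use lin_rv(2)[OF lin_id] in simp)
qed

text \<open>The map that the inverse of \<open>f\<close> induces.\<close>

definition "w y = P.proj_H (inv_into (carrier P.T) f (P'.in_H y))"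

lemma w_facts:
  shows lin_w: "lin H' H w"
    and w_v: "h \<in> carrier H \<Longrightarrow> w (v h) = h"
    and v_w: "y \<in> carrier H' \<Longrightarrow> v (w y) = y"
proof -
  define g where "g = inv_into (carrier P.T) f"
  have gf: "g (f X) = X" if "X \<in> carrier P.T" for X
    unfolding g_def using f_bij that by (simp add: bij_betw_inv_into_left)
  have fg: "f (g Y) = Y" if "Y \<in> carrier P'.T" for Y
    unfolding g_def using f_bij that by (simp add: bij_betw_inv_into_right)
  have gc [simp]: "g Y \<in> carrier P.T" if "Y \<in> carrier P'.T" for Y
    unfolding g_def using f_bij that by (metis bij_betw_def inv_into_into)
  have lg: "lin P'.T P.T g"
  proof (rule linI)
    show "g (x \<oplus>\<^bsub>P'.T\<^esub> y) = g x \<oplus>\<^bsub>P.T\<^esub> g y" if "x \<in> carrier P'.T" "y \<in> carrier P'.T" for x y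
      using that gf[of "g x \<oplus>\<^bsub>P.T\<^esub> g y"] by (simp add: lin_add[OF lin_f] fg)
    show "g (c \<odot>\<^bsub>P'.T\<^esub> x) = c \<odot>\<^bsub>P.T\<^esub> g x" if "c \<in> carrier K" "x \<in> carrier P'.T" for c x
      using that gf[of "c \<odot>\<^bsub>P.T\<^esub> g x"] by (simp add: lin_scale[OF lin_f] fg)
  qed simp
  have w: "w y = P.proj_H (g (P'.in_H y))" for y
    by (simp add: w_def g_def)
  show lw: "lin H' H w"
    unfolding w[abs_def] by (simp add: lin_comp[OF lg])
  have g_pure: "g (tens A H' a y) = P.dm (P.in_A a) (g (P'.in_H y))"
    if "a \<in> carrier A" "y \<in> carrier H'" for a y
    using that gf[of "P.dm (P.in_A a) (g (P'.in_H y))"] by (simp add: f_left fg)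
  have proj_g: "P.proj_H (g Y) = w (P'.proj_H Y)" if "Y \<in> carrier P'.T" for Y
  proof (rule P'.double_ext[where P = H and f = "\<lambda>Y. P.proj_H (g Y)" and g = "\<lambda>Y. w (P'.proj_H Y)"])
    fix a y assume ay: "a \<in> carrier A" "y \<in> carrier H'"
    then show "P.proj_H (g (tens A H' a y)) = w (P'.proj_H (tens A H' a y))"
      by (subst g_pure) (simp_all add: P.proj_mult_A lin_scale[OF lw] w[symmetric])
  qed (use that in \<open>simp_all add: lg lin_comp[OF lw] P'.lin_proj\<close>)
  show "w (v h) = h" if "h \<in> carrier H"
    using that proj_g[of "f (P.in_H h)"] by (simp add: v_def gf)
  show "v (w y) = y" if "y \<in> carrier H'"
    using that by (simp add: w proj_H_f[symmetric] fg)
qed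

lemma v_iso: "coalgebra_iso K H H' v"
  unfolding coalgebra_iso_def
  using coalgebra_maps(2) w_v v_w lin_closed[OF lin_w]
  by (auto intro!: bij_betw_byWitness[of _ w])

text \<open>Apply the inverse of \<open>v\<close> to the second leg of the two formulas in \<open>f_eq\<close>.\<close>

lemma r_cocentral: "cocentral_map K H A r"
  unfolding cocentral_map_def
proof (intro conjI ballI coalgebra_maps)
  fix h assume h: "h \<in> carrier H"
  define \<Psi> where "\<Psi> = (\<lambda>X. tsum A H' P.T X (\<lambda>a y. tens A H a (w y)))"
  have b: "bilin A H' P.T (\<lambda>a y. tens A H a (w y))"
    by (intro bilinI) (simp_all add: lin_w lin_closed[OF lin_w])
  have \<Psi>: "lin P'.T P.T \<Psi>" unfolding \<Psi>_def by (intro tsum_lin b) simp_all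
  have \<Psi>_pure: "\<Psi> (tens A H' a (v x)) = tens A H a x" if "a \<in> carrier A" "x \<in> carrier H" for a x
    unfolding \<Psi>_def using that b by (simp add: tsum_pure w_v)
  have "\<Psi> (sw H P'.T h (\<lambda>h1 h2. tens A H' (r h1) (v h2))) = \<Psi> (sw H P'.T h (\<lambda>h1 h2. tens A H' (r h2) (v h1)))"
    using f_eq[OF h] by simp
  then have "sw H P.T h (\<lambda>h1 h2. tens A H (r h1) h2) = sw H P.T h (\<lambda>h1 h2. tens A H (r h2) h1)"
    by (simp add: lin_sw[OF _ _ \<Psi>] \<Psi>_pure)
  moreover have "sweedler2 H P.T h (\<lambda>h1 h2. tens A H (r h1) h2) = sw H P.T h (\<lambda>h1 h2. tens A H (r h1) h2)"
    "sweedler2 H P.T h (\<lambda>h1 h2. tens A H (r h2) h1) = sw H P.T h (\<lambda>h1 h2. tens A H (r h2) h1)"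
    using h by (intro sweedler2_sw_lin; simp)+
  ultimately show "sweedler2 H P.T h (\<lambda>h1 h2. tens A H (r h1) h2) = sweedler2 H P.T h (\<lambda>h1 h2. tens A H (r h2) h1)"
    by simp
qed

lemma rv_one: "r \<one>\<^bsub>H\<^esub> = \<one>\<^bsub>A\<^esub>" "v \<one>\<^bsub>H\<^esub> = \<one>\<^bsub>H'\<^esub>"
  by (simp_all add: r_def v_def f_one)

sublocale double_data K A H l H' l' r v
  by unfold_locales (simp_all add: r_cocentral v_iso rv_one)

text \<open>The two components of \<open>f(1 \<bowtie> hg) = f(1 \<bowtie> h) f(1 \<bowtie> g)\<close>.\<close>

lemma rv_mult:
  assumes h: "h \<in> carrier H" and g: "g \<in> carrier H"
  shows "r (h \<otimes>\<^bsub>H\<^esub> g) = sw H A h (\<lambda>h1 h2. r h1 \<otimes>\<^bsub>A\<^esub> P'.act_l (v h2) (r g))"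
    and "v (h \<otimes>\<^bsub>H\<^esub> g) = sw H H' g (\<lambda>g1 g2. P'.act_r (v h) (r g1) \<otimes>\<^bsub>H'\<^esub> v g2)"
proof -
  have "f (P.in_H (h \<otimes>\<^bsub>H\<^esub> g)) = P'.dm (f (P.in_H h)) (f (P.in_H g))"
    using h g by (simp add: f_mult[symmetric])
  also have "\<dots> = sw H P'.T h (\<lambda>h1 h2. sw H P'.T g (\<lambda>g1 g2.
      P'.dm (tens A H' (r h1) (v h2)) (tens A H' (r g1) (v g2))))"
    using h g
    by (simp add: f_eq(1) bilin_sw_left[OF P'.bilin_double_mult] bilin_sw_right[OF P'.bilin_double_mult])
      (intro sw_swap; simp)
  finally have f: "f (P.in_H (h \<otimes>\<^bsub>H\<^esub> g)) = sw H P'.T h (\<lambda>h1 h2. sw H P'.T g (\<lambda>g1 g2.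
      P'.dm (tens A H' (r h1) (v h2)) (tens A H' (r g1) (v g2))))" .
  have "r (h \<otimes>\<^bsub>H\<^esub> g) = sw H A h (\<lambda>h1 h2. sw H A g (\<lambda>g1 g2.
      counit H g2 \<odot>\<^bsub>A\<^esub> (r h1 \<otimes>\<^bsub>A\<^esub> P'.act_l (v h2) (r g1))))"
    unfolding r_def[of "h \<otimes>\<^bsub>H\<^esub> g"] f by (simp add: lin_sw[OF _ _ P'.lin_proj(1)] P'.proj_mult)
  also have "\<dots> = sw H A h (\<lambda>h1 h2. r h1 \<otimes>\<^bsub>A\<^esub> P'.act_l (v h2) (r g))"
    using g by (intro sw_cong refl sw_counit_right[where f = "\<lambda>g. r _ \<otimes>\<^bsub>A\<^esub> P'.act_l (v _) (r g)"]) simp_all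
  finally show "r (h \<otimes>\<^bsub>H\<^esub> g) = sw H A h (\<lambda>h1 h2. r h1 \<otimes>\<^bsub>A\<^esub> P'.act_l (v h2) (r g))" .
  have "v (h \<otimes>\<^bsub>H\<^esub> g) = sw H H' h (\<lambda>h1 h2. counit H h1 \<odot>\<^bsub>H'\<^esub> sw H H' g (\<lambda>g1 g2.
      P'.act_r (v h2) (r g1) \<otimes>\<^bsub>H'\<^esub> v g2))"
    unfolding v_def[of "h \<otimes>\<^bsub>H\<^esub> g"] f by (simp add: lin_sw[OF _ _ P'.lin_proj(2)] P'.proj_mult smult_sw)
  also have "\<dots> = sw H H' g (\<lambda>g1 g2. P'.act_r (v h) (r g1) \<otimes>\<^bsub>H'\<^esub> v g2)"
    using h by (intro sw_counit_left) simp_all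
  finally show "v (h \<otimes>\<^bsub>H\<^esub> g) = sw H H' g (\<lambda>g1 g2. P'.act_r (v h) (r g1) \<otimes>\<^bsub>H'\<^esub> v g2)" .
qed

text \<open>The two components of the image under \<open>f\<close> of \<open>(1 \<bowtie> h)(a \<bowtie> 1)\<close>.\<close>

lemma rv_act:
  assumes h: "h \<in> carrier H" and a: "a \<in> carrier A"
  shows "v (P.act_r h a) = P'.act_r (v h) a"
    and "P.conjugate A (\<lambda>h a. a \<otimes>\<^bsub>A\<^esub> r h) h a = sw H A h (\<lambda>h1 h2. r h1 \<otimes>\<^bsub>A\<^esub> P'.act_l (v h2) a)"
proof -
  let ?X = "P.dm (P.in_H h) (P.in_A a)"
  have "f (P.in_A a) = P'.in_A a"
    using a by (simp add: f_pure[of a] f_one)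
  then have f: "f ?X = sw H P'.T h (\<lambda>h1 h2. P'.dm (tens A H' (r h1) (v h2)) (P'.in_A a))"
    using h a by (simp add: f_mult f_eq(1) bilin_sw_left[OF P'.bilin_double_mult])
  have "v (P.act_r h a) = P'.proj_H (f ?X)"
    using h a by (simp add: proj_H_f P.proj_mult)
  also have "\<dots> = sw H H' h (\<lambda>h1 h2. counit H h1 \<odot>\<^bsub>H'\<^esub> P'.act_r (v h2) a)"
    using a by (simp add: f lin_sw[OF _ _ P'.lin_proj(2)] P'.proj_mult)
  also have "\<dots> = P'.act_r (v h) a"
    using h a by (intro sw_counit_left) simp_all
  finally show "v (P.act_r h a) = P'.act_r (v h) a" .
  have "P.conjugate A (\<lambda>h a. a \<otimes>\<^bsub>A\<^esub> r h) h a
      = sw H A h (\<lambda>h1 h2. sw A A a (\<lambda>a1 a2. P.act_l h1 a1 \<otimes>\<^bsub>A\<^esub> r (P.act_r h2 a2)))"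
    using P.conv_actions[of A "\<lambda>x y. x \<otimes>\<^bsub>A\<^esub> r y" h a] h a by (simp add: conv_def bilinI)
  also have "\<dots> = P'.proj_A (f ?X)"
    using h a
    by (simp add: P.double_mult_actions lin_sw[OF _ _ lin_f] lin_sw[OF _ _ P'.lin_proj(1)] proj_f_pure)
  also have "\<dots> = sw H A h (\<lambda>h1 h2. r h1 \<otimes>\<^bsub>A\<^esub> P'.act_l (v h2) a)"
    using a by (simp add: f lin_sw[OF _ _ P'.lin_proj(1)] P'.proj_mult)
  finally show "P.conjugate A (\<lambda>h a. a \<otimes>\<^bsub>A\<^esub> r h) h a = sw H A h (\<lambda>h1 h2. r h1 \<otimes>\<^bsub>A\<^esub> P'.act_l (v h2) a)" .
qed

end

theorem corollary3p9:
  fixes K :: "('k, 'r) ring_scheme"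
    and A :: "('k, 'a, 'm) hopf_scheme"
    and H :: "('k, 'h, 'n) hopf_scheme"
    and H' :: "('k, 'g, 'q) hopf_scheme"
    and l :: "'h \<Rightarrow> 'a \<Rightarrow> 'k"
    and l' :: "'g \<Rightarrow> 'a \<Rightarrow> 'k"
  assumes "field K"
    and "hopf_algebra K A"
    and "hopf_algebra K H"
    and "hopf_algebra K H'"
    and "skew_pairing K H A l"
    and "skew_pairing K H' A l'"
  shows "(\<exists>f. hopf_iso K (quantum_double K A H l) (quantum_double K A H' l') f \<and>
              left_linear K A H l H' l' f)
    \<longleftrightarrow>
    (\<exists>r v.
       cocentral_map K H A r \<and> unitary H A r \<and>
       coalgebra_iso K H H' v \<and> unitary H H' v \<and>
       (\<forall>h\<in>carrier H. \<forall>g\<in>carrier H.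
          r (h \<otimes>\<^bsub>H\<^esub> g) =
            sweedler2 H A h (\<lambda>h1 h2. sweedler3 H A g (\<lambda>g1 g2 g3.
              l' (v h2) (r g3 \<otimes>\<^bsub>A\<^esub> antipode A (r g1)) \<odot>\<^bsub>A\<^esub> (r h1 \<otimes>\<^bsub>A\<^esub> r g2)))) \<and>
       (\<forall>h\<in>carrier H. \<forall>g\<in>carrier H.
          v (h \<otimes>\<^bsub>H\<^esub> g) =
            sweedler3 H H' h (\<lambda>h1 h2 h3. sweedler2 H H' g (\<lambda>g1 g2.
              l' (antipode H' (v h1) \<otimes>\<^bsub>H'\<^esub> v h3) (r g1) \<odot>\<^bsub>H'\<^esub> (v h2 \<otimes>\<^bsub>H'\<^esub> v g2)))) \<and>
       (\<forall>h\<in>carrier H. \<forall>a\<in>carrier A.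
          sweedler3 H H' h (\<lambda>h1 h2 h3. l (antipode H h1 \<otimes>\<^bsub>H\<^esub> h3) a \<odot>\<^bsub>H'\<^esub> v h2) =
          sweedler3 H H' h (\<lambda>h1 h2 h3.
            l' (antipode H' (v h1) \<otimes>\<^bsub>H'\<^esub> v h3) a \<odot>\<^bsub>H'\<^esub> v h2)) \<and>
       (\<forall>h\<in>carrier H. \<forall>a\<in>carrier A.
          sweedler3 H A h (\<lambda>h1 h2 h3. sweedler3 A A a (\<lambda>a1 a2 a3.
            (l (antipode H h1) a1 \<otimes>\<^bsub>K\<^esub> l h3 a3) \<odot>\<^bsub>A\<^esub> (a2 \<otimes>\<^bsub>A\<^esub> r h2))) =
          sweedler3 H A h (\<lambda>h1 h2 h3. sweedler3 A A a (\<lambda>a1 a2 a3.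
            (l' (v h3) a3 \<otimes>\<^bsub>K\<^esub> l' (antipode H' (v h2)) a1) \<odot>\<^bsub>A\<^esub> (r h1 \<otimes>\<^bsub>A\<^esub> a2)))))"
  (is "?iso \<longleftrightarrow> (\<exists>r v. ?maps r v)")
proof -
  interpret two_pairings K A H l H' l'
    by (intro two_pairings.intro scalars.intro pairing.intro pairing_axioms.intro assms)
  show ?thesis
  proof
    assume ?iso
    then obtain f where "hopf_iso K (quantum_double K A H l) (quantum_double K A H' l') f"
      "left_linear K A H l H' l' f" by blast
    then interpret double_iso K A H l H' l' f
      by unfold_locales
    have "?maps r v"
      using cocentral v_iso
      by (auto simp: unitary_def r_condition_actions v_condition_actions
          act_right_condition_left act_right_condition_right act_left_condition_left
          act_left_condition_right rv_mult rv_act)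
    then show "\<exists>r v. ?maps r v" by blast
  next
    assume "\<exists>r v. ?maps r v"
    then obtain r v where maps: "?maps r v" by blast
    interpret double_data K A H l H' l' r v
      using maps by unfold_locales (simp_all add: unitary_def)
    interpret compatible_data K A H l H' l' r v
      using maps
      by unfold_locales
        (simp_all add: r_condition_actions v_condition_actions act_right_condition_left
          act_right_condition_right act_left_condition_left act_left_condition_right)
    have "hopf_iso K P.D P'.D double_map \<and> left_linear K A H l H' l' double_map"
      by (intro conjI hopf_iso_double_map)
    then show ?iso by blast
  qed
qed

end
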